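(* Let $K$ be a field, let $n\geq 3$ be an integer, let $S=K[x_1,\ldots,x_n]$, and let $I_n=(x_1x_2,\,x_2x_3,\ldots,x_{n-1}x_n)\subset S$ and $J_n=I_n+(x_nx_1)\subset S$. Then $$\operatorname{sdepth}(J_n/I_n)=\operatorname{depth}(J_n/I_n)=\left\lceil\frac{n+2}{3}\right\rceil.$$
   Context: Let $M$ be a nonzero $\mathbb Z^n$-graded $S$-module. A Stanley decomposition of $M$ is a direct sum $\mathcal D: M=\bigoplus_{i=1}^r m_iK[Z_i]$ as $\mathbb Z^n$-graded $K$-vector spaces, where each $m_i\in M$ is homogeneous with respect to the $\mathbb Z^n$-grading, $Z_i\subset\{x_1,\ldots,x_n\}$, and $m_iK[Z_i]=\{um_i:\ u\in K[Z_i]\}\subset M$ is a free $K[Z_i]$-submodule of $M$. Put $\operatorname{sdepth}(\mathcal D)=\min_{i}|Z_i|$. The Stanley depth $\operatorname{sdepth}(M)$ is the maximum of $\operatorname{sdepth}(\mathcal D)$ over all Stanley decompositions $\mathcal D$ of $M$. The depth $\operatorname{depth}(M)$ is taken with respect to the graded maximal ideal $(x_1,\ldots,x_n)$. *)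

theory Defs
  imports Complex_Main "HOL-Library.Poly_Mapping" "HOL-Algebra.Ideal" "HOL-Algebra.Module"
begin

section \<open>Polynomial rings\<close>

text \<open>
  Polynomials in variables indexed by natural numbers: a monomial is its exponent function of
  finite support, a polynomial is a finitely supported function from monomials to coefficients,
  and multiplication is the convolution product supplied by \<^theory>\<open>HOL-Library.Poly_Mapping\<close>.
\<close>

type_synonym 'k mpolynomial = "(nat \<Rightarrow>\<^sub>0 nat) \<Rightarrow>\<^sub>0 'k"

definition var :: "nat \<Rightarrow> 'k::field mpolynomial"
  where "var i = Poly_Mapping.single (Poly_Mapping.single i 1) 1"

text \<open>\<open>poly_ring Z\<close> is $K[x_i : i \in Z]$; the coefficient field $K$ is the type \<open>'k\<close>.\<close>

definition poly_ring :: "nat set \<Rightarrow> 'k::field mpolynomial ring"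
  where "poly_ring Z =
    \<lparr>carrier = {p. \<forall>m\<in>Poly_Mapping.keys p. Poly_Mapping.keys m \<subseteq> Z},
     monoid.mult = (*), one = 1, zero = 0, add = (+)\<rparr>"

definition graded_max_ideal :: "nat \<Rightarrow> 'k::field mpolynomial set"
  where "graded_max_ideal n = Idl\<^bsub>poly_ring {1..n}\<^esub> (var ` {1..n})"


section \<open>Quotient modules\<close>

text \<open>
  Module records extend ring records, but \<^locale>\<open>module\<close> ignores the fields \<open>mult\<close> and \<open>one\<close> of
  the module, so they are left unspecified in a quotient.
\<close>

definition quot_module :: "('r, 'b) module \<Rightarrow> 'b set \<Rightarrow> ('r, 'b set) module"
  where "quot_module M N =
    \<lparr>carrier = a_rcosets\<^bsub>M\<^esub> N,
     monoid.mult = undefined, one = undefined,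
     zero = N, add = (<+>\<^bsub>M\<^esub>),
     smult = (\<lambda>r X. \<Union>x\<in>X. N +>\<^bsub>M\<^esub> (r \<odot>\<^bsub>M\<^esub> x))\<rparr>"

definition ideal_module :: "'r ring \<Rightarrow> 'r set \<Rightarrow> ('r, 'r) module"
  where "ideal_module R J =
    \<lparr>carrier = J, monoid.mult = monoid.mult R, one = one R, zero = zero R, add = add R, smult = monoid.mult R\<rparr>"

definition ideal_quot :: "'r ring \<Rightarrow> 'r set \<Rightarrow> 'r set \<Rightarrow> ('r, 'r set) module"
  where "ideal_quot R J I = quot_module (ideal_module R J) I"


section \<open>Depth\<close>

text \<open>\<open>elements_times_module M fs\<close> is the submodule $(f_1, \ldots, f_r) M = f_1 M + \cdots + f_r M$.\<close>

definition elements_times_module :: "('r, 'b) module \<Rightarrow> 'r list \<Rightarrow> 'b set"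
  where "elements_times_module M fs =
    {\<Oplus>\<^bsub>M\<^esub>j\<in>{..<length fs}. (fs ! j) \<odot>\<^bsub>M\<^esub> y j | y. y \<in> {..<length fs} \<rightarrow> carrier M}"

definition regular_element :: "('r, 'b) module \<Rightarrow> 'r \<Rightarrow> bool"
  where "regular_element M f \<longleftrightarrow> (\<forall>x\<in>carrier M. f \<odot>\<^bsub>M\<^esub> x = \<zero>\<^bsub>M\<^esub> \<longrightarrow> x = \<zero>\<^bsub>M\<^esub>)"

definition regular_sequence :: "('r, 'b) module \<Rightarrow> 'r list \<Rightarrow> bool"
  where "regular_sequence M fs \<longleftrightarrow>
    (\<forall>i<length fs.
       regular_element (quot_module M (elements_times_module M (take i fs))) (fs ! i)) \<and>
    elements_times_module M fs \<noteq> carrier M"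

text \<open>
  The depth of a module with respect to an ideal \<open>m\<close> of the base ring.  The members of the
  sequences are arbitrary elements of \<open>m\<close>, not necessarily homogeneous ones.  Note that
  \<^const>\<open>Max\<close> is unspecified on infinite sets and on the empty set.
\<close>

definition depth :: "'r set \<Rightarrow> ('r, 'b) module \<Rightarrow> nat"
  where "depth m M = Max {length fs | fs. set fs \<subseteq> m \<and> regular_sequence M fs}"


section \<open>Stanley depth\<close>

text \<open>
  The group $\mathbf{Z}^n$ is the set of integer-valued functions vanishing outside \<open>{1..n}\<close>.
  A $\mathbf{Z}^n$-grading of a module is given by the family of its homogeneous components.
\<close>

definition multidegrees :: "nat \<Rightarrow> (nat \<Rightarrow> int) set"
  where "multidegrees n = {a. \<forall>i. i \<notin> {1..n} \<longrightarrow> a i = 0}"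

definition poly_component :: "nat \<Rightarrow> (nat \<Rightarrow> int) \<Rightarrow> 'k::field mpolynomial set"
  where "poly_component n a =
    {p \<in> carrier (poly_ring {1..n}).
       \<forall>m\<in>Poly_Mapping.keys p. (\<lambda>i. int (Poly_Mapping.lookup m i)) = a}"

text \<open>The grading induced on $J/I$: the image of $J_a = J \cap S_a$.\<close>

definition ideal_quot_component ::
    "nat \<Rightarrow> 'k::field mpolynomial set \<Rightarrow> 'k mpolynomial set \<Rightarrow> (nat \<Rightarrow> int)
      \<Rightarrow> 'k mpolynomial set set"
  where "ideal_quot_component n J I a =
    {I +>\<^bsub>ideal_module (poly_ring {1..n}) J\<^esub> p | p. p \<in> J \<inter> poly_component n a}"

definition stanley_space ::
    "('k::field mpolynomial, 'b) module \<Rightarrow> 'b \<Rightarrow> nat set \<Rightarrow> 'b set"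
  where "stanley_space M m Z = {u \<odot>\<^bsub>M\<^esub> m | u. u \<in> carrier (poly_ring Z)}"

text \<open>
  A decomposition is a list of pairs $(m_i, Z_i)$, with $x_j \in Z_i$ encoded as $j \in Z_i$.
  The third conjunct says that $m_i K[Z_i]$ is free over $K[Z_i]$ with basis $m_i$, the last one
  that $M$ is the internal direct sum of these subspaces.  As every $m_i$ is homogeneous, each
  summand is a graded subspace, so the sum is automatically one of graded vector spaces.
\<close>

definition stanley_decomposition ::
    "nat \<Rightarrow> ('k::field mpolynomial, 'b) module \<Rightarrow> ((nat \<Rightarrow> int) \<Rightarrow> 'b set)
      \<Rightarrow> ('b \<times> nat set) list \<Rightarrow> bool"
  where "stanley_decomposition n M G D \<longleftrightarrow>
    (\<forall>(m, Z)\<in>set D.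
       m \<in> carrier M \<and> (\<exists>a\<in>multidegrees n. m \<in> G a) \<and>
       Z \<subseteq> {1..n} \<and>
       (\<forall>u\<in>carrier (poly_ring Z). u \<odot>\<^bsub>M\<^esub> m = \<zero>\<^bsub>M\<^esub> \<longrightarrow> u = 0)) \<and>
    (\<forall>x\<in>carrier M.
       \<exists>!y. y \<in> (\<Pi>\<^sub>E i\<in>{..<length D}. stanley_space M (fst (D ! i)) (snd (D ! i))) \<and>
            x = (\<Oplus>\<^bsub>M\<^esub>i\<in>{..<length D}. y i))"

definition decomposition_sdepth :: "('b \<times> nat set) list \<Rightarrow> nat"
  where "decomposition_sdepth D = Min ((\<lambda>(m, Z). card Z) ` set D)"

definition sdepth ::
    "nat \<Rightarrow> ('k::field mpolynomial, 'b) module \<Rightarrow> ((nat \<Rightarrow> int) \<Rightarrow> 'b set) \<Rightarrow> nat"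
  where "sdepth n M G = Max {decomposition_sdepth D | D. stanley_decomposition n M G D}"

end

theory Submission
  imports Defs
begin

text \<open>
  $J_n/I_n$ has a $K$-basis of monomials, namely those whose support is a face: a subset of
  $\{1,\ldots,n\}$ that contains $1$ and $n$ and no two consecutive numbers.  Put
  $d = 2 + \lfloor (n-2)/3 \rfloor$.

  Upper bounds: there is a maximal face $Z$ with at most $d$ elements, so the monomial $x_Z$ is killed by
  every variable outside $Z$.  A Stanley space that contains $x_Z$ therefore uses only variables from $Z$.
  A regular sequence $f_1, \ldots, f_r$ with $r > |Z|$ would, after passing to $N$-th powers, be algebraically
  dependent on $x_Z K[Z]$, and a lexicographic argument puts $x_Z$ into $(f_1^N, \ldots, f_r^N) J_n + I_n$ for all $N$,
  which is absurd for degree reasons.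

  Lower bounds: removing the centers $3k$ ($3k \le n-2$) from a face gives its core, and the faces with a given
  core $F$ form an interval $[F, Z_F]$, where $Z_F$ meets each of the disjoint blocks $\{1\}$, $\{n\}$,
  $\{3k-1, 3k, 3k+1\}$; thus $|Z_F| \ge d$.  The spaces $x_F K[Z_F]$ form a Stanley decomposition, and they are
  also the factors of a filtration by submodules.  The sums of the variables in the blocks are regular on each
  $K[Z_F]$, hence on $J_n/I_n$.
\<close>

section \<open>Regular sequences on quotients of submodules\<close>

text \<open>The upper bound for the depth replaces the inequality depth <= dim S/P, for the
  associated prime P = ann(x_Z) = (x_i : i not in Z), by linear algebra over K. Two obstacles shape
  it. The members of a regular sequence may be inhomogeneous, so degrees can only be bounded from
  below; and $x_Z$ is in general no minimal generator of $J_n/I_n$, which is generated by $x_1 x_n$,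
  so there is nothing absurd in $x_Z$ lying in $(f_1, ..., f_r) J_n + I_n$. Powers remove the second
  obstacle: every monomial of $f_i^N$ has degree at least N, which exceeds the degree of $x_Z$ for
  large N.

  On the lower side, multiples of 3 serve as centers because no two of them are adjacent: all
  centers without a neighbour in a core can be added at once, and this produces intervals. The
  blocks do not depend on the core, so a single sequence of linear forms is regular on every factor
  of the filtration, and the same partition of the faces settles both invariants.\<close>

definition submodule_set :: "'a::comm_ring_1 set \<Rightarrow> 'a set \<Rightarrow> bool"
  where "submodule_set T A \<longleftrightarrow> 0 \<in> A \<and> (\<forall>a\<in>A. \<forall>b\<in>A. a + b \<in> A) \<and> (\<forall>a\<in>A. - a \<in> A) \<and> (\<forall>t\<in>T. \<forall>a\<in>A. t * a \<in> A)"

lemma submodule_setD: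
  assumes "submodule_set T A"
  shows "0 \<in> A" "a \<in> A \<Longrightarrow> b \<in> A \<Longrightarrow> a + b \<in> A" "a \<in> A \<Longrightarrow> - a \<in> A"
    "a \<in> A \<Longrightarrow> b \<in> A \<Longrightarrow> a - b \<in> A" "t \<in> T \<Longrightarrow> a \<in> A \<Longrightarrow> t * a \<in> A"
  using assms unfolding submodule_set_def by (auto simp: diff_conv_add_uminus simp del: add_uminus_conv_diff)

lemma submodule_set_sum:
  assumes "submodule_set T A" "\<And>i. i \<in> X \<Longrightarrow> g i \<in> A"
  shows "sum g X \<in> A"
  using assms(2) by (induction X rule: infinite_finite_induct) (auto simp: submodule_setD[OF assms(1)])

text \<open>This is $fA + B$, so that \<open>A\<close> modulo it is the quotient of $A/B$ by
  \<open>f\<close>. The same shape with \<open>f = 1\<close> is the sum of two submodules, and with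
  \<open>A\<close> the whole ring it extends \<open>B\<close> by one generator
  \<open>f\<close>.\<close>

definition adjoin_multiples :: "'a::comm_ring_1 \<Rightarrow> 'a set \<Rightarrow> 'a set \<Rightarrow> 'a set"
  where "adjoin_multiples f A B = {f * a + b | a b. a \<in> A \<and> b \<in> B}"

lemma adjoin_multiplesI: "a \<in> A \<Longrightarrow> b \<in> B \<Longrightarrow> x = f * a + b \<Longrightarrow> x \<in> adjoin_multiples f A B"
  unfolding adjoin_multiples_def by blast

lemma adjoin_multiplesE:
  assumes "x \<in> adjoin_multiples f A B"
  obtains a b where "a \<in> A" "b \<in> B" "x = f * a + b"
  using assms unfolding adjoin_multiples_def by blast

lemma submodule_set_adjoin_multiples:
  assumes A: "submodule_set T A" and B: "submodule_set T B"
  shows "submodule_set T (adjoin_multiples f A B)"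
  unfolding submodule_set_def
proof (intro conjI ballI)
  show "0 \<in> adjoin_multiples f A B"
    by (rule adjoin_multiplesI[of 0 _ 0]) (auto simp: submodule_setD[OF A] submodule_setD[OF B])
next
  fix x y assume "x \<in> adjoin_multiples f A B" "y \<in> adjoin_multiples f A B"
  then obtain a b a' b' where "a \<in> A" "b \<in> B" "x = f * a + b" "a' \<in> A" "b' \<in> B" "y = f * a' + b'"
    by (metis adjoin_multiplesE)
  then show "x + y \<in> adjoin_multiples f A B"
    by (intro adjoin_multiplesI[of "a + a'" _ "b + b'"])
       (auto simp: submodule_setD[OF A] submodule_setD[OF B] algebra_simps)
next
  fix x assume "x \<in> adjoin_multiples f A B"
  then obtain a b where "a \<in> A" "b \<in> B" "x = f * a + b"
    by (metis adjoin_multiplesE)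
  then show "- x \<in> adjoin_multiples f A B"
    by (intro adjoin_multiplesI[of "- a" _ "- b"])
       (auto simp: submodule_setD[OF A] submodule_setD[OF B] algebra_simps)
next
  fix t x assume t: "t \<in> T" and "x \<in> adjoin_multiples f A B"
  then obtain a b where "a \<in> A" "b \<in> B" "x = f * a + b"
    by (metis adjoin_multiplesE)
  then show "t * x \<in> adjoin_multiples f A B"
    by (intro adjoin_multiplesI[of "t * a" _ "t * b"])
       (auto simp: submodule_setD[OF A] submodule_setD[OF B] t distrib_left mult.left_commute)
qed

lemma adjoin_multiples_supset: "submodule_set T A \<Longrightarrow> B \<subseteq> adjoin_multiples f A B"
  by (auto intro!: adjoin_multiplesI[of 0] simp: submodule_setD)

lemma adjoin_multiples_subset:
  "submodule_set T A \<Longrightarrow> f \<in> T \<Longrightarrow> B \<subseteq> A \<Longrightarrow> adjoin_multiples f A B \<subseteq> A"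
  by (auto elim!: adjoin_multiplesE simp: submodule_setD subsetD)

text \<open>The pair of submodules $B \subseteq A$ stands for the module $A/B$, so that quotients by further
  elements only enlarge \<open>B\<close>.\<close>

fun weakly_regular :: "'a::comm_ring_1 list \<Rightarrow> 'a set \<Rightarrow> 'a set \<Rightarrow> bool" where
  "weakly_regular [] A B \<longleftrightarrow> True"
| "weakly_regular (f # fs) A B \<longleftrightarrow>
     (\<forall>x\<in>A. f * x \<in> B \<longrightarrow> x \<in> B) \<and> weakly_regular fs A (adjoin_multiples f A B)"

text \<open>Second isomorphism theorem: \<open>A\<close> modulo \<open>A \<inter> C\<close> is $(A +
  C)/C$. The induction replaces \<open>C\<close> by $D = fA + C$; the modular law gives
  \<open>A \<inter> D\<close> = fA + (\<open>A \<inter> C\<close>), and $A + D = A + C$.\<close>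

lemma weakly_regular_add:
  assumes "submodule_set T A" "submodule_set T C" "set fs \<subseteq> T"
    and "weakly_regular fs A (A \<inter> C)"
  shows "weakly_regular fs (adjoin_multiples 1 A C) C"
  using assms
proof (induction fs arbitrary: C)
  case Nil
  then show ?case by simp
next
  case (Cons f fs)
  note A = submodule_setD[OF Cons.prems(1)] and C = submodule_setD[OF Cons.prems(2)]
  have fT: "f \<in> T" using Cons.prems by simp
  define D where "D = adjoin_multiples f (adjoin_multiples 1 A C) C"
  have D: "submodule_set T D"
    unfolding D_def using Cons.prems by (intro submodule_set_adjoin_multiples)
  have CD: "C \<subseteq> D" unfolding D_def
    by (rule adjoin_multiples_supset[of T]) (use Cons.prems in \<open>intro submodule_set_adjoin_multiples\<close>)
  have D_eq: "x \<in> D \<longleftrightarrow> (\<exists>a\<in>A. \<exists>c\<in>C. x = f * a + c)" for x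
  proof
    assume "x \<in> D"
    then obtain a c c' where *: "a \<in> A" "c \<in> C" "c' \<in> C" "x = f * (1 * a + c) + c'"
      unfolding D_def by (metis adjoin_multiplesE)
    then have "x = f * a + (f * c + c')" by (simp add: algebra_simps)
    with * show "\<exists>a\<in>A. \<exists>c\<in>C. x = f * a + c" by (metis C(2,5) fT)
  next
    assume "\<exists>a\<in>A. \<exists>c\<in>C. x = f * a + c"
    then obtain a c where *: "a \<in> A" "c \<in> C" "x = f * a + c" by blast
    then have "a \<in> adjoin_multiples 1 A C" by (intro adjoin_multiplesI[of a _ 0]) (auto simp: C)
    with * show "x \<in> D" unfolding D_def by (auto intro: adjoin_multiplesI[of a _ c])
  qed
  have 1: "adjoin_multiples f A (A \<inter> C) = A \<inter> D"
  proof (intro Set.set_eqI iffI)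
    fix x assume "x \<in> adjoin_multiples f A (A \<inter> C)"
    then show "x \<in> A \<inter> D" by (auto simp: D_eq fT A elim!: adjoin_multiplesE)
  next
    fix x assume x: "x \<in> A \<inter> D"
    then obtain a c where ac: "a \<in> A" "c \<in> C" "x = f * a + c" using D_eq by blast
    then have "c = x - f * a" by simp
    then have "c \<in> A" using x ac A(4,5) fT by blast
    with ac show "x \<in> adjoin_multiples f A (A \<inter> C)" by (auto intro: adjoin_multiplesI)
  qed
  have 2: "adjoin_multiples 1 A D = adjoin_multiples 1 A C"
  proof
    show "adjoin_multiples 1 A D \<subseteq> adjoin_multiples 1 A C"
    proof
      fix x assume "x \<in> adjoin_multiples 1 A D"
      then obtain a a' c where *: "a \<in> A" "a' \<in> A" "c \<in> C" "x = 1 * a + (f * a' + c)"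
        by (metis adjoin_multiplesE D_eq)
      then show "x \<in> adjoin_multiples 1 A C"
        by (intro adjoin_multiplesI[of "a + f * a'" _ c]) (auto simp: A fT)
    qed
    show "adjoin_multiples 1 A C \<subseteq> adjoin_multiples 1 A D"
      using CD by (auto elim!: adjoin_multiplesE intro: adjoin_multiplesI)
  qed
  have "weakly_regular fs (adjoin_multiples 1 A D) D"
    by (rule Cons.IH) (use Cons.prems D 1 in auto)
  then have "weakly_regular fs (adjoin_multiples 1 A C) D" by (simp add: 2)
  moreover have "x \<in> C" if "x \<in> adjoin_multiples 1 A C" "f * x \<in> C" for x
  proof -
    from that obtain a c where ac: "a \<in> A" "c \<in> C" "x = 1 * a + c" by (metis adjoin_multiplesE)
    then have "f * a = f * x - f * c" by (simp add: algebra_simps)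
    then have "f * a \<in> C" using ac that fT C(4,5) by simp
    then have "f * a \<in> A \<inter> C" using ac fT A(5) by simp
    then have "a \<in> A \<inter> C" using Cons.prems ac by simp
    then show ?thesis using ac C by simp
  qed
  ultimately show ?case by (simp add: D_def)
qed

text \<open>For an exact sequence $0 \to B/C \to A/C \to A/B \to 0$.\<close>

lemma weakly_regular_trans:
  assumes "submodule_set T A" "submodule_set T B" "submodule_set T C" "C \<subseteq> B" "B \<subseteq> A" "set fs \<subseteq> T"
    and "weakly_regular fs A B" "weakly_regular fs B C"
  shows "weakly_regular fs A C"
  using assms
proof (induction fs arbitrary: B C)
  case Nil
  then show ?case by simp
next
  case (Cons f fs)
  note A = submodule_setD[OF Cons.prems(1)] and B = submodule_setD[OF Cons.prems(2)]
    and C = submodule_setD[OF Cons.prems(3)]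
  have fT: "f \<in> T" using Cons.prems by simp
  define D where "D = adjoin_multiples f A C"
  have D: "submodule_set T D"
    unfolding D_def using Cons.prems by (intro submodule_set_adjoin_multiples)
  have E: "adjoin_multiples 1 B D = adjoin_multiples f A B"
  proof (intro Set.set_eqI iffI)
    fix x assume "x \<in> adjoin_multiples 1 B D"
    then obtain b a c where "b \<in> B" "a \<in> A" "c \<in> C" "x = 1 * b + (f * a + c)"
      unfolding D_def by (metis adjoin_multiplesE)
    then show "x \<in> adjoin_multiples f A B"
      using Cons.prems(4) by (intro adjoin_multiplesI[of a _ "b + c"]) (auto simp: B subsetD)
  next
    fix x assume "x \<in> adjoin_multiples f A B"
    then obtain b a where "b \<in> B" "a \<in> A" "x = f * a + b"
      by (metis adjoin_multiplesE)
    then show "x \<in> adjoin_multiples 1 B D"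
      unfolding D_def
      by (intro adjoin_multiplesI[of b _ "f * a"] adjoin_multiplesI[of a _ 0]) (auto simp: C)
  qed
  \<comment> \<open>Regularity of \<open>f\<close> on $A/B$ enters here: \<open>f * a\<close> in
    \<open>B\<close> forces \<open>a\<close> in \<open>B\<close>. Hence $B/C$ modulo
    \<open>f\<close> still embeds in $A/C$ modulo \<open>f\<close>, and the exact sequence survives
    to the next stage.\<close>
  have BD: "B \<inter> D = adjoin_multiples f B C"
  proof (intro Set.set_eqI iffI)
    fix x assume x: "x \<in> B \<inter> D"
    then obtain a c where ac: "a \<in> A" "c \<in> C" "x = f * a + c"
      unfolding D_def by (auto elim: adjoin_multiplesE)
    then have "f * a = x - c" by simp
    moreover have "c \<in> B" using ac Cons.prems(4) by auto
    ultimately have "f * a \<in> B" using x B(4) by auto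
    then have "a \<in> B" using Cons.prems ac by simp
    with ac show "x \<in> adjoin_multiples f B C" by (auto intro: adjoin_multiplesI)
  next
    fix x assume "x \<in> adjoin_multiples f B C"
    then obtain b c where "b \<in> B" "c \<in> C" "x = f * b + c"
      by (metis adjoin_multiplesE)
    then show "x \<in> B \<inter> D"
      unfolding D_def using Cons.prems(4,5) fT by (auto intro: adjoin_multiplesI[of b _ c] simp: B subsetD)
  qed
  have "weakly_regular fs (adjoin_multiples 1 B D) D"
    by (rule weakly_regular_add[of T]) (use Cons.prems D BD in auto)
  then have "weakly_regular fs (adjoin_multiples f A B) D" by (simp add: E)
  moreover have "weakly_regular fs A (adjoin_multiples f A B)" using Cons.prems by simp
  ultimately have "weakly_regular fs A D"
  proof (intro Cons.IH[of "adjoin_multiples f A B" D])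
    show "D \<subseteq> adjoin_multiples f A B"
      unfolding D_def using Cons.prems(4) by (auto elim!: adjoin_multiplesE intro: adjoin_multiplesI)
    show "adjoin_multiples f A B \<subseteq> A"
      by (rule adjoin_multiples_subset[of T]) (use Cons.prems in auto)
  qed (use Cons.prems D in \<open>auto intro: submodule_set_adjoin_multiples\<close>)
  moreover have "x \<in> C" if "x \<in> A" "f * x \<in> C" for x
    using that Cons.prems by auto
  ultimately show ?case by (simp add: D_def)
qed

text \<open>Multiplication by \<open>g\<close> induces an isomorphism from \<open>A\<close> modulo
  the colon (B : g) onto $(gA + B)/B$. In the induction \<open>B\<close> becomes $D = f(gA + B) +
  B$, whose colon is $fA + (B : g)$, while $gA + D = gA + B$.\<close>

lemma weakly_regular_colon:
  assumes "submodule_set T A" "submodule_set T B" "set fs \<subseteq> T"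
    and "weakly_regular fs A {s \<in> A. g * s \<in> B}"
  shows "weakly_regular fs (adjoin_multiples g A B) B"
  using assms
proof (induction fs arbitrary: B)
  case Nil
  then show ?case by simp
next
  case (Cons f fs)
  note A = submodule_setD[OF Cons.prems(1)] and B = submodule_setD[OF Cons.prems(2)]
  have fT: "f \<in> T" using Cons.prems by simp
  define D where "D = adjoin_multiples f (adjoin_multiples g A B) B"
  have D: "submodule_set T D"
    unfolding D_def using Cons.prems by (intro submodule_set_adjoin_multiples)
  have BD: "B \<subseteq> D" unfolding D_def
    by (rule adjoin_multiples_supset[of T]) (use Cons.prems in \<open>intro submodule_set_adjoin_multiples\<close>)
  have 1: "adjoin_multiples f A {s \<in> A. g * s \<in> B} = {s \<in> A. g * s \<in> D}"
  proof (intro Set.set_eqI iffI)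
    fix x assume "x \<in> adjoin_multiples f A {s \<in> A. g * s \<in> B}"
    then obtain a s where as: "a \<in> A" "s \<in> A" "g * s \<in> B" "x = f * a + s"
      by (auto elim: adjoin_multiplesE)
    then have "g * x \<in> D" unfolding D_def
      by (intro adjoin_multiplesI[of "g * a" _ "g * s"] adjoin_multiplesI[of a _ 0])
         (auto simp: B algebra_simps)
    with as show "x \<in> {s \<in> A. g * s \<in> D}" by (auto simp: A fT)
  next
    fix x assume "x \<in> {s \<in> A. g * s \<in> D}"
    then obtain a b b' where x: "x \<in> A" "a \<in> A" "b \<in> B" "b' \<in> B" "g * x = f * (g * a + b) + b'"
      unfolding D_def by (auto elim!: adjoin_multiplesE)
    then have "g * (x - f * a) = f * b + b'" by (simp add: algebra_simps)
    then have "g * (x - f * a) \<in> B" using x fT by (simp add: B)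
    then show "x \<in> adjoin_multiples f A {s \<in> A. g * s \<in> B}"
      using x fT by (intro adjoin_multiplesI[of a _ "x - f * a"]) (auto simp: A)
  qed
  have 2: "adjoin_multiples g A D = adjoin_multiples g A B"
  proof
    show "adjoin_multiples g A D \<subseteq> adjoin_multiples g A B"
    proof
      fix x assume "x \<in> adjoin_multiples g A D"
      then obtain a a' b b' where *: "a \<in> A" "a' \<in> A" "b \<in> B" "b' \<in> B" "x = g * a + (f * (g * a' + b) + b')"
        unfolding D_def by (metis adjoin_multiplesE)
      then show "x \<in> adjoin_multiples g A B"
        by (intro adjoin_multiplesI[of "a + f * a'" _ "f * b + b'"]) (simp_all add: A B fT, simp add: algebra_simps)
    qed
    show "adjoin_multiples g A B \<subseteq> adjoin_multiples g A D"
      using BD by (auto elim!: adjoin_multiplesE intro: adjoin_multiplesI)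
  qed
  have "weakly_regular fs (adjoin_multiples g A D) D"
    by (rule Cons.IH) (use Cons.prems D 1 in auto)
  then have "weakly_regular fs (adjoin_multiples g A B) D" by (simp add: 2)
  moreover have "x \<in> B" if "x \<in> adjoin_multiples g A B" "f * x \<in> B" for x
  proof -
    from that obtain a b where ac: "a \<in> A" "b \<in> B" "x = g * a + b" by (metis adjoin_multiplesE)
    then have "g * (f * a) = f * x - f * b" by (simp add: algebra_simps)
    then have "g * (f * a) \<in> B" using ac that fT B(4,5) by simp
    then have "g * a \<in> B" using Cons.prems ac A fT by simp
    then show ?thesis using ac B by simp
  qed
  ultimately show ?case by (simp add: D_def)
qed

lemma adjoin_multiples_self:
  "submodule_set T A \<Longrightarrow> f \<in> T \<Longrightarrow> adjoin_multiples f A A = A"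
  by (intro equalityI adjoin_multiples_subset adjoin_multiples_supset) auto

lemma weakly_regular_self:
  "submodule_set T A \<Longrightarrow> set fs \<subseteq> T \<Longrightarrow> weakly_regular fs A A"
  by (induction fs) (auto simp: adjoin_multiples_self)

text \<open>With $D_j = f^j A + B$, multiplication by $f^j$ identifies $A/D_1$ with $D_j/D_{j+1}$,
  because the head \<open>f\<close> is regular on $A/B$. So $A/D_N$ is a repeated extension of
  copies of $A/D_1$, on which the powers of the tail are regular by induction.\<close>

lemma weakly_regular_power:
  assumes "submodule_set T A" "submodule_set T B" "B \<subseteq> A" "set fs \<subseteq> T"
    "\<And>f. f \<in> T \<Longrightarrow> f ^ N \<in> T" "weakly_regular fs A B"
  shows "weakly_regular (map (\<lambda>f. f ^ N) fs) A B"
  using assms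
proof (induction fs arbitrary: B)
  case Nil
  then show ?case by simp
next
  case (Cons f fs)
  note A = submodule_setD[OF Cons.prems(1)] and B = submodule_setD[OF Cons.prems(2)]
  have fT: "f \<in> T" using Cons.prems by simp
  have fA: "f ^ j * a \<in> A" if "a \<in> A" for j a
    using that by (induction j) (auto simp: A fT mult.assoc)
  have fB: "f ^ j * a \<in> B" if "a \<in> B" for j a
    using that by (induction j) (auto simp: B fT mult.assoc)
  have inj: "a \<in> B" if "a \<in> A" "f ^ j * a \<in> B" for j a
    using that(2)
  proof (induction j)
    case (Suc j)
    then show ?case using Cons.prems(6) fA[OF that(1), of j] by (simp add: mult.assoc)
  qed simp
  let ?fs = "map (\<lambda>f. f ^ N) fs"
  define D where "D j = adjoin_multiples (f ^ j) A B" for j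
  have D: "submodule_set T (D j)" for j
    unfolding D_def using Cons.prems by (intro submodule_set_adjoin_multiples)
  have DA: "D j \<subseteq> A" for j
    unfolding D_def using fA Cons.prems(3) A(2) by (auto elim!: adjoin_multiplesE)
  have BD: "B \<subseteq> D j" for j
    unfolding D_def using Cons.prems(1) by (rule adjoin_multiples_supset)
  have fsT: "set ?fs \<subseteq> T" using Cons.prems by auto
  have tail: "weakly_regular ?fs A (D 1)"
    by (rule Cons.IH) (use Cons.prems D[of 1] DA[of 1] in \<open>simp_all add: D_def\<close>)
  have "weakly_regular ?fs A (D j)" for j
  proof (induction j)
    case 0
    have "a \<in> D 0" if "a \<in> A" for a
      unfolding D_def using that B(1) by (intro adjoin_multiplesI[of a _ 0]) auto
    then have "D 0 = A" using DA[of 0] by blast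
    then show ?case using weakly_regular_self Cons.prems(1) fsT by metis
  next
    case (Suc j)
    have sub: "D (Suc j) \<subseteq> D j"
    proof
      fix x assume "x \<in> D (Suc j)"
      then obtain a b where "a \<in> A" "b \<in> B" "x = f ^ Suc j * a + b"
        unfolding D_def by (metis adjoin_multiplesE)
      then show "x \<in> D j" unfolding D_def
        by (intro adjoin_multiplesI[of "f * a" _ b]) (auto simp: A fT mult.assoc power_commutes)
    qed
    have 1: "adjoin_multiples (f ^ j) A (D (Suc j)) = D j"
    proof
      show "adjoin_multiples (f ^ j) A (D (Suc j)) \<subseteq> D j"
      proof
        fix x assume "x \<in> adjoin_multiples (f ^ j) A (D (Suc j))"
        then obtain a y where *: "a \<in> A" "y \<in> D j" "x = f ^ j * a + y"
          using sub by (auto elim!: adjoin_multiplesE)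
        moreover have "f ^ j * a \<in> D j" unfolding D_def using * by (intro adjoin_multiplesI[of a _ 0]) (auto simp: B)
        ultimately show "x \<in> D j" using submodule_setD[OF D] by simp
      qed
      show "D j \<subseteq> adjoin_multiples (f ^ j) A (D (Suc j))"
        using BD unfolding D_def[of j] by (auto elim!: adjoin_multiplesE intro: adjoin_multiplesI)
    qed
    have 2: "{s \<in> A. f ^ j * s \<in> D (Suc j)} = D 1"
    proof (intro Set.set_eqI iffI)
      fix s assume "s \<in> {s \<in> A. f ^ j * s \<in> D (Suc j)}"
      then obtain a b where s: "s \<in> A" "a \<in> A" "b \<in> B" "f ^ j * s = f ^ Suc j * a + b"
        unfolding D_def by (auto elim: adjoin_multiplesE)
      then have "f ^ j * (s - f * a) = b" by (simp add: algebra_simps)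
      then have "s - f * a \<in> B" using s inj[of "s - f * a" j] A fT by simp
      then show "s \<in> D 1" unfolding D_def using s by (intro adjoin_multiplesI[of a _ "s - f * a"]) auto
    next
      fix s assume "s \<in> D 1"
      then obtain a b where s: "a \<in> A" "b \<in> B" "s = f * a + b"
        unfolding D_def by (auto elim: adjoin_multiplesE)
      then have "s \<in> A" using A fT Cons.prems(3) by auto
      moreover have "f ^ j * s \<in> D (Suc j)"
        unfolding D_def using s fB by (intro adjoin_multiplesI[of a _ "f ^ j * b"]) (auto simp: algebra_simps)
      ultimately show "s \<in> {s \<in> A. f ^ j * s \<in> D (Suc j)}" by simp
    qed
    have "weakly_regular ?fs (D j) (D (Suc j))"
      unfolding 1[symmetric] by (rule weakly_regular_colon[of T]) (use Cons.prems(1) D fsT tail 2 in auto)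
    with Suc show ?case
      using weakly_regular_trans[OF Cons.prems(1) D D sub DA fsT] by blast
  qed
  from this[of N] show ?case
    using inj by (auto simp: D_def)
qed

section \<open>Monomial ideals\<close>

abbreviation "poly_carrier V \<equiv> carrier (poly_ring V)"

lemma poly_ring_simps [simp]:
  "monoid.mult (poly_ring V) = (*)" "one (poly_ring V) = 1" "zero (poly_ring V) = 0" "add (poly_ring V) = (+)"
  by (simp_all add: poly_ring_def)

lemma poly_carrier_iff: "p \<in> poly_carrier V \<longleftrightarrow> (\<forall>m\<in>Poly_Mapping.keys p. Poly_Mapping.keys m \<subseteq> V)"
  by (simp add: poly_ring_def)

lemma keys_plus_nat: "Poly_Mapping.keys (a + b :: nat \<Rightarrow>\<^sub>0 nat) = Poly_Mapping.keys a \<union> Poly_Mapping.keys b"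
  by (auto simp: in_keys_iff lookup_add)

lemma keys_uminus: "Poly_Mapping.keys (- p) = Poly_Mapping.keys (p :: 'a \<Rightarrow>\<^sub>0 'b::ab_group_add)"
  by (auto simp: in_keys_iff)

lemma keys_multE:
  fixes p q :: "'k::field mpolynomial"
  assumes "m \<in> Poly_Mapping.keys (p * q)"
  obtains a b where "a \<in> Poly_Mapping.keys p" "b \<in> Poly_Mapping.keys q" "m = a + b"
  using assms keys_mult by fastforce

lemma keys_single_mult:
  fixes p :: "'k::field mpolynomial"
  shows "Poly_Mapping.keys (Poly_Mapping.single a c * p) \<subseteq> (+) a ` Poly_Mapping.keys p"
  by (auto elim!: keys_multE split: if_splits)

lemma lookup_single_mult:
  fixes p :: "'k::field mpolynomial"
  shows "Poly_Mapping.lookup (Poly_Mapping.single a c * p) (a + m) = c * Poly_Mapping.lookup p m"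
proof -
  have "Poly_Mapping.lookup (Poly_Mapping.single a c * p) (a + m)
      = (\<Sum>l. Poly_Mapping.lookup (Poly_Mapping.single a c) l *
           (\<Sum>q. Poly_Mapping.lookup p q when a + m = l + q))"
    by (rule lookup_mult)
  also have "\<dots> = (\<Sum>l. (c * (\<Sum>q. Poly_Mapping.lookup p q when a + m = l + q)) when l = a)"
    by (rule Sum_any.cong) (auto simp: lookup_single when_def)
  also have "\<dots> = c * (\<Sum>q. Poly_Mapping.lookup p q when q = m)"
    by (simp add: eq_commute[of m])
  finally show ?thesis by simp
qed

lemma sum_single_keys:
  "(\<Sum>m\<in>Poly_Mapping.keys p. Poly_Mapping.single m (Poly_Mapping.lookup p m)) = p"
  by (rule poly_mapping_eqI)
     (auto simp: lookup_sum lookup_single when_def in_keys_iff if_distrib cong: if_cong)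

lemma in_poly_carrier [simp]:
  "0 \<in> poly_carrier V" "1 \<in> poly_carrier V"
  "Poly_Mapping.keys m \<subseteq> V \<Longrightarrow> Poly_Mapping.single m c \<in> poly_carrier V"
  by (auto simp: poly_carrier_iff)

lemma poly_carrier_closed:
  assumes "p \<in> poly_carrier V" "q \<in> poly_carrier V"
  shows "p + q \<in> poly_carrier V" "p * q \<in> poly_carrier V" "- p \<in> poly_carrier V" "p ^ N \<in> poly_carrier V"
proof -
  have mult: "x * y \<in> poly_carrier V" if "x \<in> poly_carrier V" "y \<in> poly_carrier V" for x y :: "'a mpolynomial"
    using that unfolding poly_carrier_iff by (auto elim!: keys_multE simp: keys_plus_nat subset_iff)
  show "p + q \<in> poly_carrier V"
    using assms keys_add[of p q] unfolding poly_carrier_iff by blast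
  show "- p \<in> poly_carrier V"
    using assms unfolding poly_carrier_iff by (simp add: keys_uminus)
  show "p * q \<in> poly_carrier V" using mult assms by blast
  show "p ^ N \<in> poly_carrier V" by (induction N) (use mult assms in auto)
qed

lemma cring_poly_ring: "cring (poly_ring V)"
proof (intro cringI abelian_groupI comm_monoidI)
  show "\<exists>y\<in>poly_carrier V. y \<oplus>\<^bsub>poly_ring V\<^esub> x = \<zero>\<^bsub>poly_ring V\<^esub>" if "x \<in> poly_carrier V" for x
    using that by (intro bexI[of _ "- x"]) (auto simp: poly_carrier_closed)
qed (auto simp: poly_carrier_closed algebra_simps)

text \<open>The maximal ideal, $I_n$, $J_n$ and all members of the filtration are spanned by
  monomials. Describing them by a predicate on exponents reduces membership to an inspection of the
  keys.\<close>

definition monomial_span :: "nat set \<Rightarrow> ((nat \<Rightarrow>\<^sub>0 nat) \<Rightarrow> bool) \<Rightarrow> 'k::field mpolynomial set"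
  where "monomial_span V P = {p \<in> poly_carrier V. \<forall>m\<in>Poly_Mapping.keys p. P m}"

definition restrict_keys :: "('a \<Rightarrow> bool) \<Rightarrow> ('a \<Rightarrow>\<^sub>0 'b::ab_group_add) \<Rightarrow> ('a \<Rightarrow>\<^sub>0 'b)"
  where "restrict_keys P p = (\<Sum>m | m \<in> Poly_Mapping.keys p \<and> P m. Poly_Mapping.single m (Poly_Mapping.lookup p m))"

lemma lookup_restrict_keys:
  "Poly_Mapping.lookup (restrict_keys P p) m = (if P m then Poly_Mapping.lookup p m else 0)"
  unfolding restrict_keys_def
  by (auto simp: lookup_sum lookup_single when_def in_keys_iff if_distrib cong: if_cong)

lemma keys_restrict_keys: "Poly_Mapping.keys (restrict_keys P p) = {m \<in> Poly_Mapping.keys p. P m}"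
  by (auto simp: in_keys_iff lookup_restrict_keys split: if_splits)

lemma submodule_set_monomial_span:
  assumes "\<And>m k. P m \<Longrightarrow> Poly_Mapping.keys k \<subseteq> V \<Longrightarrow> P (k + m)"
  shows "submodule_set (poly_carrier V) (monomial_span V P :: 'k::field mpolynomial set)"
  unfolding submodule_set_def
proof (intro conjI ballI)
  show "(0 :: 'k mpolynomial) \<in> monomial_span V P" by (simp add: monomial_span_def)
  fix p q :: "'k mpolynomial" assume "p \<in> monomial_span V P" "q \<in> monomial_span V P"
  then show "p + q \<in> monomial_span V P"
    using keys_add[of p q] by (auto simp: monomial_span_def poly_carrier_closed)
next
  fix p :: "'k mpolynomial" assume "p \<in> monomial_span V P"
  then show "- p \<in> monomial_span V P"
    by (auto simp: monomial_span_def poly_carrier_closed keys_uminus)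
next
  fix p q :: "'k mpolynomial" assume "p \<in> poly_carrier V" "q \<in> monomial_span V P"
  then show "p * q \<in> monomial_span V P"
    by (auto simp: monomial_span_def poly_carrier_closed elim!: keys_multE)
       (metis assms poly_carrier_iff)
qed

lemma in_submodule_if_single:
  assumes "submodule_set T A" "\<And>m. m \<in> Poly_Mapping.keys p \<Longrightarrow> Poly_Mapping.single m (Poly_Mapping.lookup p m) \<in> A"
  shows "p \<in> A"
  using submodule_set_sum[OF assms(1), of "Poly_Mapping.keys p"] assms(2) sum_single_keys[of p] by metis

lemma ideal_submodule_set:
  assumes "ideal I (poly_ring V)"
  shows "submodule_set (poly_carrier V) I"
proof -
  interpret ideal I "poly_ring V" by fact
  interpret cring "poly_ring V" by (rule cring_poly_ring)
  have neg: "- a \<in> I" if "a \<in> I" for a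
  proof -
    have "(-1) \<in> poly_carrier V" using poly_carrier_closed(3)[of 1 V 1] by simp
    then have "(-1) * a \<in> I" using I_l_closed[OF that, of "-1"] by simp
    then show ?thesis by simp
  qed
  show ?thesis unfolding submodule_set_def
    using additive_subgroup.a_closed[OF is_additive_subgroup] I_l_closed neg additive_subgroup.zero_closed[OF is_additive_subgroup] by auto
qed

lemma ideal_monomial_span:
  assumes "\<And>m k. P m \<Longrightarrow> Poly_Mapping.keys k \<subseteq> V \<Longrightarrow> P (k + m)"
  shows "ideal (monomial_span V P) (poly_ring V)"
proof -
  interpret cring "poly_ring V" by (rule cring_poly_ring)
  have S: "submodule_set (poly_carrier V) (monomial_span V P)"
    using submodule_set_monomial_span[of P V] assms by blast
  note S = submodule_setD[OF S]
  have S5: "a * t \<in> monomial_span V P" if "t \<in> poly_carrier V" "a \<in> monomial_span V P" for t a :: "'a mpolynomial"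
    using S(5)[OF that] by (simp add: mult.commute)
  show ?thesis
  proof (intro idealI subgroup.intro ring_axioms)
    show "monomial_span V P \<subseteq> carrier (add_monoid (poly_ring V))"
      by (auto simp: monomial_span_def)
    show "inv\<^bsub>add_monoid (poly_ring V)\<^esub> x \<in> monomial_span V P" if "x \<in> monomial_span V P" for x
    proof -
      have "x \<in> poly_carrier V" using that by (auto simp: monomial_span_def)
      then have "\<ominus>\<^bsub>poly_ring V\<^esub> x = - x"
        using minus_equality[of "- x" x] by (auto simp: poly_carrier_closed)
      with that S(3) show ?thesis by (simp add: a_inv_def)
    qed
  qed (use S(1,2,5) S5 in auto)
qed

lemma genideal_monomials:
  assumes G: "\<And>g. g \<in> G \<Longrightarrow> Poly_Mapping.keys g \<subseteq> V"
  shows "Idl\<^bsub>poly_ring V\<^esub> ((\<lambda>g. Poly_Mapping.single g (1::'k::field)) ` G)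
    = monomial_span V (\<lambda>m. \<exists>g\<in>G. \<exists>k. m = g + k)"
    (is "?I = monomial_span V ?P")
proof
  interpret cring "poly_ring V :: 'k mpolynomial ring" by (rule cring_poly_ring)
  have sub: "(\<lambda>g. Poly_Mapping.single g (1::'k)) ` G \<subseteq> poly_carrier V"
    using G by auto
  show "?I \<subseteq> monomial_span V ?P"
  proof (rule genideal_minimal)
    show "ideal (monomial_span V ?P) (poly_ring V)"
      by (rule ideal_monomial_span) (metis add.left_commute)
    show "(\<lambda>g. Poly_Mapping.single g (1::'k)) ` G \<subseteq> monomial_span V ?P"
      using sub by (auto simp: monomial_span_def) (metis add_0_right)
  qed
  show "monomial_span V ?P \<subseteq> ?I"
  proof
    fix p :: "'k mpolynomial" assume p: "p \<in> monomial_span V ?P"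
    have S: "submodule_set (poly_carrier V) ?I"
      by (rule ideal_submodule_set, rule genideal_ideal, rule sub)
    show "p \<in> ?I"
    proof (rule in_submodule_if_single[OF S])
      fix m assume m: "m \<in> Poly_Mapping.keys p"
      then obtain g k where gk: "g \<in> G" "m = g + k" using p by (auto simp: monomial_span_def)
      \<comment> \<open>The predicate leaves the cofactor \<open>k\<close> unrestricted; since
        exponents are natural numbers, its support lies inside that of \<open>m\<close>.\<close>
      have "Poly_Mapping.keys k \<subseteq> V"
        using p m keys_plus_nat[of g k] unfolding gk(2) by (auto simp: monomial_span_def poly_carrier_iff)
      then have "Poly_Mapping.single k (Poly_Mapping.lookup p m) * Poly_Mapping.single g 1 \<in> ?I"
        by (intro submodule_setD(5)[OF S]) (use gk genideal_self[OF sub] in auto)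
      then show "Poly_Mapping.single m (Poly_Mapping.lookup p m) \<in> ?I"
        by (simp add: mult_single gk add.commute)
    qed
  qed
qed

lemma monomial_span_cong:
  "(\<And>m. Poly_Mapping.keys m \<subseteq> V \<Longrightarrow> P m \<longleftrightarrow> Q m) \<Longrightarrow> monomial_span V P = monomial_span V Q"
  by (auto simp: monomial_span_def poly_carrier_iff)

lemma monomial_span_add:
  "monomial_span V P <+>\<^bsub>poly_ring V\<^esub> monomial_span V Q
    = (monomial_span V (\<lambda>m. P m \<or> Q m) :: 'k::field mpolynomial set)"
proof
  show "monomial_span V P <+>\<^bsub>poly_ring V\<^esub> monomial_span V Q
    \<subseteq> (monomial_span V (\<lambda>m. P m \<or> Q m) :: 'k mpolynomial set)"
  proof
    fix x :: "'k mpolynomial" assume "x \<in> monomial_span V P <+>\<^bsub>poly_ring V\<^esub> monomial_span V Q"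
    then obtain p q where "p \<in> monomial_span V P" "q \<in> monomial_span V Q" "x = p + q"
      by (auto simp: set_add_def')
    then show "x \<in> monomial_span V (\<lambda>m. P m \<or> Q m)"
      using keys_add[of p q] by (auto simp: monomial_span_def poly_carrier_closed)
  qed
  show "monomial_span V (\<lambda>m. P m \<or> Q m)
    \<subseteq> (monomial_span V P <+>\<^bsub>poly_ring V\<^esub> monomial_span V Q :: 'k mpolynomial set)"
  proof
    fix x :: "'k mpolynomial" assume x: "x \<in> monomial_span V (\<lambda>m. P m \<or> Q m)"
    have "x = restrict_keys P x + restrict_keys (\<lambda>m. \<not> P m) x"
      by (rule poly_mapping_eqI) (simp add: lookup_add lookup_restrict_keys)
    moreover have "restrict_keys P x \<in> monomial_span V P" "restrict_keys (\<lambda>m. \<not> P m) x \<in> monomial_span V Q"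
      using x by (auto simp: monomial_span_def poly_carrier_iff keys_restrict_keys)
    ultimately show "x \<in> monomial_span V P <+>\<^bsub>poly_ring V\<^esub> monomial_span V Q"
      by (auto simp: set_add_def')
  qed
qed

section \<open>The path and cycle ideals as conditions on supports\<close>

lemma single_add_dvd_iff:
  assumes "i \<noteq> j"
  shows "(\<exists>k. m = Poly_Mapping.single i (1::nat) + Poly_Mapping.single j 1 + k) \<longleftrightarrow>
    i \<in> Poly_Mapping.keys m \<and> j \<in> Poly_Mapping.keys m" (is "?l \<longleftrightarrow> ?r")
proof
  assume ?l then show ?r by (auto simp: in_keys_iff lookup_add lookup_single)
next
  assume ?r
  \<comment> \<open>Subtraction of exponents is truncated; it is exact here because the two
    variables are distinct and both occur in \<open>m\<close>.\<close>
  then have "m = Poly_Mapping.single i (1::nat) + Poly_Mapping.single j 1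
      + (m - (Poly_Mapping.single i (1::nat) + Poly_Mapping.single j 1))"
    using assms
    by (intro poly_mapping_eqI) (auto simp: lookup_add lookup_minus lookup_single in_keys_iff when_def)
  then show ?l by blast
qed

lemma single_dvd_iff:
  "(\<exists>k. m = Poly_Mapping.single i (1::nat) + k) \<longleftrightarrow> i \<in> Poly_Mapping.keys m" (is "?l \<longleftrightarrow> ?r")
proof
  assume ?l then show ?r by (auto simp: in_keys_iff lookup_add lookup_single)
next
  assume ?r
  then have "m = Poly_Mapping.single i (1::nat) + (m - Poly_Mapping.single i (1::nat))"
    by (intro poly_mapping_eqI) (auto simp: lookup_add lookup_minus lookup_single in_keys_iff when_def)
  then show ?l by blast
qed

lemma graded_max_ideal_eq:
  "graded_max_ideal n = (monomial_span {1..n} (\<lambda>m. \<exists>i\<in>{1..n}. i \<in> Poly_Mapping.keys m) :: 'k::field mpolynomial set)"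
proof -
  have "graded_max_ideal n = Idl\<^bsub>poly_ring {1..n}\<^esub> ((\<lambda>g. Poly_Mapping.single g (1::'k)) ` (\<lambda>i. Poly_Mapping.single i 1) ` {1..n})"
    by (simp add: graded_max_ideal_def image_image var_def)
  also have "\<dots> = monomial_span {1..n} (\<lambda>m. \<exists>g\<in>(\<lambda>i. Poly_Mapping.single i 1) ` {1..n}. \<exists>k. m = g + k)"
    by (rule genideal_monomials) auto
  finally show ?thesis by (simp add: single_dvd_iff del: One_nat_def)
qed

text \<open>An edge of the path graph on \<open>{1..n}\<close>. The generators of $I_n$ are
  squarefree, so whether a monomial lies in $I_n$ depends only on its support.\<close>

definition has_path_edge :: "nat \<Rightarrow> nat set \<Rightarrow> bool"
  where "has_path_edge n F \<longleftrightarrow> (\<exists>i\<in>{1..n - 1}. i \<in> F \<and> i + 1 \<in> F)"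

lemma path_ideal_eq:
  "Idl\<^bsub>poly_ring {1..n}\<^esub> {var i * var (i + 1) | i. i \<in> {1..n - 1}}
    = (monomial_span {1..n} (\<lambda>m. has_path_edge n (Poly_Mapping.keys m)) :: 'k::field mpolynomial set)"
proof -
  have eq: "{var i * var (i + 1) | i. i \<in> {1..n - 1}} = (\<lambda>g. Poly_Mapping.single g (1::'k)) `
      (\<lambda>i. Poly_Mapping.single i 1 + Poly_Mapping.single (i + 1) 1) ` {1..n - 1}"
    by (auto simp: image_image var_def mult_single)
  have "Idl\<^bsub>poly_ring {1..n}\<^esub> {var i * var (i + 1) | i. i \<in> {1..n - 1}}
     = (monomial_span {1..n} (\<lambda>m. \<exists>g\<in>(\<lambda>i. Poly_Mapping.single i 1 + Poly_Mapping.single (i + 1) 1) ` {1..n - 1}. \<exists>k. m = g + k) :: 'k mpolynomial set)"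
    unfolding eq by (rule genideal_monomials) (auto simp: keys_plus_nat)
  also have "\<dots> = monomial_span {1..n} (\<lambda>m. has_path_edge n (Poly_Mapping.keys m))"
    unfolding has_path_edge_def
    by (rule monomial_span_cong) (simp add: single_add_dvd_iff del: One_nat_def)
  finally show ?thesis .
qed

lemma cycle_ideal_eq:
  assumes "n \<ge> 3"
  shows "monomial_span {1..n} (\<lambda>m. has_path_edge n (Poly_Mapping.keys m))
      <+>\<^bsub>poly_ring {1..n}\<^esub> PIdl\<^bsub>poly_ring {1..n}\<^esub> (var n * var 1)
    = (monomial_span {1..n} (\<lambda>m. has_path_edge n (Poly_Mapping.keys m)
        \<or> (1 \<in> Poly_Mapping.keys m \<and> n \<in> Poly_Mapping.keys m)) :: 'k::field mpolynomial set)"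
proof -
  interpret cring "poly_ring {1..n} :: 'k mpolynomial ring" by (rule cring_poly_ring)
  let ?g = "Poly_Mapping.single n 1 + Poly_Mapping.single 1 (1::nat)"
  have v: "var n * var 1 = Poly_Mapping.single ?g (1::'k)"
    by (simp add: var_def mult_single)
  have "PIdl\<^bsub>poly_ring {1..n}\<^esub> (var n * var 1 :: 'k mpolynomial) = Idl\<^bsub>poly_ring {1..n}\<^esub> {Poly_Mapping.single ?g (1::'k)}"
    unfolding v by (rule cgenideal_eq_genideal) (use assms in \<open>auto simp: keys_plus_nat\<close>)
  also have "{Poly_Mapping.single ?g (1::'k)} = (\<lambda>g. Poly_Mapping.single g (1::'k)) ` {?g}"
    by simp
  also have "Idl\<^bsub>poly_ring {1..n}\<^esub> \<dots> = monomial_span {1..n} (\<lambda>m. \<exists>g\<in>{?g}. \<exists>k. m = g + k)"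
    by (rule genideal_monomials) (use assms in \<open>auto simp: keys_plus_nat\<close>)
  also have "\<dots> = monomial_span {1..n} (\<lambda>m. 1 \<in> Poly_Mapping.keys m \<and> n \<in> Poly_Mapping.keys m)"
    using assms by (intro monomial_span_cong) (auto simp: single_add_dvd_iff simp del: One_nat_def)
  finally show ?thesis by (simp add: monomial_span_add)
qed

section \<open>The quotient of two ideals\<close>

text \<open>The submodule $(f_1, ..., f_r)A + B$. Folding in list order makes the prefixes
  \<open>take i fs\<close> correspond to the stages of \<open>weakly_regular\<close>.\<close>

definition adjoin_list :: "'a::comm_ring_1 list \<Rightarrow> 'a set \<Rightarrow> 'a set \<Rightarrow> 'a set"
  where "adjoin_list fs A B = fold (\<lambda>f. adjoin_multiples f A) fs B"

lemma weakly_regular_iff: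
  "weakly_regular fs A B \<longleftrightarrow>
    (\<forall>i<length fs. \<forall>x\<in>A. fs ! i * x \<in> adjoin_list (take i fs) A B \<longrightarrow> x \<in> adjoin_list (take i fs) A B)"
proof (induction fs arbitrary: B)
  case (Cons f fs)
  have "(\<forall>i<length (f # fs). Q i) \<longleftrightarrow> Q 0 \<and> (\<forall>i<length fs. Q (Suc i))" for Q
    by (auto simp: less_Suc_eq_0_disj)
  then show ?case by (simp add: Cons.IH adjoin_list_def)
qed simp

lemma submodule_set_adjoin_list:
  "submodule_set T A \<Longrightarrow> submodule_set T B \<Longrightarrow> submodule_set T (adjoin_list fs A B)"
  unfolding adjoin_list_def by (induction fs arbitrary: B) (auto intro: submodule_set_adjoin_multiples)

lemma adjoin_list_supset: "submodule_set T A \<Longrightarrow> B \<subseteq> adjoin_list fs A B"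
proof (induction fs rule: rev_induct)
  case (snoc f fs)
  then show ?case using adjoin_multiples_supset[of T A "adjoin_list fs A B" f]
    by (auto simp: adjoin_list_def)
qed (simp add: adjoin_list_def)

lemma adjoin_list_subset:
  "submodule_set T A \<Longrightarrow> set fs \<subseteq> T \<Longrightarrow> B \<subseteq> A \<Longrightarrow> adjoin_list fs A B \<subseteq> A"
proof (induction fs rule: rev_induct)
  case (snoc f fs)
  then show ?case using adjoin_multiples_subset[of T A f "adjoin_list fs A B"]
    by (auto simp: adjoin_list_def)
qed (simp add: adjoin_list_def)

lemma adjoin_list_eq:
  "adjoin_list fs A B = {(\<Sum>j<length fs. fs ! j * y j) + b | y b. y \<in> {..<length fs} \<rightarrow> A \<and> b \<in> B}"
proof (induction fs rule: rev_induct)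
  case (snoc f fs)
  let ?S = "\<lambda>fs. {(\<Sum>j<length fs. fs ! j * y j) + b | y b. y \<in> {..<length fs} \<rightarrow> A \<and> b \<in> B}"
  have "adjoin_list (fs @ [f]) A B = adjoin_multiples f A (?S fs)"
    using snoc by (simp add: adjoin_list_def)
  also have "\<dots> = ?S (fs @ [f])"
  proof (intro Set.set_eqI iffI)
    fix x assume "x \<in> adjoin_multiples f A (?S fs)"
    then obtain a y b where *: "a \<in> A" "y \<in> {..<length fs} \<rightarrow> A" "b \<in> B"
      "x = f * a + ((\<Sum>j<length fs. fs ! j * y j) + b)"
      by (auto elim!: adjoin_multiplesE)
    have "(\<Sum>j<length (fs @ [f]). (fs @ [f]) ! j * (y(length fs := a)) j) = (\<Sum>j<length fs. fs ! j * y j) + f * a"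
      by (simp add: nth_append)
    with * have "x = (\<Sum>j<length (fs @ [f]). (fs @ [f]) ! j * (y(length fs := a)) j) + b"
      by (simp add: algebra_simps)
    moreover have "y(length fs := a) \<in> {..<length (fs @ [f])} \<rightarrow> A"
      using * by (auto simp: Pi_def less_Suc_eq)
    ultimately show "x \<in> ?S (fs @ [f])" using * by blast
  next
    fix x assume "x \<in> ?S (fs @ [f])"
    then obtain y b where *: "y \<in> {..<length (fs @ [f])} \<rightarrow> A" "b \<in> B"
      "x = (\<Sum>j<length (fs @ [f]). (fs @ [f]) ! j * y j) + b" by blast
    have "(\<Sum>j<length (fs @ [f]). (fs @ [f]) ! j * y j) = (\<Sum>j<length fs. fs ! j * y j) + f * y (length fs)"
      by (simp add: nth_append)
    with * have "x = f * y (length fs) + ((\<Sum>j<length fs. fs ! j * y j) + b)"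
      by (simp add: algebra_simps)
    moreover have "y \<in> {..<length fs} \<rightarrow> A" using * by auto
    moreover have "y (length fs) \<in> A" using * by auto
    ultimately show "x \<in> adjoin_multiples f A (?S fs)" using * by (intro adjoin_multiplesI) blast+
  qed
  finally show ?case .
qed (auto simp: adjoin_list_def)

text \<open>Modules of cosets are handled only through representatives: the locale expresses the
  operations of $J/I$ by \<open>cls\<close> and then states regularity of a sequence in terms of the
  pair of submodules \<open>I\<close>, \<open>J\<close> alone.\<close>

locale ideal_quotient =
  fixes V :: "nat set" and I J :: "'k::field mpolynomial set"
  assumes sub_I: "submodule_set (poly_carrier V) I"
    and sub_J: "submodule_set (poly_carrier V) J"
    and I_J: "I \<subseteq> J" and J_carrier: "J \<subseteq> poly_carrier V"
begin

abbreviation "cls p \<equiv> I +>\<^bsub>ideal_module (poly_ring V) J\<^esub> p"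
abbreviation "Q \<equiv> ideal_quot (poly_ring V) J I"

lemmas I_closed = submodule_setD[OF sub_I] and J_closed = submodule_setD[OF sub_J]

lemma in_cls_iff: "q \<in> cls p \<longleftrightarrow> q - p \<in> I"
proof
  assume "q \<in> cls p"
  then show "q - p \<in> I" by (auto simp: a_r_coset_def' ideal_module_def)
next
  assume "q - p \<in> I"
  then show "q \<in> cls p" by (auto simp: a_r_coset_def' ideal_module_def intro!: bexI[of _ "q - p"])
qed

lemma cls_eq_iff: "cls p = cls q \<longleftrightarrow> p - q \<in> I"
proof
  assume "cls p = cls q"
  moreover have "p \<in> cls p" using I_closed(1) by (simp add: in_cls_iff)
  ultimately show "p - q \<in> I" by (simp add: in_cls_iff)
next
  assume pq: "p - q \<in> I"
  have "x - p \<in> I \<longleftrightarrow> x - q \<in> I" for x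
    using I_closed(2)[OF _ pq, of "x - p"] I_closed(4)[OF _ pq, of "x - q"] by auto
  then show "cls p = cls q" by (auto simp: in_cls_iff)
qed

lemma carrier_Q: "carrier Q = cls ` J"
  by (auto simp: ideal_quot_def quot_module_def A_RCOSETS_def' ideal_module_def)

lemma zero_Q: "\<zero>\<^bsub>Q\<^esub> = cls 0"
  by (auto simp: ideal_quot_def quot_module_def in_cls_iff)

lemma add_Q: "cls p \<oplus>\<^bsub>Q\<^esub> cls q = cls (p + q)"
proof -
  have "cls p \<oplus>\<^bsub>Q\<^esub> cls q = {x + y | x y. x \<in> cls p \<and> y \<in> cls q}"
    by (auto simp: ideal_quot_def quot_module_def set_add_def' ideal_module_def)
  also have "\<dots> = cls (p + q)"
  proof (intro Set.set_eqI iffI)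
    fix z assume "z \<in> {x + y | x y. x \<in> cls p \<and> y \<in> cls q}"
    then obtain x y where "z = x + y" "x - p \<in> I" "y - q \<in> I" by (auto simp: in_cls_iff)
    then show "z \<in> cls (p + q)"
      using I_closed(2)[of "x - p" "y - q"] by (simp add: in_cls_iff algebra_simps)
  next
    fix z assume "z \<in> cls (p + q)"
    then have "z = p + (z - p)" "p \<in> cls p" "z - p \<in> cls q"
      using I_closed(1) by (simp_all add: in_cls_iff algebra_simps)
    then show "z \<in> {x + y | x y. x \<in> cls p \<and> y \<in> cls q}" by blast
  qed
  finally show ?thesis .
qed

lemma smult_Q:
  assumes "r \<in> poly_carrier V"
  shows "r \<odot>\<^bsub>Q\<^esub> cls p = cls (r * p)"
proof -
  have "r \<odot>\<^bsub>Q\<^esub> cls p = (\<Union>x\<in>cls p. cls (r * x))"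
    by (simp add: ideal_quot_def quot_module_def) (simp add: ideal_module_def)
  also have "\<dots> = cls (r * p)"
  proof -
    \<comment> \<open>All cosets in the union that defines scalar multiplication coincide, because
      \<open>I\<close> is closed under multiplication by \<open>r\<close>.\<close>
    have "cls (r * x) = cls (r * p)" if "x \<in> cls p" for x
      using I_closed(5)[OF assms, of "x - p"] that by (simp add: in_cls_iff cls_eq_iff algebra_simps)
    moreover have "p \<in> cls p" using I_closed(1) by (simp add: in_cls_iff)
    ultimately show ?thesis by blast
  qed
  finally show ?thesis .
qed

lemma abelian_group_Q: "abelian_group Q"
proof (rule abelian_groupI)
  show "\<exists>y\<in>carrier Q. y \<oplus>\<^bsub>Q\<^esub> x = \<zero>\<^bsub>Q\<^esub>" if "x \<in> carrier Q" for x
  proof -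
    from that obtain p where "p \<in> J" "x = cls p" by (auto simp: carrier_Q)
    then show ?thesis
      by (intro bexI[of _ "cls (- p)"]) (auto simp: carrier_Q add_Q zero_Q J_closed)
  qed
qed (auto simp: carrier_Q zero_Q add_Q J_closed algebra_simps)

lemma finsum_Q:
  assumes "finite X" "\<And>i. i \<in> X \<Longrightarrow> f i \<in> J" "\<And>i. i \<in> X \<Longrightarrow> y i = cls (f i)"
  shows "(\<Oplus>\<^bsub>Q\<^esub>i\<in>X. y i) = cls (\<Sum>i\<in>X. f i)"
proof -
  interpret abelian_group Q by (rule abelian_group_Q)
  from assms show ?thesis
  proof (induction X rule: finite_induct)
    case empty
    then show ?case by (simp add: zero_Q)
  next
    case (insert a X)
    then have y: "y \<in> X \<rightarrow> carrier Q" "y a \<in> carrier Q" by (auto simp: carrier_Q)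
    have "(\<Oplus>\<^bsub>Q\<^esub>i\<in>insert a X. y i) = y a \<oplus>\<^bsub>Q\<^esub> (\<Oplus>\<^bsub>Q\<^esub>i\<in>X. y i)"
      by (rule finsum_insert) (use insert y in auto)
    also have "\<dots> = cls (\<Sum>i\<in>insert a X. f i)"
      using insert by (simp add: add_Q)
    finally show ?case .
  qed
qed

lemma elements_times_Q:
  assumes fs: "set fs \<subseteq> poly_carrier V"
  shows "elements_times_module Q fs = cls ` adjoin_list fs J I"
proof -
  have eq: "(\<Oplus>\<^bsub>Q\<^esub>j\<in>{..<length fs}. (fs ! j) \<odot>\<^bsub>Q\<^esub> y j) = cls (\<Sum>j<length fs. fs ! j * z j)"
    if "\<And>j. j < length fs \<Longrightarrow> z j \<in> J \<and> y j = cls (z j)" for y z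
    using that fs by (intro finsum_Q) (auto simp: smult_Q subset_iff intro!: J_closed)
  show ?thesis
  proof (intro Set.set_eqI iffI)
    fix X assume "X \<in> elements_times_module Q fs"
    then obtain y where y: "y \<in> {..<length fs} \<rightarrow> carrier Q"
        "X = (\<Oplus>\<^bsub>Q\<^esub>j\<in>{..<length fs}. (fs ! j) \<odot>\<^bsub>Q\<^esub> y j)"
      by (auto simp: elements_times_module_def)
    then have "\<forall>j<length fs. \<exists>p. p \<in> J \<and> y j = cls p" by (auto simp: carrier_Q)
    then obtain z where z: "\<And>j. j < length fs \<Longrightarrow> z j \<in> J \<and> y j = cls (z j)" by metis
    then have "X = cls ((\<Sum>j<length fs. fs ! j * z j) + 0)" using eq y by simp
    moreover have "(\<Sum>j<length fs. fs ! j * z j) + 0 \<in> adjoin_list fs J I"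
      unfolding adjoin_list_eq using z I_closed(1) by blast
    ultimately show "X \<in> cls ` adjoin_list fs J I" by blast
  next
    fix X assume "X \<in> cls ` adjoin_list fs J I"
    then obtain z b where z: "z \<in> {..<length fs} \<rightarrow> J" "b \<in> I"
        "X = cls ((\<Sum>j<length fs. fs ! j * z j) + b)"
      unfolding adjoin_list_eq by auto
    have "X = cls (\<Sum>j<length fs. fs ! j * z j)" using z by (simp add: cls_eq_iff)
    then have "X = (\<Oplus>\<^bsub>Q\<^esub>j\<in>{..<length fs}. (fs ! j) \<odot>\<^bsub>Q\<^esub> cls (z j))"
      using eq[of z "\<lambda>j. cls (z j)"] z by auto
    moreover have "(\<lambda>j. cls (z j)) \<in> {..<length fs} \<rightarrow> carrier Q" using z by (auto simp: carrier_Q)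
    ultimately show "X \<in> elements_times_module Q fs"
      unfolding elements_times_module_def by (intro CollectI exI[of _ "\<lambda>j. cls (z j)"] conjI)
  qed
qed

text \<open>Third isomorphism theorem: $(J/I)/(W/I)$ is $J/W$. An element on the left is a set of
  cosets, namely the image under \<open>cls\<close> of a coset $p + W$; being zero and
  multiplication by \<open>f\<close> can therefore be read off from \<open>p\<close>.\<close>

lemma regular_element_quotient_iff:
  assumes W: "submodule_set (poly_carrier V) W" "I \<subseteq> W" "W \<subseteq> J" and f: "f \<in> poly_carrier V"
  shows "regular_element (quot_module Q (cls ` W)) f \<longleftrightarrow> (\<forall>p\<in>J. f * p \<in> W \<longrightarrow> p \<in> W)"
proof -
  note W_closed = submodule_setD[OF W(1)]
  have coset: "(cls ` W) +>\<^bsub>Q\<^esub> cls p = cls ` {r. r - p \<in> W}" for p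
  proof -
    have "(cls ` W) +>\<^bsub>Q\<^esub> cls p = (\<lambda>q. cls (q + p)) ` W"
      by (auto simp: a_r_coset_def'[of Q] add_Q)
    also have "\<dots> = cls ` {r. r - p \<in> W}"
    proof -
      have "r \<in> (\<lambda>q. q + p) ` W" if "r - p \<in> W" for r
        using that by (intro image_eqI[of _ _ "r - p"]) simp_all
      then have "{r. r - p \<in> W} = (\<lambda>q. q + p) ` W" by auto
      then show ?thesis by (simp add: image_image)
    qed
    finally show ?thesis .
  qed
  have cls_in: "cls r \<in> cls ` W \<longleftrightarrow> r \<in> W" for r
  proof
    assume "cls r \<in> cls ` W"
    then obtain q where "q \<in> W" "r - q \<in> W" using W(2) by (auto simp: cls_eq_iff)
    then show "r \<in> W" using W_closed(2)[of q "r - q"] by simp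
  qed auto
  have eq_zero: "cls ` {r. r - p \<in> W} = cls ` W \<longleftrightarrow> p \<in> W" for p
  proof
    assume eq: "cls ` {r. r - p \<in> W} = cls ` W"
    have "cls p \<in> cls ` {r. r - p \<in> W}" using W_closed(1) by auto
    then show "p \<in> W" using eq cls_in by simp
  next
    assume "p \<in> W"
    then have "r - p \<in> W \<longleftrightarrow> r \<in> W" for r
      using W_closed(2)[of "r - p" p] W_closed(4)[of r p] by auto
    then show "cls ` {r. r - p \<in> W} = cls ` W" by simp
  qed
  have smult: "f \<odot>\<^bsub>quot_module Q (cls ` W)\<^esub> (cls ` {r. r - p \<in> W}) = cls ` {r. r - f * p \<in> W}" for p
  proof -
    have "f \<odot>\<^bsub>quot_module Q (cls ` W)\<^esub> (cls ` {r. r - p \<in> W})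
        = (\<Union>r\<in>{r. r - p \<in> W}. (cls ` W) +>\<^bsub>Q\<^esub> (f \<odot>\<^bsub>Q\<^esub> cls r))"
      by (simp add: quot_module_def)
    also have "\<dots> = (\<Union>r\<in>{r. r - p \<in> W}. cls ` {s. s - f * r \<in> W})"
      by (simp add: smult_Q f coset)
    also have "\<dots> = cls ` {r. r - f * p \<in> W}"
    proof -
      have "{s. s - f * r \<in> W} = {s. s - f * p \<in> W}" if "r - p \<in> W" for r
      proof -
        have "f * r - f * p \<in> W" using W_closed(5)[OF f that] by (simp add: algebra_simps)
        then have "s - f * r \<in> W \<longleftrightarrow> s - f * p \<in> W" for s
          using W_closed(2)[of "s - f * r" "f * r - f * p"] W_closed(4)[of "s - f * p" "f * r - f * p"]
          by auto
        then show ?thesis by simp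
      qed
      moreover have "p \<in> {r. r - p \<in> W}" using W_closed(1) by simp
      ultimately show ?thesis by (metis (no_types, lifting) SUP_eq_const empty_iff mem_Collect_eq)
    qed
    finally show ?thesis .
  qed
  have carrier: "carrier (quot_module Q (cls ` W)) = (\<lambda>p. cls ` {r. r - p \<in> W}) ` J"
    by (auto simp: quot_module_def A_RCOSETS_def' carrier_Q coset)
  have zero: "\<zero>\<^bsub>quot_module Q (cls ` W)\<^esub> = cls ` W" by (simp add: quot_module_def)
  show ?thesis
    unfolding regular_element_def carrier zero by (simp add: smult eq_zero)
qed

text \<open>Properness passes from cosets to submodules because \<open>adjoin_list fs J I\<close>
  contains \<open>I\<close> and is thus determined by its image under \<open>cls\<close>.\<close>

lemma regular_sequence_iff:
  assumes fs: "set fs \<subseteq> poly_carrier V"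
  shows "regular_sequence Q fs \<longleftrightarrow> weakly_regular fs J I \<and> adjoin_list fs J I \<noteq> J"
proof -
  have W: "submodule_set (poly_carrier V) (adjoin_list gs J I)" "I \<subseteq> adjoin_list gs J I"
      "adjoin_list gs J I \<subseteq> J" if "set gs \<subseteq> set fs" for gs
    using that fs submodule_set_adjoin_list[OF sub_J sub_I] adjoin_list_supset[OF sub_J]
      adjoin_list_subset[OF sub_J _ I_J] by auto
  have reg: "regular_element (quot_module Q (elements_times_module Q (take i fs))) (fs ! i) \<longleftrightarrow>
     (\<forall>x\<in>J. fs ! i * x \<in> adjoin_list (take i fs) J I \<longrightarrow> x \<in> adjoin_list (take i fs) J I)"
    if "i < length fs" for i
  proof -
    have "set (take i fs) \<subseteq> poly_carrier V" "fs ! i \<in> poly_carrier V"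
      using fs that set_take_subset[of i fs] by auto
    then show ?thesis
      using W[of "take i fs"] set_take_subset[of i fs]
      by (simp add: elements_times_Q regular_element_quotient_iff)
  qed
  have "cls ` adjoin_list fs J I = cls ` J \<longleftrightarrow> adjoin_list fs J I = J"
  proof
    assume eq: "cls ` adjoin_list fs J I = cls ` J"
    have "p \<in> adjoin_list fs J I" if "p \<in> J" for p
    proof -
      have "cls p \<in> cls ` adjoin_list fs J I" unfolding eq using that by (rule imageI)
      then obtain q where "q \<in> adjoin_list fs J I" "p - q \<in> I"
        unfolding image_iff cls_eq_iff by blast
      then show ?thesis using W[of fs] submodule_setD(2)[OF W(1)[of fs], of q "p - q"] by auto
    qed
    then show "adjoin_list fs J I = J" using W(3)[of fs] by auto
  qed simp
  then show ?thesis
    using reg unfolding regular_sequence_def weakly_regular_iff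
    by (simp add: elements_times_Q[OF fs] carrier_Q)
qed

end

section \<open>Regular sequences and annihilated monomials\<close>

text \<open>A homogeneous linear system with unknowns \<open>X\<close> and fewer equations
  \<open>Y\<close>. Gaussian elimination removes one equation together with one pivot unknown, which
  preserves the inequality between the two numbers.\<close>

lemma nontrivial_solution:
  fixes F :: "'x \<Rightarrow> 'y \<Rightarrow> 'k::field"
  assumes "finite Y" "finite X" "card Y < card X"
  obtains c where "\<exists>x\<in>X. c x \<noteq> 0" "\<And>y. y \<in> Y \<Longrightarrow> (\<Sum>x\<in>X. c x * F x y) = 0"
proof -
  have "\<exists>c. (\<exists>x\<in>X. c x \<noteq> 0) \<and> (\<forall>y\<in>Y. (\<Sum>x\<in>X. c x * F x y) = 0)"
    using assms
  proof (induction Y arbitrary: X F rule: finite_induct)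
    case empty
    then have "X \<noteq> {}" by auto
    then show ?case by (intro exI[of _ "\<lambda>_. 1"]) auto
  next
    case (insert y Y)
    show ?case
    proof (cases "\<forall>x\<in>X. F x y = 0")
      case True
      obtain c where "\<exists>x\<in>X. c x \<noteq> 0" "\<forall>y\<in>Y. (\<Sum>x\<in>X. c x * F x y) = 0"
        using insert.IH[of X F] insert.prems insert.hyps by (auto simp del: Bex_def)
      with True show ?thesis by (intro exI[of _ c]) auto
    next
      case False
      then obtain x0 where x0: "x0 \<in> X" "F x0 y \<noteq> 0" by blast
      define X' where "X' = X - {x0}"
      \<comment> \<open>Coefficients of the remaining equations after equation \<open>y\<close> has
        been solved for the pivot unknown \<open>x0\<close>; \<open>- s\<close> below is the value
        of that unknown.\<close>
      define G where "G x z = F x z - F x y / F x0 y * F x0 z" for x z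
      have X: "X = insert x0 X'" "x0 \<notin> X'" "finite X'" using x0 insert.prems by (auto simp: X'_def)
      have "card Y < card X'" using insert X by simp
      then obtain c where c: "\<exists>x\<in>X'. c x \<noteq> 0" "\<forall>z\<in>Y. (\<Sum>x\<in>X'. c x * G x z) = 0"
        using insert.IH[of X' G] X by blast
      define s where "s = (\<Sum>x\<in>X'. c x * F x y) / F x0 y"
      define c' where "c' = c(x0 := - s)"
      have sum: "(\<Sum>x\<in>X. c' x * F x z) = (\<Sum>x\<in>X'. c x * F x z) - s * F x0 z" for z
      proof -
        have "(\<Sum>x\<in>X'. c' x * F x z) = (\<Sum>x\<in>X'. c x * F x z)"
          by (rule sum.cong) (use X in \<open>auto simp: c'_def\<close>)
        then show ?thesis using X by (simp add: c'_def)
      qed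
      have "(\<Sum>x\<in>X. c' x * F x z) = 0" if "z \<in> insert y Y" for z
      proof (cases "z = y")
        case True
        then show ?thesis using x0 by (simp add: sum s_def)
      next
        case False
        then have "0 = (\<Sum>x\<in>X'. c x * G x z)" using c that by simp
        also have "\<dots> = (\<Sum>x\<in>X'. c x * F x z) - s * F x0 z"
        proof -
          have "c x * G x z = c x * F x z - c x * F x y / F x0 y * F x0 z" for x
            by (simp add: G_def algebra_simps)
          then show ?thesis by (simp add: s_def sum_subtractf sum_divide_distrib sum_distrib_right)
        qed
        finally show ?thesis by (simp add: sum)
      qed
      moreover have "\<exists>x\<in>X. c' x \<noteq> 0" using c X by (auto simp: c'_def)
      ultimately show ?thesis by blast
    qed
  qed
  then show ?thesis using that by blast
qed

lemma lookup_const_mult: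
  fixes p :: "'k::field mpolynomial"
  shows "Poly_Mapping.lookup (Poly_Mapping.single 0 c * p) m = c * Poly_Mapping.lookup p m"
  using lookup_single_mult[of 0 c p m] by simp

definition list_power :: "'a::comm_ring_1 list \<Rightarrow> nat list \<Rightarrow> 'a"
  where "list_power fs as = prod_list (map2 (^) fs as)"

lemma list_power_simps [simp]:
  "list_power [] as = 1" "list_power (f # fs) (a # as) = f ^ a * list_power fs as"
  by (simp_all add: list_power_def)

lemma list_power_in_poly_carrier:
  "set fs \<subseteq> poly_carrier V \<Longrightarrow> list_power fs as \<in> poly_carrier V"
proof (induction fs arbitrary: as)
  case (Cons f fs)
  then show ?case by (cases as) (auto simp: list_power_def poly_carrier_closed)
qed simp

text \<open>In a relation among the $f^\alpha u$ divide by the lowest power of the first element that occurs and reduce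
  modulo this element; the remaining relation is shorter.\<close>

lemma monomials_in_regular_sequence_independent:
  fixes fs :: "'k::field mpolynomial list"
  assumes A: "submodule_set (poly_carrier V) A" and fs: "set fs \<subseteq> poly_carrier V" and u: "u \<in> A"
    and B: "submodule_set (poly_carrier V) B" and reg: "weakly_regular fs A B"
    and X: "finite X" "X \<subseteq> {as. length as = length fs}"
    and sum: "(\<Sum>as\<in>X. Poly_Mapping.single 0 (c as) * list_power fs as * u) \<in> B"
    and notin: "u \<notin> adjoin_list fs A B"
  shows "\<forall>as\<in>X. c as = 0"
  using fs B reg X sum notin
proof (induction fs arbitrary: B X c)
  case Nil
  show ?case
  proof (rule ccontr)
    assume *: "\<not> (\<forall>as\<in>X. c as = 0)"
    with Nil have X: "X = {[]}" and c: "c [] \<noteq> 0" by auto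
    then have "Poly_Mapping.single 0 (c []) * u \<in> B" using Nil by simp
    then have "Poly_Mapping.single 0 (1 / c []) * (Poly_Mapping.single 0 (c []) * u) \<in> B"
      by (rule submodule_setD(5)[OF Nil(2), rotated]) auto
    moreover have "Poly_Mapping.single 0 (1 / c []) * (Poly_Mapping.single 0 (c []) * u) = u"
      using c by (simp only: mult.assoc[symmetric] mult_single) simp
    ultimately have "u \<in> B" by simp
    with Nil show False by (simp add: adjoin_list_def)
  qed
next
  case (Cons f fs)
  note A' = submodule_setD[OF A] and B' = submodule_setD[OF Cons.prems(2)]
  have f: "f \<in> poly_carrier V" using Cons.prems by simp
  let ?k = "\<lambda>a. Poly_Mapping.single 0 a :: 'k mpolynomial"
  show ?case
  proof (rule ccontr)
    assume *: "\<not> (\<forall>as\<in>X. c as = 0)"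
    define X' where "X' = {as \<in> X. c as \<noteq> 0}"
    have X': "finite X'" "X' \<noteq> {}" "X' \<subseteq> X" using * Cons.prems by (auto simp: X'_def)
    define a where "a = Min (hd ` X')"
    have a: "a \<in> hd ` X'" "\<And>as. as \<in> X' \<Longrightarrow> a \<le> hd as" using X' by (auto simp: a_def)
    define Y where "Y = {as \<in> X'. hd as = a}"
    have nonempty: "as \<noteq> []" if "as \<in> X'" for as using that X' Cons.prems by auto
    define t where "t as = ?k (c as) * f ^ (hd as - a) * list_power fs (tl as) * u" for as
    have tA: "t as \<in> A" for as
      unfolding t_def using f u Cons.prems(1)
      by (auto intro!: A' poly_carrier_closed list_power_in_poly_carrier)
    have inj: "y \<in> B" if "y \<in> A" "f ^ j * y \<in> B" for y j
      using that(2)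
    proof (induction j)
      case (Suc j)
      have "f ^ j * y \<in> A" using that f by (auto intro!: A' poly_carrier_closed)
      then show ?case using Suc Cons.prems(3) by (simp add: mult.assoc)
    qed simp
    have "(\<Sum>as\<in>X. ?k (c as) * list_power (f # fs) as * u) = (\<Sum>as\<in>X'. ?k (c as) * list_power (f # fs) as * u)"
      by (rule sum.mono_neutral_right) (use Cons.prems X' in \<open>auto simp: X'_def\<close>)
    also have "\<dots> = (\<Sum>as\<in>X'. f ^ a * t as)"
    proof (rule sum.cong)
      fix as assume as: "as \<in> X'"
      then have "list_power (f # fs) as = f ^ hd as * list_power fs (tl as)"
        using nonempty by (cases as) auto
      also have "f ^ hd as = f ^ a * f ^ (hd as - a)" using a(2)[OF as] by (simp flip: power_add)
      finally show "?k (c as) * list_power (f # fs) as * u = f ^ a * t as"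
        by (simp add: t_def ac_simps)
    qed simp
    finally have "f ^ a * (\<Sum>as\<in>X'. t as) \<in> B" using Cons.prems by (simp add: sum_distrib_left)
    moreover have "(\<Sum>as\<in>X'. t as) \<in> A" using tA by (intro submodule_set_sum[OF A])
    ultimately have tB: "(\<Sum>as\<in>X'. t as) \<in> B" by (rule inj[rotated])
    have "(\<Sum>as\<in>X' - Y. t as) = f * (\<Sum>as\<in>X' - Y. ?k (c as) * f ^ (hd as - Suc a) * list_power fs (tl as) * u)"
      unfolding sum_distrib_left
    proof (rule sum.cong)
      fix as assume "as \<in> X' - Y"
      then have "a < hd as" using a(2)[of as] by (auto simp: Y_def)
      then have "f ^ (hd as - a) = f * f ^ (hd as - Suc a)" by (simp flip: power_Suc add: Suc_diff_Suc)
      then show "t as = f * (?k (c as) * f ^ (hd as - Suc a) * list_power fs (tl as) * u)"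
        by (simp add: t_def ac_simps)
    qed simp
    moreover have "(\<Sum>as\<in>X' - Y. ?k (c as) * f ^ (hd as - Suc a) * list_power fs (tl as) * u) \<in> A"
      using f u Cons.prems(1)
      by (intro submodule_set_sum[OF A] A') (auto intro!: poly_carrier_closed list_power_in_poly_carrier)
    moreover have "(\<Sum>as\<in>X'. t as) = (\<Sum>as\<in>Y. t as) + (\<Sum>as\<in>X' - Y. t as)"
      using X'(1) by (subst sum.subset_diff[of Y X']) (auto simp: Y_def)
    ultimately have "(\<Sum>as\<in>Y. t as) \<in> adjoin_multiples f A B"
      using tB A'(3) by (intro adjoin_multiplesI[of "- (\<Sum>as\<in>X' - Y. ?k (c as) * f ^ (hd as - Suc a) * list_power fs (tl as) * u)" A "\<Sum>as\<in>X'. t as"]) auto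
    \<comment> \<open>On \<open>Y\<close> all heads equal \<open>a\<close>, so the tails are
      distinct and index a relation among the remaining elements modulo $fA + B$.\<close>
    moreover have "(\<Sum>as\<in>Y. t as) = (\<Sum>bs\<in>tl ` Y. ?k (c (a # bs)) * list_power fs bs * u)"
    proof -
      have eq: "as = a # tl as" if "as \<in> Y" for as
        using that nonempty[of as] by (cases as) (auto simp: Y_def)
      then have "inj_on tl Y" by (metis inj_onI)
      then have "(\<Sum>bs\<in>tl ` Y. ?k (c (a # bs)) * list_power fs bs * u)
          = (\<Sum>as\<in>Y. ?k (c (a # tl as)) * list_power fs (tl as) * u)"
        by (simp add: sum.reindex)
      also have "\<dots> = (\<Sum>as\<in>Y. t as)"
        using eq by (intro sum.cong) (auto simp: t_def Y_def)
      finally show ?thesis by simp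
    qed
    ultimately have "(\<Sum>bs\<in>tl ` Y. ?k (c (a # bs)) * list_power fs bs * u) \<in> adjoin_multiples f A B"
      by simp
    then have "\<forall>bs\<in>tl ` Y. c (a # bs) = 0"
      using Cons.prems X' A
      by (intro Cons.IH[of "adjoin_multiples f A B"])
         (auto simp: Y_def adjoin_list_def intro: submodule_set_adjoin_multiples)
    moreover obtain as where "as \<in> X'" "hd as = a" using a(1) by auto
    moreover from this have "as = a # tl as" using nonempty by (cases as) auto
    ultimately show False by (auto simp: Y_def X'_def)
  qed
qed

section \<open>Counting monomials, and algebraic dependence\<close>

lemma finite_card_bounded_monomials:
  assumes "finite Z"
  shows "finite {m :: nat \<Rightarrow>\<^sub>0 nat. Poly_Mapping.keys m \<subseteq> Z \<and> (\<forall>j. Poly_Mapping.lookup m j \<le> b)}" (is "finite ?M")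
    and "card {m :: nat \<Rightarrow>\<^sub>0 nat. Poly_Mapping.keys m \<subseteq> Z \<and> (\<forall>j. Poly_Mapping.lookup m j \<le> b)} \<le> (b + 1) ^ card Z"
proof -
  let ?f = "\<lambda>m. restrict (Poly_Mapping.lookup m) Z"
  have inj: "inj_on ?f ?M"
  proof (rule inj_onI, rule poly_mapping_eqI)
    fix m m' :: "nat \<Rightarrow>\<^sub>0 nat" and k
    assume *: "m \<in> ?M" "m' \<in> ?M" "?f m = ?f m'"
    show "Poly_Mapping.lookup m k = Poly_Mapping.lookup m' k"
    proof (cases "k \<in> Z")
      case True
      then show ?thesis using fun_cong[OF *(3), of k] by simp
    next
      case False
      then have "k \<notin> Poly_Mapping.keys m" "k \<notin> Poly_Mapping.keys m'" using * by auto
      then show ?thesis by (simp add: in_keys_iff)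
    qed
  qed
  have img: "?f ` ?M \<subseteq> Z \<rightarrow>\<^sub>E {..b}" by auto
  have fin: "finite (Z \<rightarrow>\<^sub>E {..b})" using assms by (intro finite_PiE) auto
  show "finite ?M" using finite_imageD[OF finite_subset[OF img fin] inj] .
  show "card ?M \<le> (b + 1) ^ card Z"
    using card_inj_on_le[OF inj img fin] assms by (simp add: card_PiE)
qed

lemma lookup_power_le:
  fixes p :: "'k::field mpolynomial"
  assumes "\<And>m. m \<in> Poly_Mapping.keys p \<Longrightarrow> Poly_Mapping.lookup m j \<le> b"
    and "m \<in> Poly_Mapping.keys (p ^ a)"
  shows "Poly_Mapping.lookup m j \<le> b * a"
  using assms(2)
proof (induction a arbitrary: m)
  case (Suc a)
  then show ?case
    using assms(1) by (auto elim!: keys_multE simp: lookup_add intro!: add_mono)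
qed simp

lemma lookup_list_power_le:
  fixes fs :: "'k::field mpolynomial list"
  assumes "\<And>f m. f \<in> set fs \<Longrightarrow> m \<in> Poly_Mapping.keys f \<Longrightarrow> Poly_Mapping.lookup m j \<le> b"
    and "length as = length fs" "set as \<subseteq> {..L}" "m \<in> Poly_Mapping.keys (list_power fs as)"
  shows "Poly_Mapping.lookup m j \<le> length fs * (b * L)"
  using assms
proof (induction fs arbitrary: as m)
  case (Cons f fs)
  then obtain a bs where as: "as = a # bs" by (cases as) auto
  with Cons.prems obtain m1 m2 where m: "m1 \<in> Poly_Mapping.keys (f ^ a)"
      "m2 \<in> Poly_Mapping.keys (list_power fs bs)" "m = m1 + m2"
    by (auto elim: keys_multE)
  have "Poly_Mapping.lookup m1 j \<le> b * a"
    by (rule lookup_power_le[OF _ m(1)]) (use Cons.prems in auto)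
  also have "\<dots> \<le> b * L" using Cons.prems as by simp
  finally have "Poly_Mapping.lookup m1 j \<le> b * L" .
  moreover have "Poly_Mapping.lookup m2 j \<le> length fs * (b * L)"
    by (rule Cons.IH[of bs]) (use Cons.prems as m in auto)
  ultimately show ?case using m by (simp add: lookup_add)
qed simp

text \<open>For large \<open>L\<close> the products of powers of \<open>fs\<close> with exponents at most \<open>L\<close> outnumber the monomials
  in \<open>Z\<close> in which they can be expanded.\<close>

lemma algebraic_dependence:
  fixes fs :: "'k::field mpolynomial list"
  assumes Z: "finite Z" "card Z < length fs"
  obtains X c where "finite X" "X \<subseteq> {as. length as = length fs}" "\<exists>as\<in>X. c as \<noteq> 0"
    "\<And>m. m \<in> Poly_Mapping.keys (\<Sum>as\<in>X. Poly_Mapping.single 0 (c as) * list_power fs as)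
       \<Longrightarrow> \<not> Poly_Mapping.keys m \<subseteq> Z"
proof -
  \<comment> \<open>\<open>range\<close> collects only the nonzero exponents; 0 is added for the
    variables absent from \<open>m\<close>.\<close>
  define W where "W = (\<Union>f\<in>set fs. \<Union>m\<in>Poly_Mapping.keys f. insert 0 (Poly_Mapping.range m))"
  have "finite W" by (auto simp: W_def)
  define b where "b = Max (insert 0 W)"
  have b: "Poly_Mapping.lookup m j \<le> b" if "f \<in> set fs" "m \<in> Poly_Mapping.keys f" for f m j
  proof -
    have "Poly_Mapping.lookup m j \<in> W"
    proof (cases "j \<in> Poly_Mapping.keys m")
      case True
      then have "Poly_Mapping.lookup m j \<in> Poly_Mapping.range m" by simp
      with that show ?thesis by (auto simp: W_def)
    next
      case False
      then show ?thesis using that by (auto simp: W_def in_keys_iff)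
    qed
    with \<open>finite W\<close> show ?thesis by (simp add: b_def)
  qed
  define r where "r = length fs"
  \<comment> \<open>Chosen to make the count close: \<open>Y\<close> has at most $(rbL + 1)^{|Z|}$
    elements, which is at most $((rb + 1)(L + 1))^{|Z|} = L (L + 1)^{|Z|}$ and so less than $(L +
    1)^{|Z| + 1}$, whereas \<open>X\<close> has $(L + 1)^r$ elements and $r > |Z|$.\<close>
  define L where "L = (r * b + 1) ^ card Z"
  define X where "X = {as. set as \<subseteq> {..L} \<and> length as = r}"
  define Y where "Y = {m :: nat \<Rightarrow>\<^sub>0 nat. Poly_Mapping.keys m \<subseteq> Z \<and> (\<forall>j. Poly_Mapping.lookup m j \<le> r * (b * L))}"
  have X: "finite X" "card X = (L + 1) ^ r"
    by (simp_all add: X_def finite_lists_length_eq card_lists_length_eq)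
  have "card Y \<le> (r * (b * L) + 1) ^ card Z"
    unfolding Y_def using finite_card_bounded_monomials(2)[OF Z(1)] .
  also have "\<dots> \<le> ((r * b + 1) * (L + 1)) ^ card Z"
    by (intro power_mono) (auto simp: algebra_simps)
  also have "\<dots> = L * (L + 1) ^ card Z" by (simp only: power_mult_distrib L_def)
  also have "\<dots> < (L + 1) * (L + 1) ^ card Z" by simp
  also have "\<dots> = (L + 1) ^ Suc (card Z)" by simp
  also have "\<dots> \<le> (L + 1) ^ r" using Z unfolding r_def by (intro power_increasing) auto
  finally have "card Y < card X" by (simp only: X)
  moreover have "finite Y" unfolding Y_def using finite_card_bounded_monomials(1)[OF Z(1)] .
  ultimately obtain c where c: "\<exists>as\<in>X. c as \<noteq> 0"
      "\<And>m. m \<in> Y \<Longrightarrow> (\<Sum>as\<in>X. c as * Poly_Mapping.lookup (list_power fs as) m) = 0"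
    using nontrivial_solution[OF _ X(1), of Y "\<lambda>as m. Poly_Mapping.lookup (list_power fs as) m"] by blast
  let ?G = "\<Sum>as\<in>X. Poly_Mapping.single 0 (c as) * list_power fs as"
  have lookup: "Poly_Mapping.lookup ?G m = (\<Sum>as\<in>X. c as * Poly_Mapping.lookup (list_power fs as) m)" for m
    by (simp add: lookup_sum lookup_const_mult)
  show ?thesis
  proof (rule that[of X c])
    fix m assume m: "m \<in> Poly_Mapping.keys ?G"
    then have "\<exists>as\<in>X. c as * Poly_Mapping.lookup (list_power fs as) m \<noteq> 0"
      unfolding in_keys_iff lookup using sum.not_neutral_contains_not_neutral by blast
    then obtain as where as: "as \<in> X" "m \<in> Poly_Mapping.keys (list_power fs as)" by (auto simp: in_keys_iff)
    then have "Poly_Mapping.lookup m j \<le> r * (b * L)" for j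
      unfolding r_def by (intro lookup_list_power_le[of fs j b as L]) (auto simp: X_def r_def b)
    then show "\<not> Poly_Mapping.keys m \<subseteq> Z" using c(2)[of m] m by (auto simp: Y_def in_keys_iff lookup)
  qed (use X c in \<open>auto simp: X_def r_def\<close>)
qed

text \<open>The factor \<open>p\<close> has no constant term, so each further factor raises the
  degree of every monomial by at least one. A bound on single monomials suits the inhomogeneous
  members of a regular sequence.\<close>

lemma power_total_degree:
  fixes p :: "'k::field mpolynomial"
  assumes "finite V" "p \<in> monomial_span V (\<lambda>m. \<exists>i\<in>V. i \<in> Poly_Mapping.keys m)"
    and "m \<in> Poly_Mapping.keys (p ^ N)"
  shows "N \<le> sum (Poly_Mapping.lookup m) V"
  using assms(3)
proof (induction N arbitrary: m)
  case (Suc N)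
  then obtain a b where m: "a \<in> Poly_Mapping.keys p" "b \<in> Poly_Mapping.keys (p ^ N)" "m = a + b"
    by (auto elim: keys_multE)
  then obtain i where i: "i \<in> V" "i \<in> Poly_Mapping.keys a" using assms by (auto simp: monomial_span_def)
  then have "1 \<le> Poly_Mapping.lookup a i" by (simp add: in_keys_iff)
  also have "\<dots> \<le> sum (Poly_Mapping.lookup a) V" using i assms(1) by (intro member_le_sum) auto
  finally show ?case using Suc.IH[OF m(2)] m by (simp add: lookup_add sum.distrib)
qed simp

context ideal_quotient
begin

text \<open>If \<open>fs\<close> is regular and longer than \<open>card Z\<close>, then so is the sequence of \<open>N\<close>-th powers; an algebraic
  dependence of the latter modulo the variables outside \<open>Z\<close>, which annihilate \<open>x\<^sup>e\<close>, puts \<open>x\<^sup>e\<close> into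
  the span of the \<open>N\<close>-th powers.  This is impossible when \<open>N\<close> exceeds the degree of \<open>x\<^sup>e\<close>.\<close>

lemma weakly_regular_length_le:
  assumes V: "finite V" and Z: "finite Z"
    and fs: "set fs \<subseteq> monomial_span V (\<lambda>m. \<exists>i\<in>V. i \<in> Poly_Mapping.keys m)"
    and reg: "weakly_regular fs J I"
    and e: "Poly_Mapping.single e 1 \<in> J" "\<And>p. p \<in> I \<Longrightarrow> e \<notin> Poly_Mapping.keys p"
    and ann: "\<And>m c. Poly_Mapping.keys m \<subseteq> V \<Longrightarrow> \<not> Poly_Mapping.keys m \<subseteq> Z \<Longrightarrow> Poly_Mapping.single (m + e) c \<in> I"
  shows "length fs \<le> card Z"
proof (rule ccontr)
  assume "\<not> length fs \<le> card Z"
  define N where "N = Suc (sum (Poly_Mapping.lookup e) V)"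
  define gs where "gs = map (\<lambda>f. f ^ N) fs"
  let ?u = "Poly_Mapping.single e 1 :: 'k mpolynomial"
  have fs_carrier: "set fs \<subseteq> poly_carrier V" using fs by (auto simp: monomial_span_def)
  then have gs_carrier: "set gs \<subseteq> poly_carrier V" by (auto simp: gs_def intro!: poly_carrier_closed)
  have gs_reg: "weakly_regular gs J I"
    unfolding gs_def using reg fs_carrier
    by (intro weakly_regular_power[OF sub_J sub_I I_J]) (auto intro: poly_carrier_closed)
  have "card Z < length gs" using \<open>\<not> length fs \<le> card Z\<close> by (simp add: gs_def)
  then obtain X c where X: "finite X" "X \<subseteq> {as. length as = length gs}" "\<exists>as\<in>X. c as \<noteq> (0::'k)"
    and keys: "\<And>m. m \<in> Poly_Mapping.keys (\<Sum>as\<in>X. Poly_Mapping.single 0 (c as) * list_power gs as)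
       \<Longrightarrow> \<not> Poly_Mapping.keys m \<subseteq> Z"
    using algebraic_dependence[OF Z, of gs] by blast
  let ?G = "\<Sum>as\<in>X. Poly_Mapping.single 0 (c as) * list_power gs as"
  have G: "?G \<in> poly_carrier V"
    using gs_carrier
    by (intro submodule_set_sum[of "poly_carrier V"])
       (auto simp: submodule_set_def intro!: poly_carrier_closed list_power_in_poly_carrier)
  have "?G * ?u \<in> I"
  proof (rule in_submodule_if_single[OF sub_I])
    fix m assume "m \<in> Poly_Mapping.keys (?G * ?u)"
    then obtain m' where "m' \<in> Poly_Mapping.keys ?G" "m = m' + e" by (auto elim!: keys_multE)
    then show "Poly_Mapping.single m (Poly_Mapping.lookup (?G * ?u) m) \<in> I"
      using keys[of m'] G by (auto simp: poly_carrier_iff intro!: ann)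
  qed
  then have "(\<Sum>as\<in>X. Poly_Mapping.single 0 (c as) * list_power gs as * ?u) \<in> I"
    by (simp add: sum_distrib_right)
  then have "?u \<in> adjoin_list gs J I"
    using monomials_in_regular_sequence_independent[OF sub_J gs_carrier e(1) sub_I gs_reg X(1,2)] X(3) by blast
  then obtain y b where yb: "?u = (\<Sum>j<length gs. gs ! j * y j) + b" "b \<in> I"
      "y \<in> {..<length gs} \<rightarrow> J"
    unfolding adjoin_list_eq by blast
  have "Poly_Mapping.lookup (gs ! j * y j) e = 0" if "j < length gs" for j
  proof (rule ccontr)
    assume "Poly_Mapping.lookup (gs ! j * y j) e \<noteq> 0"
    then have "e \<in> Poly_Mapping.keys (fs ! j ^ N * y j)" using that by (simp add: in_keys_iff gs_def)
    then obtain a b where ab: "a \<in> Poly_Mapping.keys (fs ! j ^ N)" "e = a + b" by (auto elim: keys_multE)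
    have "fs ! j \<in> monomial_span V (\<lambda>m. \<exists>i\<in>V. i \<in> Poly_Mapping.keys m)"
      using that fs by (auto simp: gs_def)
    then have "N \<le> sum (Poly_Mapping.lookup a) V"
      using power_total_degree[OF V _ ab(1)] by blast
    also have "\<dots> \<le> sum (Poly_Mapping.lookup e) V" by (simp add: ab lookup_add sum.distrib)
    finally show False by (simp add: N_def)
  qed
  moreover have "Poly_Mapping.lookup b e = 0" using e(2)[OF yb(2)] by (simp add: in_keys_iff)
  moreover have "Poly_Mapping.lookup ?u e = Poly_Mapping.lookup ((\<Sum>j<length gs. gs ! j * y j) + b) e"
    using yb(1) by simp
  ultimately show False by (simp add: lookup_add lookup_sum)
qed

end

section \<open>Sums of disjoint sets of variables\<close>

text \<open>As the kernel of \<open>h\<close> on \<open>A\<close> lies in \<open>B\<close>,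
  \<open>h\<close> induces an isomorphism from $A/B$ to $h(A)/h(B)$ under which \<open>f\<close>
  acts as \<open>h f\<close>. In the applications \<open>h\<close> is a substitution whose image is
  a smaller polynomial ring.\<close>

lemma weakly_regular_hom:
  assumes A: "submodule_set T A" and B: "submodule_set T B" and "B \<subseteq> A" and T: "set fs \<subseteq> T"
    and add: "\<And>x y. h (x + y) = h x + h y" and mult: "\<And>x y. h (x * y) = h x * h y"
    and ker: "\<And>x. x \<in> A \<Longrightarrow> h x = 0 \<Longrightarrow> x \<in> B"
    and reg: "weakly_regular (map h fs) (h ` A) (h ` B)"
  shows "weakly_regular fs A B"
  using B \<open>B \<subseteq> A\<close> T ker reg
proof (induction fs arbitrary: B)
  case Nil
  then show ?case by simp
next
  case (Cons f fs)
  note A' = submodule_setD[OF A] and B' = submodule_setD[OF Cons.prems(1)]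
  have f: "f \<in> T" using Cons.prems by simp
  have diff: "h (x - y) = h x - h y" for x y
    using add[of "x - y" y] by (simp add: algebra_simps)
  have "x \<in> B" if "x \<in> A" "f * x \<in> B" for x
  proof -
    have "h f * h x \<in> h ` B" using that by (simp flip: mult)
    then have "h x \<in> h ` B" using Cons.prems(5) that by simp
    then obtain b where b: "b \<in> B" "h x = h b" by auto
    then have "x - b \<in> B" using Cons.prems(2) that by (intro Cons.prems(4) A') (auto simp: diff)
    then show ?thesis using B'(2)[of "x - b" b] b by simp
  qed
  moreover have "weakly_regular fs A (adjoin_multiples f A B)"
  proof (rule Cons.IH)
    have "h ` adjoin_multiples f A B = adjoin_multiples (h f) (h ` A) (h ` B)"
    proof (intro Set.set_eqI iffI)
      fix y assume "y \<in> h ` adjoin_multiples f A B"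
      then obtain a b where "a \<in> A" "b \<in> B" "y = h (f * a + b)" by (auto elim!: adjoin_multiplesE)
      then show "y \<in> adjoin_multiples (h f) (h ` A) (h ` B)"
        by (intro adjoin_multiplesI[of "h a" _ "h b"]) (auto simp: add mult)
    next
      fix y assume "y \<in> adjoin_multiples (h f) (h ` A) (h ` B)"
      then obtain a b where *: "a \<in> A" "b \<in> B" "y = h (f * a + b)"
        by (auto elim!: adjoin_multiplesE simp: add mult)
      then have "f * a + b \<in> adjoin_multiples f A B" by (auto intro: adjoin_multiplesI)
      with * show "y \<in> h ` adjoin_multiples f A B" by blast
    qed
    then show "weakly_regular (map h fs) (h ` A) (h ` adjoin_multiples f A B)" using Cons.prems by simp
    show "adjoin_multiples f A B \<subseteq> A"
      by (rule adjoin_multiples_subset[OF A f Cons.prems(2)])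
    show "x \<in> adjoin_multiples f A B" if "x \<in> A" "h x = 0" for x
      using adjoin_multiples_supset[OF A, of B f] Cons.prems(4)[OF that] by blast
  qed (use Cons.prems A in \<open>auto intro: submodule_set_adjoin_multiples\<close>)
  ultimately show ?case by simp
qed

lemma poly_carrier_mono: "Z \<subseteq> V \<Longrightarrow> poly_carrier Z \<subseteq> poly_carrier V"
  unfolding poly_carrier_iff subset_iff by blast

section \<open>Substitution of polynomials for variables\<close>

definition subst_monomial :: "(nat \<Rightarrow> 'k::field mpolynomial) \<Rightarrow> (nat \<Rightarrow>\<^sub>0 nat) \<Rightarrow> 'k mpolynomial"
  where "subst_monomial s m = (\<Prod>i\<in>Poly_Mapping.keys m. s i ^ Poly_Mapping.lookup m i)"

text \<open>The K-algebra endomorphism that sends $x_i$ to \<open>s i\<close>;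
  \<open>single 0 c\<close> is the constant \<open>c\<close>. It serves twice: to eliminate a
  variable by means of a linear form, and to set the variables outside a face to zero.\<close>

definition subst :: "(nat \<Rightarrow> 'k::field mpolynomial) \<Rightarrow> 'k mpolynomial \<Rightarrow> 'k mpolynomial"
  where "subst s p = (\<Sum>m\<in>Poly_Mapping.keys p. Poly_Mapping.single 0 (Poly_Mapping.lookup p m) * subst_monomial s m)"

lemma subst_monomial_superset:
  assumes "finite X" "Poly_Mapping.keys m \<subseteq> X"
  shows "subst_monomial s m = (\<Prod>i\<in>X. s i ^ Poly_Mapping.lookup m i)"
  unfolding subst_monomial_def
  by (rule prod.mono_neutral_left) (use assms in \<open>auto simp: in_keys_iff\<close>)

lemma subst_monomial_add: "subst_monomial s (a + b) = subst_monomial s a * subst_monomial s b"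
  using subst_monomial_superset[of "Poly_Mapping.keys a \<union> Poly_Mapping.keys b" a s]
    subst_monomial_superset[of "Poly_Mapping.keys a \<union> Poly_Mapping.keys b" b s]
    subst_monomial_superset[of "Poly_Mapping.keys a \<union> Poly_Mapping.keys b" "a + b" s]
  by (simp add: keys_plus_nat lookup_add power_add prod.distrib)

lemma subst_superset:
  assumes "finite X" "Poly_Mapping.keys p \<subseteq> X"
  shows "subst s p = (\<Sum>m\<in>X. Poly_Mapping.single 0 (Poly_Mapping.lookup p m) * subst_monomial s m)"
  unfolding subst_def
  by (rule sum.mono_neutral_left) (use assms in \<open>auto simp: in_keys_iff\<close>)

lemma subst_add: "subst s (p + q) = subst s p + subst s q"
proof -
  let ?X = "Poly_Mapping.keys p \<union> Poly_Mapping.keys q"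
  have "subst s (p + q) = (\<Sum>m\<in>?X. Poly_Mapping.single 0 (Poly_Mapping.lookup (p + q) m) * subst_monomial s m)"
    by (rule subst_superset) (simp_all add: keys_add)
  also have "\<dots> = subst s p + subst s q"
    by (simp add: subst_superset[of ?X p] subst_superset[of ?X q] lookup_add single_add distrib_right sum.distrib)
  finally show ?thesis .
qed

lemma subst_zero [simp]: "subst s 0 = 0"
  by (simp add: subst_def)

lemma subst_sum: "subst s (sum f X) = (\<Sum>x\<in>X. subst s (f x))"
  by (induction X rule: infinite_finite_induct) (simp_all add: subst_add)

lemma subst_single: "subst s (Poly_Mapping.single m c) = Poly_Mapping.single 0 c * subst_monomial s m"
  by (simp add: subst_def)

lemma subst_mult: "subst s (p * q) = subst s p * subst s q"
proof -
  let ?t = "\<lambda>p m. Poly_Mapping.single m (Poly_Mapping.lookup p m)"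
  have "p * q = (\<Sum>a\<in>Poly_Mapping.keys p. ?t p a) * (\<Sum>b\<in>Poly_Mapping.keys q. ?t q b)"
    by (simp only: sum_single_keys)
  then have "subst s (p * q) = (\<Sum>a\<in>Poly_Mapping.keys p. \<Sum>b\<in>Poly_Mapping.keys q. subst s (?t p a * ?t q b))"
    by (simp only: sum_product subst_sum)
  also have "\<dots> = (\<Sum>a\<in>Poly_Mapping.keys p. \<Sum>b\<in>Poly_Mapping.keys q. subst s (?t p a) * subst s (?t q b))"
  proof (intro sum.cong refl)
    fix a b
    have "Poly_Mapping.single 0 (x * y) = Poly_Mapping.single 0 x * (Poly_Mapping.single 0 y :: 'a mpolynomial)" for x y
      by (simp add: mult_single)
    then show "subst s (?t p a * ?t q b) = subst s (?t p a) * subst s (?t q b)"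
      by (simp add: mult_single subst_single subst_monomial_add ac_simps)
  qed
  also have "\<dots> = subst s (\<Sum>a\<in>Poly_Mapping.keys p. ?t p a) * subst s (\<Sum>b\<in>Poly_Mapping.keys q. ?t q b)"
    by (simp only: sum_product subst_sum)
  also have "\<dots> = subst s p * subst s q" by (simp only: sum_single_keys)
  finally show ?thesis .
qed

lemma subst_var [simp]: "subst s (var i) = s i"
  by (simp add: var_def subst_single subst_monomial_def)

lemma var_power: "var i ^ a = Poly_Mapping.single (Poly_Mapping.single i a) 1"
  by (induction a) (simp_all add: var_def mult_single flip: single_add)

lemma subst_monomial_var: "subst_monomial var m = Poly_Mapping.single m 1"
proof -
  have "(\<Prod>i\<in>X. var i ^ Poly_Mapping.lookup m i :: 'a mpolynomial)
      = Poly_Mapping.single (\<Sum>i\<in>X. Poly_Mapping.single i (Poly_Mapping.lookup m i)) 1" if "finite X" for X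
    using that by (induction X rule: finite_induct) (simp_all add: var_power mult_single)
  from this[of "Poly_Mapping.keys m"] show ?thesis
    by (simp add: subst_monomial_def sum_single_keys)
qed

lemma subst_id:
  assumes "p \<in> poly_carrier Z" "\<And>i. i \<in> Z \<Longrightarrow> s i = var i"
  shows "subst s p = p"
proof -
  have "subst_monomial s m = Poly_Mapping.single m 1" if "m \<in> Poly_Mapping.keys p" for m
  proof -
    have "subst_monomial s m = subst_monomial var m"
      unfolding subst_monomial_def using assms that by (intro prod.cong) (auto simp: poly_carrier_iff subset_iff)
    then show ?thesis by (simp add: subst_monomial_var)
  qed
  then have "subst s p = (\<Sum>m\<in>Poly_Mapping.keys p. Poly_Mapping.single m (Poly_Mapping.lookup p m))"
    unfolding subst_def by (intro sum.cong) (simp_all add: mult_single)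
  then show ?thesis by (simp add: sum_single_keys)
qed

lemma submodule_set_poly_carrier: "submodule_set (poly_carrier V) (poly_carrier V)"
  by (auto simp: submodule_set_def intro: poly_carrier_closed)

lemma subst_monomial_carrier:
  assumes "\<And>i. i \<in> Poly_Mapping.keys m \<Longrightarrow> s i \<in> poly_carrier W"
  shows "subst_monomial s m \<in> poly_carrier W"
proof -
  have "(\<Prod>i\<in>X. s i ^ Poly_Mapping.lookup m i) \<in> poly_carrier W" if "finite X" "X \<subseteq> Poly_Mapping.keys m" for X
    using that by (induction X rule: finite_induct) (auto intro!: poly_carrier_closed assms)
  then show ?thesis by (simp add: subst_monomial_def)
qed

lemma subst_carrier:
  assumes "p \<in> poly_carrier Z" "\<And>i. i \<in> Z \<Longrightarrow> s i \<in> poly_carrier W"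
  shows "subst s p \<in> poly_carrier W"
  unfolding subst_def
  by (intro submodule_set_sum[OF submodule_set_poly_carrier] poly_carrier_closed subst_monomial_carrier)
     (use assms in \<open>auto simp: poly_carrier_iff[of p]\<close>)

text \<open>Modulo \<open>l\<close> each variable equals its substitute, hence so do powers,
  products and polynomials; each passage is the telescoping identity $xy - x'y' = x(y - y') + y'(x -
  x')$. For an elimination this shows that the kernel of the substitution consists of multiples of
  the form used.\<close>

lemma subst_diff_multiple:
  assumes Z: "p \<in> poly_carrier Z" "\<And>i. i \<in> Z \<Longrightarrow> s i \<in> poly_carrier Z"
    and l: "l \<in> poly_carrier Z" "\<And>i. i \<in> Z \<Longrightarrow> \<exists>a\<in>poly_carrier Z. var i - s i = l * a"
  shows "\<exists>a\<in>poly_carrier Z. p - subst s p = l * a"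
proof -
  let ?M = "adjoin_multiples l (poly_carrier Z) {0}"
  have M: "submodule_set (poly_carrier Z) ?M"
    by (intro submodule_set_adjoin_multiples submodule_set_poly_carrier) (simp add: submodule_set_def)
  note M' = submodule_setD[OF M]
  have pow: "var i ^ a - s i ^ a \<in> ?M" if "i \<in> Z" for i a
  proof (induction a)
    case (Suc a)
    have "var i - s i \<in> ?M" using l(2)[OF that] by (auto intro: adjoin_multiplesI)
    then have "var i ^ a * (var i - s i) + s i * (var i ^ a - s i ^ a) \<in> ?M"
      using Suc that Z by (intro M'(2) M'(5)) (auto simp: var_power)
    then show ?case by (simp add: algebra_simps)
  qed (use M'(1) in simp)
  have prod: "(\<Prod>i\<in>X. var i ^ m i) - (\<Prod>i\<in>X. s i ^ m i) \<in> ?M" if "finite X" "X \<subseteq> Z" for X m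
    using that
  proof (induction X rule: finite_induct)
    case (insert x X)
    have "(\<Prod>i\<in>X. s i ^ m i) \<in> poly_carrier Z"
      using insert(1) insert.prems Z(2)
      by (induction X rule: finite_induct) (auto intro!: poly_carrier_closed)
    then have "var x ^ m x * ((\<Prod>i\<in>X. var i ^ m i) - (\<Prod>i\<in>X. s i ^ m i))
        + (\<Prod>i\<in>X. s i ^ m i) * (var x ^ m x - s x ^ m x) \<in> ?M"
      using insert pow by (intro M'(2) M'(5)) (auto simp: var_power)
    then show ?case using insert(1,2) by (simp add: algebra_simps)
  qed (use M'(1) in simp)
  have "p - subst s p = (\<Sum>m\<in>Poly_Mapping.keys p. Poly_Mapping.single 0 (Poly_Mapping.lookup p m) *
      (subst_monomial var m - subst_monomial s m))"
    using sum_single_keys[of p]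
    by (simp add: subst_def right_diff_distrib sum_subtractf subst_monomial_var mult_single)
  also have "\<dots> \<in> ?M"
    unfolding subst_monomial_def using Z(1)
    by (intro submodule_set_sum[OF M] M'(5) prod) (auto simp: poly_carrier_iff)
  finally show ?thesis by (auto elim!: adjoin_multiplesE)
qed

section \<open>Linear forms and their regularity\<close>

abbreviation "linear_form L \<equiv> (\<Sum>j\<in>L. var j)"

lemma lookup_linear_form:
  assumes "finite L" "c \<in> L"
  shows "Poly_Mapping.lookup (linear_form L :: 'k::field mpolynomial) (Poly_Mapping.single c 1) = 1"
proof -
  have "Poly_Mapping.single j (1::nat) = Poly_Mapping.single c 1 \<longleftrightarrow> j = c" for j
    using lookup_single_eq[of j "1::nat"] lookup_single_not_eq[of c j "1::nat"] by (metis zero_neq_one)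
  then have "Poly_Mapping.lookup (linear_form L :: 'k mpolynomial) (Poly_Mapping.single c 1)
      = (\<Sum>j\<in>L. if j = c then 1 else 0)"
    unfolding lookup_sum var_def lookup_single when_def by simp
  then show ?thesis using assms by simp
qed

lemma linear_form_carrier: "L \<subseteq> V \<Longrightarrow> linear_form L \<in> poly_carrier V"
  by (intro submodule_set_sum[OF submodule_set_poly_carrier]) (auto simp: var_def)

text \<open>Recursive on lists to match the induction on the list of forms; in particular no
  nonempty set is listed twice.\<close>

fun pairwise_disjoint :: "'a set list \<Rightarrow> bool" where
  "pairwise_disjoint [] \<longleftrightarrow> True"
| "pairwise_disjoint (L # Ls) \<longleftrightarrow> (\<forall>L'\<in>set Ls. L \<inter> L' = {}) \<and> pairwise_disjoint Ls"

text \<open>Modulo the first form a variable \<open>c\<close> can be eliminated, which leaves a polynomial ring and does not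
  affect the other forms.\<close>

lemma weakly_regular_linear_forms:
  assumes "pairwise_disjoint Ls" "\<And>L. L \<in> set Ls \<Longrightarrow> L \<noteq> {} \<and> finite L \<and> L \<subseteq> Z"
  shows "weakly_regular (map linear_form Ls) (poly_carrier Z :: 'k::field mpolynomial set) {0}"
  using assms
proof (induction Ls arbitrary: Z)
  case Nil
  then show ?case by simp
next
  case (Cons L Ls)
  let ?l = "linear_form L :: 'k mpolynomial"
  obtain c where c: "c \<in> L" using Cons.prems by fastforce
  have L: "finite L" "L \<subseteq> Z" using Cons.prems by auto
  \<comment> \<open>This solves $l = 0$ for the variable \<open>c\<close>; \<open>subst s\<close>
    then kills the first form and maps onto the polynomials in the variables
    \<open>Z - {c}\<close>.\<close>
  define s where "s = (var(c := - linear_form (L - {c})) :: nat \<Rightarrow> 'k mpolynomial)"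
  have lc: "?l = var c + linear_form (L - {c})"
    using L c by (simp add: sum.remove)
  have s_other: "subst s (linear_form M) = linear_form M" if "c \<notin> M" for M
    unfolding subst_sum using that by (intro sum.cong) (auto simp: s_def)
  have sl: "subst s ?l = 0" by (simp add: lc subst_add s_other) (simp add: s_def)
  have s_carrier: "s i \<in> poly_carrier (Z - {c})" if "i \<in> Z" for i
  proof (cases "i = c")
    case True
    then show ?thesis using L by (auto simp: s_def intro!: poly_carrier_closed linear_form_carrier)
  next
    case False
    then show ?thesis using that by (simp add: s_def var_def)
  qed
  have mono: "poly_carrier (Z - {c}) \<subseteq> (poly_carrier Z :: 'k mpolynomial set)"
    by (rule poly_carrier_mono) auto
  \<comment> \<open>The polynomials form an integral domain, so a nonzero form is regular on them;
    the coefficient at \<open>c\<close> shows that it is nonzero.\<close>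
  have "?l \<noteq> 0" using lookup_linear_form[OF L(1) c, where ?'k = 'k] by (metis lookup_zero zero_neq_one)
  then have "x = 0" if "?l * x = 0" for x using that by simp
  moreover have "weakly_regular (map linear_form Ls) (poly_carrier Z) (adjoin_multiples ?l (poly_carrier Z) {0})"
  proof (rule weakly_regular_hom[OF submodule_set_poly_carrier])
    show "submodule_set (poly_carrier Z) (adjoin_multiples ?l (poly_carrier Z) {0})"
      by (intro submodule_set_adjoin_multiples submodule_set_poly_carrier) (simp add: submodule_set_def)
    show "adjoin_multiples ?l (poly_carrier Z) {0} \<subseteq> poly_carrier Z"
      using L by (intro adjoin_multiples_subset[OF submodule_set_poly_carrier] linear_form_carrier) auto
    show "set (map linear_form Ls) \<subseteq> poly_carrier Z"
      using Cons.prems by (auto intro!: linear_form_carrier)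
    show "subst s (x + y) = subst s x + subst s y" "subst s (x * y) = subst s x * subst s y" for x y
      by (simp_all add: subst_add subst_mult)
    show "x \<in> adjoin_multiples ?l (poly_carrier Z) {0}" if x: "x \<in> poly_carrier Z" "subst s x = 0" for x
    proof -
      have "\<exists>a\<in>poly_carrier Z. x - subst s x = ?l * a"
      proof (rule subst_diff_multiple[OF x(1)])
        show "\<exists>a\<in>poly_carrier Z. var i - s i = ?l * a" if "i \<in> Z" for i
          by (cases "i = c") (auto simp: s_def lc intro: bexI[of _ 1] bexI[of _ 0])
      qed (use s_carrier mono L linear_form_carrier in blast)+
      then show ?thesis using x(2) by (auto intro: adjoin_multiplesI)
    qed
    have "subst s ` poly_carrier Z = poly_carrier (Z - {c})"
    proof
      show "subst s ` poly_carrier Z \<subseteq> poly_carrier (Z - {c})"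
        using s_carrier by (auto intro: subst_carrier)
      show "poly_carrier (Z - {c}) \<subseteq> subst s ` poly_carrier Z"
      proof
        fix p :: "'k mpolynomial" assume p: "p \<in> poly_carrier (Z - {c})"
        then have "subst s p = p" by (rule subst_id) (auto simp: s_def)
        then show "p \<in> subst s ` poly_carrier Z" using mono p by (metis imageI subsetD)
      qed
    qed
    moreover have "subst s ` adjoin_multiples ?l (poly_carrier Z) {0} = {0}"
    proof
      show "subst s ` adjoin_multiples ?l (poly_carrier Z) {0} \<subseteq> {0}"
        by (auto elim!: adjoin_multiplesE simp: subst_mult sl)
      have "0 \<in> adjoin_multiples ?l (poly_carrier Z) {0}" by (rule adjoin_multiplesI[of 0 _ 0]) auto
      then show "{0} \<subseteq> subst s ` adjoin_multiples ?l (poly_carrier Z) {0}"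
        by (auto simp: image_iff intro!: bexI[of _ 0])
    qed
    moreover have "map (subst s) (map linear_form Ls) = map linear_form Ls"
      using Cons.prems c by (auto intro!: s_other)
    moreover have "weakly_regular (map linear_form Ls) (poly_carrier (Z - {c})) {0 :: 'k mpolynomial}"
      using Cons.prems c by (intro Cons.IH) auto
    ultimately show "weakly_regular (map (subst s) (map linear_form Ls)) (subst s ` poly_carrier Z)
        (subst s ` adjoin_multiples ?l (poly_carrier Z) {0})"
      by (simp only:)
  qed
  ultimately show ?case unfolding list.map weakly_regular.simps by blast
qed

text \<open>Setting the variables outside \<open>Z\<close> to zero identifies the quotient with the
  polynomial ring in \<open>Z\<close> and turns the form of \<open>B\<close> into that of
  \<open>B \<inter> Z\<close>. These sets are again disjoint and nonempty, so the case of a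
  polynomial ring applies.\<close>

lemma weakly_regular_linear_forms_face:
  assumes Bs: "pairwise_disjoint Bs" "\<And>B. B \<in> set Bs \<Longrightarrow> B \<inter> Z \<noteq> {} \<and> finite B \<and> B \<subseteq> V"
    and Z: "Z \<subseteq> V"
  shows "weakly_regular (map linear_form Bs) (poly_carrier V)
    (monomial_span V (\<lambda>m. \<not> Poly_Mapping.keys m \<subseteq> Z) :: 'k::field mpolynomial set)"
proof (rule weakly_regular_hom[OF submodule_set_poly_carrier])
  define s where "s = (\<lambda>i. if i \<in> Z then var i else (0 :: 'k mpolynomial))"
  have mono: "poly_carrier Z \<subseteq> (poly_carrier V :: 'k mpolynomial set)"
    using Z by (rule poly_carrier_mono)
  have monom: "subst_monomial s m = (if Poly_Mapping.keys m \<subseteq> Z then Poly_Mapping.single m 1 else 0)" for m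
  proof (cases "Poly_Mapping.keys m \<subseteq> Z")
    case True
    then have "subst_monomial s m = subst_monomial var m"
      unfolding subst_monomial_def by (intro prod.cong) (auto simp: s_def)
    then show ?thesis using True by (simp add: subst_monomial_var)
  next
    case False
    then obtain i where "i \<in> Poly_Mapping.keys m" "i \<notin> Z" by blast
    then have "\<exists>i\<in>Poly_Mapping.keys m. s i ^ Poly_Mapping.lookup m i = 0"
      by (intro bexI[of _ i]) (auto simp: s_def in_keys_iff)
    then have "subst_monomial s m = 0" unfolding subst_monomial_def by (intro prod_zero) auto
    then show ?thesis using False by simp
  qed
  have lookup: "Poly_Mapping.lookup (subst s p) m = (if Poly_Mapping.keys m \<subseteq> Z then Poly_Mapping.lookup p m else 0)" for p m
  proof -
    have "subst s p = restrict_keys (\<lambda>m. Poly_Mapping.keys m \<subseteq> Z) p"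
      unfolding subst_def restrict_keys_def monom
      by (rule sum.mono_neutral_cong_right) (auto simp: mult_single)
    then show ?thesis by (simp add: lookup_restrict_keys)
  qed
  show "submodule_set (poly_carrier V) (monomial_span V (\<lambda>m. \<not> Poly_Mapping.keys m \<subseteq> Z) :: 'k mpolynomial set)"
    by (rule submodule_set_monomial_span) (auto simp: keys_plus_nat)
  show "monomial_span V (\<lambda>m. \<not> Poly_Mapping.keys m \<subseteq> Z) \<subseteq> (poly_carrier V :: 'k mpolynomial set)"
    by (auto simp: monomial_span_def)
  show "set (map linear_form Bs) \<subseteq> (poly_carrier V :: 'k mpolynomial set)"
    using Bs by (auto intro!: linear_form_carrier)
  show "subst s (x + y) = subst s x + subst s y" "subst s (x * y) = subst s x * subst s y" for x y
    by (simp_all add: subst_add subst_mult)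
  show "x \<in> monomial_span V (\<lambda>m. \<not> Poly_Mapping.keys m \<subseteq> Z)" if "x \<in> poly_carrier V" "subst s x = 0" for x
  proof -
    have "\<not> Poly_Mapping.keys m \<subseteq> Z" if "m \<in> Poly_Mapping.keys x" for m
      using that lookup[of x m] \<open>subst s x = 0\<close> by (auto simp: in_keys_iff)
    with that show ?thesis by (auto simp: monomial_span_def)
  qed
  have "subst s ` poly_carrier V = (poly_carrier Z :: 'k mpolynomial set)"
  proof
    show "subst s ` poly_carrier V \<subseteq> poly_carrier Z"
      by (auto intro!: subst_carrier simp: s_def var_def)
    show "poly_carrier Z \<subseteq> subst s ` poly_carrier V"
    proof
      fix p :: "'k mpolynomial" assume p: "p \<in> poly_carrier Z"
      then have "subst s p = p" by (rule subst_id) (auto simp: s_def)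
      then show "p \<in> subst s ` poly_carrier V" using mono p by (metis imageI subsetD)
    qed
  qed
  moreover have "subst s ` monomial_span V (\<lambda>m. \<not> Poly_Mapping.keys m \<subseteq> Z) = {0}"
  proof
    show "subst s ` monomial_span V (\<lambda>m. \<not> Poly_Mapping.keys m \<subseteq> Z) \<subseteq> {0}"
      by (auto simp: monomial_span_def lookup simp flip: not_in_keys_iff_lookup_eq_zero intro!: poly_mapping_eqI)
    have "(0 :: 'k mpolynomial) \<in> monomial_span V (\<lambda>m. \<not> Poly_Mapping.keys m \<subseteq> Z)" by (simp add: monomial_span_def)
    then show "{0} \<subseteq> subst s ` monomial_span V (\<lambda>m. \<not> Poly_Mapping.keys m \<subseteq> Z)"
      by (auto simp: image_iff intro!: bexI[of _ 0])
  qed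
  moreover have "map (subst s) (map linear_form Bs) = map linear_form (map (\<lambda>B. B \<inter> Z) Bs)"
  proof -
    have "subst s (linear_form B) = linear_form (B \<inter> Z)" if "B \<in> set Bs" for B
      unfolding subst_sum subst_var s_def using Bs(2)[OF that] by (intro sum.inter_restrict[symmetric]) auto
    then show ?thesis by simp
  qed
  moreover have "pairwise_disjoint (map (\<lambda>B. B \<inter> Z) Bs)"
    using Bs(1) by (induction Bs) auto
  moreover have "weakly_regular (map linear_form (map (\<lambda>B. B \<inter> Z) Bs)) (poly_carrier Z) {0 :: 'k mpolynomial}"
    using Bs \<open>pairwise_disjoint (map (\<lambda>B. B \<inter> Z) Bs)\<close>
    by (intro weakly_regular_linear_forms) auto
  ultimately show "weakly_regular (map (subst s) (map linear_form Bs)) (subst s ` poly_carrier V)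
      (subst s ` monomial_span V (\<lambda>m. \<not> Poly_Mapping.keys m \<subseteq> Z))"
    by (simp only:)
qed

section \<open>Faces\<close>

definition faces :: "nat \<Rightarrow> nat set set"
  where "faces n = {F. F \<subseteq> {1..n} \<and> 1 \<in> F \<and> n \<in> F \<and> \<not> has_path_edge n F}"

text \<open>The bounds place both neighbours of a center strictly between 1 and \<open>n\<close>. So
  the endpoints are never centers, removing centers from a face leaves a face, and blocks around
  centers avoid the endpoints.\<close>

definition centers :: "nat \<Rightarrow> nat set"
  where "centers n = {i. 3 dvd i \<and> 3 \<le> i \<and> i + 2 \<le> n}"

definition cores :: "nat \<Rightarrow> nat set set"
  where "cores n = {F \<in> faces n. F \<inter> centers n = {}}"

definition saturation :: "nat \<Rightarrow> nat set \<Rightarrow> nat set"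
  where "saturation n F = F \<union> {i \<in> centers n. i - 1 \<notin> F \<and> i + 1 \<notin> F}"

lemma has_path_edge_mono: "has_path_edge n F \<Longrightarrow> F \<subseteq> G \<Longrightarrow> has_path_edge n G"
  unfolding has_path_edge_def by blast

lemma center_nonadjacent: "i \<in> centers n \<Longrightarrow> i + 1 \<notin> centers n" "i \<in> centers n \<Longrightarrow> i - 1 \<notin> centers n"
  unfolding centers_def by (auto simp: dvd_def) presburger+

lemma face_core:
  assumes "F \<in> faces n" "n \<ge> 3"
  shows "F - centers n \<in> cores n"
  using assms has_path_edge_mono[of n "F - centers n" F]
  by (auto simp: cores_def faces_def centers_def)

lemma face_subset_saturation_core:
  assumes "F \<in> faces n"
  shows "F \<subseteq> saturation n (F - centers n)"
proof
  fix i assume i: "i \<in> F"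
  show "i \<in> saturation n (F - centers n)"
  proof (cases "i \<in> centers n")
    case True
    then have "3 \<le> i" "i + 2 \<le> n" by (auto simp: centers_def)
    moreover have "\<not> has_path_edge n F" using assms by (simp add: faces_def)
    moreover have "has_path_edge n F" if "i - 1 \<in> F"
      unfolding has_path_edge_def using i that \<open>3 \<le> i\<close> \<open>i + 2 \<le> n\<close> by (intro bexI[of _ "i - 1"]) auto
    moreover have "has_path_edge n F" if "i + 1 \<in> F"
      unfolding has_path_edge_def using i that \<open>3 \<le> i\<close> \<open>i + 2 \<le> n\<close> by (intro bexI[of _ i]) auto
    ultimately have "i - 1 \<notin> F" "i + 1 \<notin> F" by blast+
    with True show ?thesis by (auto simp: saturation_def)
  qed (use i in \<open>auto simp: saturation_def\<close>)
qed

text \<open>An edge of the saturation would join two elements of \<open>F\<close>, an element of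
  \<open>F\<close> and an added center, or two centers. The first contradicts that \<open>F\<close>
  is a face, the second the condition on added centers, the third
  \<open>center_nonadjacent\<close>.\<close>

lemma saturation_face:
  assumes "F \<in> faces n"
  shows "saturation n F \<in> faces n"
proof -
  have "\<not> (i \<in> saturation n F \<and> i + 1 \<in> saturation n F)" if "i \<in> {1..n - 1}" for i
  proof
    assume *: "i \<in> saturation n F \<and> i + 1 \<in> saturation n F"
    consider "i \<in> F" "i + 1 \<in> F" | "i \<in> F" "i + 1 \<in> centers n" "i + 1 - 1 \<notin> F"
      | "i \<in> centers n" "i + 1 \<notin> F" "i + 1 \<in> F" | "i \<in> centers n" "i + 1 \<in> centers n"
      using * unfolding saturation_def by blast
    then show False
      using assms that center_nonadjacent(1)[of i n]
      by cases (auto simp: faces_def has_path_edge_def)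
  qed
  then have "\<not> has_path_edge n (saturation n F)"
    unfolding has_path_edge_def by blast
  then show ?thesis
    using assms by (auto simp: faces_def saturation_def centers_def)
qed

text \<open>A core contains no center and its saturation adds nothing but centers, so
  \<open>G\<close> differs from \<open>F\<close> by centers only; being contained in a face, it has
  no edge.\<close>

lemma between_core_and_saturation:
  assumes "F \<in> cores n" "F \<subseteq> G" "G \<subseteq> saturation n F"
  shows "G \<in> faces n" "G - centers n = F"
proof -
  have "saturation n F \<in> faces n" using assms by (auto simp: cores_def intro: saturation_face)
  then show "G \<in> faces n"
    using assms has_path_edge_mono[of n G "saturation n F"] by (auto simp: faces_def cores_def)
  show "G - centers n = F"
    using assms by (auto simp: cores_def saturation_def)
qed

lemma core_eq_iff:
  assumes "F \<in> cores n" "G \<in> faces n"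
  shows "G - centers n = F \<longleftrightarrow> F \<subseteq> G \<and> G \<subseteq> saturation n F"
  using between_core_and_saturation(2)[OF assms(1), of G] face_subset_saturation_core[OF assms(2)] by blast

text \<open>\<open>3 * k\<close> runs exactly through \<open>centers n\<close>, since
  \<open>k \<le> (n - 2) div 3\<close> means 3k + 2 <= n. The two singletons account for the
  endpoints, which every face contains.\<close>

definition blocks :: "nat \<Rightarrow> nat set list"
  where "blocks n = {1} # {n} # map (\<lambda>k. {3 * k - 1, 3 * k, 3 * k + 1}) [1..<Suc ((n - 2) div 3)]"

lemma length_blocks: "length (blocks n) = 2 + (n - 2) div 3"
  by (simp add: blocks_def)


lemma blocks_disjoint:
  assumes "n \<ge> 3"
  shows "pairwise_disjoint (blocks n)"
proof -
  have "pairwise_disjoint (map (\<lambda>k. {3 * k - 1, 3 * k, 3 * k + 1}) [a..<b])" if "1 \<le> a" for a b :: nat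
    using that
  proof (induction "b - a" arbitrary: a)
    case (Suc d)
    have upt: "[a..<b] = a # [Suc a..<b]" using Suc by (simp add: upt_conv_Cons)
    have disj: "{3 * a - 1, 3 * a, 3 * a + 1} \<inter> {3 * k - 1, 3 * k, 3 * k + 1} = {}" if "Suc a \<le> k" for k
    proof -
      have "3 * a + 1 < 3 * k - 1" using that by simp
      then show ?thesis by auto
    qed
    have "\<forall>L'\<in>set (map (\<lambda>k. {3 * k - 1, 3 * k, 3 * k + 1}) [Suc a..<b]). {3 * a - 1, 3 * a, 3 * a + 1} \<inter> L' = {}"
      unfolding set_map set_upt by (auto simp only: atLeastLessThan_iff intro!: disj)
    moreover have "pairwise_disjoint (map (\<lambda>k. {3 * k - 1, 3 * k, 3 * k + 1}) [Suc a..<b])"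
      using Suc by (intro Suc.hyps(1)) auto
    ultimately show ?case by (simp only: upt list.map pairwise_disjoint.simps)
  qed simp
  from this[of 1 "Suc ((n - 2) div 3)"] show ?thesis
    using assms by (auto simp: blocks_def simp del: upt_Suc)
qed

text \<open>In the block around a center \<open>3 * k\<close>, either one of the neighbours lies in
  \<open>F\<close> or the center itself was added by the saturation.\<close>

lemma blocks_meet_saturation:
  assumes "n \<ge> 3" "F \<in> cores n" "B \<in> set (blocks n)"
  shows "B \<inter> saturation n F \<noteq> {}" "finite B" "B \<subseteq> {1..n}"
proof -
  have F: "1 \<in> F" "n \<in> F" using assms by (auto simp: cores_def faces_def)
  consider "B = {1}" | "B = {n}" | k where "B = {3 * k - 1, 3 * k, 3 * k + 1}" "1 \<le> k" "k \<le> (n - 2) div 3"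
    using assms(3) by (auto simp: blocks_def simp del: upt_Suc)
  then have "B \<inter> saturation n F \<noteq> {} \<and> finite B \<and> B \<subseteq> {1..n}"
  proof cases
    case 3
    then have "3 * k \<in> centers n" by (auto simp: centers_def)
    moreover from this have "3 * k + 1 \<le> n" by (auto simp: centers_def)
    ultimately show ?thesis using 3 by (auto simp: saturation_def)
  qed (use F assms in \<open>auto simp: saturation_def\<close>)
  then show "B \<inter> saturation n F \<noteq> {}" "finite B" "B \<subseteq> {1..n}" by auto
qed

lemma length_pairwise_disjoint_le:
  assumes "pairwise_disjoint Ls" "finite H" "\<And>L. L \<in> set Ls \<Longrightarrow> L \<inter> H \<noteq> {}"
  shows "length Ls \<le> card H"
  using assms
proof (induction Ls arbitrary: H)
  case (Cons L Ls)
  obtain c where c: "c \<in> L" "c \<in> H" using Cons.prems(3)[of L] by auto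
  have "length Ls \<le> card (H - {c})"
  proof (rule Cons.IH)
    show "L' \<inter> (H - {c}) \<noteq> {}" if "L' \<in> set Ls" for L'
      using Cons.prems(3)[of L'] Cons.prems(1) that c by auto
  qed (use Cons.prems in auto)
  then show ?case using c Cons.prems(2) card_Suc_Diff1[of H c] by simp
qed simp

lemma card_saturation:
  assumes "n \<ge> 3" "F \<in> cores n"
  shows "2 + (n - 2) div 3 \<le> card (saturation n F)"
proof -
  have "finite (saturation n F)"
    using assms saturation_face[of F n] by (auto simp: cores_def faces_def intro: finite_subset)
  then show ?thesis
    using length_pairwise_disjoint_le[OF blocks_disjoint[OF assms(1)], of "saturation n F"]
      blocks_meet_saturation[OF assms] by (simp add: length_blocks)
qed

text \<open>Vertices 1, 4, 7, ... leave gaps of two, the widest into which nothing can be inserted.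
  The end depends on \<open>n mod 3\<close>: for residue 2 the last of these vertices up to
  \<open>n - 2\<close> is \<open>n - 4\<close>, and \<open>n - 2\<close> is needed to fill the gap
  of three before \<open>n\<close>.\<close>

definition small_facet :: "nat \<Rightarrow> nat set"
  where "small_facet n = {i. i mod 3 = 1 \<and> i + 2 \<le> n} \<union> {n} \<union> (if n mod 3 = 2 then {n - 2} else {})"

lemma small_facet_iff:
  assumes "n \<ge> 3"
  shows "i \<in> small_facet n \<longleftrightarrow> i mod 3 = 1 \<and> i + 2 \<le> n \<or> i = n \<or> n mod 3 = 2 \<and> i + 2 = n"
  using assms by (auto simp: small_facet_def)

lemma small_facet_face:
  assumes "n \<ge> 3"
  shows "small_facet n \<in> faces n"
proof -
  have "\<not> (i \<in> small_facet n \<and> i + 1 \<in> small_facet n)" if "i \<in> {1..n - 1}" for i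
  proof -
    have "i \<noteq> n" using that by auto
    then have i: "i \<in> small_facet n \<longleftrightarrow> i mod 3 = 1 \<and> i + 2 \<le> n \<or> n mod 3 = 2 \<and> i + 2 = n"
      using assms by (auto simp: small_facet_iff)
    show ?thesis
    proof
      assume *: "i \<in> small_facet n \<and> i + 1 \<in> small_facet n"
      consider "i mod 3 = 1" "i + 2 \<le> n" | "n mod 3 = 2" "i + 2 = n" using * i by blast
      then show False
      proof cases
        case 1
        then have "(i + 1) mod 3 = 2" by presburger
        then have "n mod 3 = 2" "i + 3 = n" using * 1 unfolding small_facet_iff[OF assms] by auto
        with 1 show False by presburger
      next
        case 2
        then show False using * unfolding small_facet_iff[OF assms] by auto
      qed
    qed
  qed
  then have "\<not> has_path_edge n (small_facet n)"
    unfolding has_path_edge_def by blast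
  moreover have "i \<noteq> 0" if "i \<in> small_facet n" for i
    using that assms unfolding small_facet_iff[OF assms] by (cases "i = 0") auto
  then have "small_facet n \<subseteq> {1..n}"
    using assms by (fastforce simp: small_facet_iff Suc_le_eq)
  ultimately show ?thesis
    using assms by (auto simp: faces_def small_facet_iff)
qed

text \<open>The residue of \<open>j\<close> modulo 3 decides: for 0 the right neighbour lies in the
  facet, for 2 the left one, and residue 1 forces \<open>j = n - 1\<close>, which is adjacent to
  \<open>n\<close>.\<close>

lemma small_facet_maximal:
  assumes "n \<ge> 3" "j \<in> {1..n}" "j \<notin> small_facet n"
  shows "has_path_edge n (insert j (small_facet n))"
proof -
  note iff = small_facet_iff[OF assms(1)]
  have j: "j \<noteq> n" "\<not> (n mod 3 = 2 \<and> j + 2 = n)" "\<not> (j mod 3 = 1 \<and> j + 2 \<le> n)" "1 \<le> j" "j \<le> n"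
    using assms(2,3) unfolding iff by auto
  consider "j mod 3 = 0" | "j mod 3 = 1" | "j mod 3 = 2" by linarith
  then have "j - 1 \<in> small_facet n \<and> j \<ge> 2 \<or> j + 1 \<in> small_facet n"
  proof cases
    case 1
    then have "(j + 1) mod 3 = 1" by presburger
    moreover have "(j + 2) mod 3 = 2" using 1 by presburger
    \<comment> \<open>Otherwise \<open>n mod 3 = 2\<close>, and \<open>j = n - 2\<close> would be
      the extra vertex of the facet.\<close>
    then have "j + 2 \<noteq> n" using j(2) by metis
    then have "j + 1 = n \<or> j + 3 \<le> n" using j by linarith
    ultimately show ?thesis unfolding iff by auto
  next
    case 2
    then have "j + 1 = n" using j by linarith
    then show ?thesis unfolding iff by simp
  next
    case 3
    then obtain k where "j = 3 * k + 2" by (metis mult_div_mod_eq)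
    then show ?thesis using j unfolding iff by auto
  qed
  then consider "j - 1 \<in> small_facet n" "j \<ge> 2" | "j + 1 \<in> small_facet n" by blast
  then show ?thesis
  proof cases
    case 1
    then show ?thesis unfolding has_path_edge_def using assms by (intro bexI[of _ "j - 1"]) auto
  next
    case 2
    then show ?thesis unfolding has_path_edge_def using assms j by (intro bexI[of _ j]) auto
  qed
qed

lemma card_small_facet:
  assumes "n \<ge> 3"
  shows "card (small_facet n) \<le> 2 + (n - 2) div 3"
proof -
  define q where "q = (n - 3) div 3"
  have "{i. i mod 3 = 1 \<and> i + 2 \<le> n} \<subseteq> (\<lambda>k. 3 * k + 1) ` {..q}"
  proof
    fix i assume "i \<in> {i. i mod 3 = 1 \<and> i + 2 \<le> n}"
    then have "i mod 3 = 1" "i + 2 \<le> n" by auto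
    then obtain k where k: "i = 3 * k + 1" "3 * k + 3 \<le> n" 
      by (metis (no_types) mult_div_mod_eq add.assoc one_plus_numeral semiring_norm(3))
    have "3 * k div 3 \<le> q" unfolding q_def using k by (intro div_le_mono) simp
    then show "i \<in> (\<lambda>k. 3 * k + 1) ` {..q}" using k by simp
  qed
  then have "card {i. i mod 3 = 1 \<and> i + 2 \<le> n} \<le> q + 1"
    using surj_card_le[of "{..q}"] by fastforce
  moreover have "card (small_facet n) \<le> card {i. i mod 3 = 1 \<and> i + 2 \<le> n} + 1 + (if n mod 3 = 2 then 1 else 0)"
    unfolding small_facet_def
    by (intro order_trans[OF card_Un_le] add_mono) auto
  \<comment> \<open>The extra vertex occurs only for \<open>n mod 3 = 2\<close>, and exactly then
    \<open>(n - 2) div 3\<close> is larger than \<open>q\<close> by one, which pays for it.\<close>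
  moreover have "q + 2 + (if n mod 3 = 2 then 1 else 0) \<le> 2 + (n - 2) div 3"
  proof (cases "n mod 3 = 2")
    case True
    then obtain k where "n = 3 * k + 2" by (metis mult_div_mod_eq)
    moreover from this obtain l where "k = Suc l" using assms by (cases k) auto
    ultimately show ?thesis by (simp add: q_def)
  next
    case False
    have "(n - 3) div 3 \<le> (n - 2) div 3" by (intro div_le_mono) simp
    then show ?thesis using False by (simp add: q_def)
  qed
  ultimately show ?thesis by linarith
qed

section \<open>Depth\<close>

definition squarefree_monomial :: "nat set \<Rightarrow> (nat \<Rightarrow>\<^sub>0 nat)"
  where "squarefree_monomial F = (\<Sum>i\<in>F. Poly_Mapping.single i 1)"

lemma lookup_squarefree_monomial:
  "finite F \<Longrightarrow> Poly_Mapping.lookup (squarefree_monomial F) i = (if i \<in> F then 1 else 0)"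
  by (simp add: squarefree_monomial_def lookup_sum lookup_single when_def)

lemma keys_squarefree_monomial: "finite F \<Longrightarrow> Poly_Mapping.keys (squarefree_monomial F) = F"
  by (auto simp: in_keys_iff lookup_squarefree_monomial split: if_splits)

abbreviation "face_poly F \<equiv> Poly_Mapping.single (squarefree_monomial F) 1"

lemma face_poly_dvd:
  fixes q :: "'k::field mpolynomial"
  assumes "finite F" "q \<in> poly_carrier V" "\<And>m. m \<in> Poly_Mapping.keys q \<Longrightarrow> F \<subseteq> Poly_Mapping.keys m"
  obtains a where "a \<in> poly_carrier V" "q = face_poly F * a"
proof -
  let ?e = "squarefree_monomial F"
  \<comment> \<open>The truncated subtraction of exponents is exact on the keys of \<open>q\<close>,
    because their supports contain \<open>F\<close>.\<close>
  define a where "a = (\<Sum>m\<in>Poly_Mapping.keys q. Poly_Mapping.single (m - ?e) (Poly_Mapping.lookup q m))"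
  have split: "?e + (m - ?e) = m" if "m \<in> Poly_Mapping.keys q" for m
  proof (rule poly_mapping_eqI)
    fix i
    have "i \<in> F \<Longrightarrow> Poly_Mapping.lookup m i \<noteq> 0" using assms(3)[OF that] by (auto simp: in_keys_iff)
    then show "Poly_Mapping.lookup (?e + (m - ?e)) i = Poly_Mapping.lookup m i"
      using assms(1) by (simp add: lookup_add lookup_minus lookup_squarefree_monomial)
  qed
  have "Poly_Mapping.keys (m - ?e) \<subseteq> Poly_Mapping.keys m" for m
    by (auto simp: in_keys_iff lookup_minus)
  then have "a \<in> poly_carrier V"
    unfolding a_def using assms(2)
    by (intro submodule_set_sum[OF submodule_set_poly_carrier] in_poly_carrier(3)) (fastforce simp: poly_carrier_iff)
  moreover have "face_poly F * a = (\<Sum>m\<in>Poly_Mapping.keys q. Poly_Mapping.single m (Poly_Mapping.lookup q m))"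
    unfolding a_def sum_distrib_left using split by (intro sum.cong) (simp_all add: mult_single)
  ultimately show ?thesis using that by (simp add: sum_single_keys)
qed

lemma keys_single_mult_mem:
  fixes p :: "'k::field mpolynomial"
  assumes "m \<in> Poly_Mapping.keys p" "c \<noteq> 0"
  shows "a + m \<in> Poly_Mapping.keys (Poly_Mapping.single a c * p)"
  using assms by (simp add: in_keys_iff lookup_single_mult)

definition path_ideal :: "nat \<Rightarrow> 'k::field mpolynomial set"
  where "path_ideal n = monomial_span {1..n} (\<lambda>m. has_path_edge n (Poly_Mapping.keys m))"

definition cycle_ideal :: "nat \<Rightarrow> 'k::field mpolynomial set"
  where "cycle_ideal n = monomial_span {1..n} (\<lambda>m. has_path_edge n (Poly_Mapping.keys m)
    \<or> (1 \<in> Poly_Mapping.keys m \<and> n \<in> Poly_Mapping.keys m))"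

lemma cycle_ideal_faces:
  "cycle_ideal n = (monomial_span {1..n} (\<lambda>m. has_path_edge n (Poly_Mapping.keys m)
    \<or> Poly_Mapping.keys m \<in> faces n) :: 'k::field mpolynomial set)"
  unfolding cycle_ideal_def by (rule monomial_span_cong) (auto simp: faces_def)

lemma ideal_quotient_path_cycle:
  "ideal_quotient {1..n} (path_ideal n) (cycle_ideal n :: 'k::field mpolynomial set)"
proof
  show "submodule_set (poly_carrier {1..n}) (path_ideal n :: 'k mpolynomial set)"
    unfolding path_ideal_def
    by (rule submodule_set_monomial_span) (auto simp: keys_plus_nat intro: has_path_edge_mono)
  show "submodule_set (poly_carrier {1..n}) (cycle_ideal n :: 'k mpolynomial set)"
    unfolding cycle_ideal_def
    by (rule submodule_set_monomial_span) (auto simp: keys_plus_nat intro: has_path_edge_mono)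
qed (auto simp: path_ideal_def cycle_ideal_def monomial_span_def)

lemma path_ideal_keys:
  "p \<in> path_ideal n \<Longrightarrow> m \<in> Poly_Mapping.keys p \<Longrightarrow> Poly_Mapping.keys m \<notin> faces n"
  by (auto simp: path_ideal_def monomial_span_def faces_def)

lemma finite_face: "F \<in> faces n \<Longrightarrow> finite F"
  by (auto simp: faces_def intro: finite_subset)

lemma single_in_cycle_ideal:
  assumes "Poly_Mapping.keys m \<in> faces n"
  shows "Poly_Mapping.single m c \<in> cycle_ideal n"
proof -
  have "Poly_Mapping.keys m \<subseteq> {1..n}" using assms by (simp add: faces_def)
  then show ?thesis using assms by (auto simp: cycle_ideal_faces monomial_span_def)
qed

section \<open>The filtration by cores\<close>

definition layer :: "nat \<Rightarrow> nat set set \<Rightarrow> 'k::field mpolynomial set"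
  where "layer n Fs = monomial_span {1..n} (\<lambda>m. has_path_edge n (Poly_Mapping.keys m)
    \<or> (Poly_Mapping.keys m \<in> faces n \<and> Poly_Mapping.keys m - centers n \<in> Fs))"

text \<open>Multiplication by a monomial enlarges the support and with it the core, so this
  condition makes \<open>layer n Fs\<close> closed under multiplication. For
  \<open>n \<ge> 3\<close> the extremes \<open>layer n {}\<close> and
  \<open>layer n (cores n)\<close> are $I_n$ and $J_n$.\<close>

definition upward_closed :: "nat \<Rightarrow> nat set set \<Rightarrow> bool"
  where "upward_closed n Fs \<longleftrightarrow> Fs \<subseteq> cores n \<and> (\<forall>F\<in>Fs. \<forall>G\<in>cores n. F \<subseteq> G \<longrightarrow> G \<in> Fs)"

lemma upward_closedD:
  "upward_closed n Fs \<Longrightarrow> F \<in> Fs \<Longrightarrow> G \<in> cores n \<Longrightarrow> F \<subseteq> G \<Longrightarrow> G \<in> Fs"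
  by (simp add: upward_closed_def)

lemma face_union:
  assumes "F \<in> faces n" "K \<subseteq> {1..n}" "\<not> has_path_edge n (K \<union> F)"
  shows "K \<union> F \<in> faces n"
  using assms by (auto simp: faces_def)

lemma submodule_set_layer:
  assumes "upward_closed n Fs" "n \<ge> 3"
  shows "submodule_set (poly_carrier {1..n}) (layer n Fs :: 'k::field mpolynomial set)"
  unfolding layer_def
proof (rule submodule_set_monomial_span)
  fix m k :: "nat \<Rightarrow>\<^sub>0 nat"
  let ?F = "Poly_Mapping.keys m" and ?K = "Poly_Mapping.keys k"
  assume *: "has_path_edge n ?F \<or> ?F \<in> faces n \<and> ?F - centers n \<in> Fs" and k: "?K \<subseteq> {1..n}"
  show "has_path_edge n (Poly_Mapping.keys (k + m)) \<or>
      Poly_Mapping.keys (k + m) \<in> faces n \<and> Poly_Mapping.keys (k + m) - centers n \<in> Fs"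
  proof (cases "has_path_edge n (?K \<union> ?F)")
    case False
    then have F: "?F \<in> faces n" "?F - centers n \<in> Fs"
      using * has_path_edge_mono[of n ?F "?K \<union> ?F"] by auto
    then have face: "?K \<union> ?F \<in> faces n" using False k by (intro face_union)
    then have "?K \<union> ?F - centers n \<in> cores n" using assms(2) by (rule face_core)
    then have "?K \<union> ?F - centers n \<in> Fs" using upward_closedD[OF assms(1) F(2)] by blast
    with face show ?thesis by (simp add: keys_plus_nat)
  qed (simp add: keys_plus_nat)
qed

lemma finite_cores: "finite (cores n)"
proof -
  have "cores n \<subseteq> Pow {1..n}" by (auto simp: cores_def faces_def)
  then show ?thesis by (rule finite_subset) simp
qed

text \<open>The monomials with support between a core \<open>F\<close> and its saturation \<open>Z\<close> span a copy of $K[Z]$.\<close>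

lemma weakly_regular_layer_step:
  assumes n: "n \<ge> 3" and Fs: "upward_closed n Fs" and F: "F \<in> Fs" and Gs: "upward_closed n (Fs - {F})"
    and fs: "set fs \<subseteq> poly_carrier {1..n}"
    and reg: "weakly_regular fs (poly_carrier {1..n})
      (monomial_span {1..n} (\<lambda>m. \<not> Poly_Mapping.keys m \<subseteq> saturation n F) :: 'k::field mpolynomial set)"
  shows "weakly_regular fs (layer n Fs) (layer n (Fs - {F}) :: 'k mpolynomial set)"
proof -
  let ?T = "poly_carrier {1..n} :: 'k mpolynomial set" and ?L = "layer n (Fs - {F}) :: 'k mpolynomial set"
  let ?x = "face_poly F :: 'k mpolynomial"
  have core: "F \<in> cores n" using Fs F by (auto simp: upward_closed_def)
  then have face: "F \<in> faces n" by (simp add: cores_def)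
  then have F_fin: "finite F" and F_sub: "F \<subseteq> {1..n}" by (rule finite_face, simp add: faces_def)
  note L = submodule_set_layer[OF Fs n] and L' = submodule_set_layer[OF Gs n]
  have sub: "?L \<subseteq> layer n Fs" by (auto simp: layer_def monomial_span_def)
  have x0: "?x \<in> layer n Fs"
    using F F_sub face core by (auto simp: layer_def monomial_span_def keys_squarefree_monomial F_fin cores_def Diff_triv)
  then have x: "?x * s \<in> layer n Fs" if "s \<in> ?T" for s
    using submodule_setD(5)[OF L that x0] by (simp add: mult.commute)
  \<comment> \<open>The factor of the two layers is cyclic, generated by the class of $x_F$: every
    monomial with core \<open>F\<close> is divisible by $x_F$.\<close>
  have gen: "adjoin_multiples ?x ?T ?L = layer n Fs"
  proof
    show "adjoin_multiples ?x ?T ?L \<subseteq> layer n Fs"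
      using x sub submodule_setD(2)[OF L] by (auto elim!: adjoin_multiplesE)
    show "layer n Fs \<subseteq> adjoin_multiples ?x ?T ?L"
    proof
      fix p :: "'k mpolynomial" assume p: "p \<in> layer n Fs"
      let ?P = "\<lambda>m. Poly_Mapping.keys m \<in> faces n \<and> Poly_Mapping.keys m - centers n = F"
      have eq: "p = restrict_keys ?P p + restrict_keys (\<lambda>m. \<not> ?P m) p"
        by (rule poly_mapping_eqI) (simp add: lookup_add lookup_restrict_keys)
      have rest: "restrict_keys (\<lambda>m. \<not> ?P m) p \<in> ?L"
        using p by (auto simp: layer_def monomial_span_def poly_carrier_iff keys_restrict_keys)
      have "restrict_keys ?P p \<in> ?T"
        using p by (auto simp: layer_def monomial_span_def poly_carrier_iff keys_restrict_keys)
      then obtain a where a: "a \<in> ?T" "restrict_keys ?P p = ?x * a"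
        by (rule face_poly_dvd[OF F_fin]) (auto simp: keys_restrict_keys)
      show "p \<in> adjoin_multiples ?x ?T ?L"
        using a(1) rest
      proof (rule adjoin_multiplesI)
        show "p = ?x * a + restrict_keys (\<lambda>m. \<not> ?P m) p" using eq unfolding a(2) .
      qed
    qed
  qed
  \<comment> \<open>This computes the annihilator of the class of $x_F$. If the support of
    \<open>m\<close> leaves the saturation, then multiplying by $x^m$ either creates an edge or
    enlarges the core strictly, and by upward closure the larger core still belongs to
    \<open>Fs - {F}\<close>.\<close>
  have iff: "Poly_Mapping.keys m \<subseteq> saturation n F \<longleftrightarrow>
      \<not> (has_path_edge n (F \<union> Poly_Mapping.keys m) \<or>
         F \<union> Poly_Mapping.keys m \<in> faces n \<and> F \<union> Poly_Mapping.keys m - centers n \<in> Fs - {F})"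
    if m: "Poly_Mapping.keys m \<subseteq> {1..n}" for m
  proof
    assume "Poly_Mapping.keys m \<subseteq> saturation n F"
    then have "F \<union> Poly_Mapping.keys m \<subseteq> saturation n F" by (auto simp: saturation_def)
    from between_core_and_saturation[OF core _ this]
    show "\<not> (has_path_edge n (F \<union> Poly_Mapping.keys m) \<or>
         F \<union> Poly_Mapping.keys m \<in> faces n \<and> F \<union> Poly_Mapping.keys m - centers n \<in> Fs - {F})"
      by (auto simp: faces_def)
  next
    assume *: "\<not> (has_path_edge n (F \<union> Poly_Mapping.keys m) \<or>
         F \<union> Poly_Mapping.keys m \<in> faces n \<and> F \<union> Poly_Mapping.keys m - centers n \<in> Fs - {F})"
    then have G: "F \<union> Poly_Mapping.keys m \<in> faces n"
      using face_union[OF face m] by (simp add: Un_commute)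
    then have "F \<union> Poly_Mapping.keys m - centers n \<in> cores n" using n by (rule face_core)
    moreover have "F \<subseteq> F \<union> Poly_Mapping.keys m - centers n" using core by (auto simp: cores_def)
    ultimately have "F \<union> Poly_Mapping.keys m - centers n \<in> Fs"
      by (rule upward_closedD[OF Fs F])
    then have "F \<union> Poly_Mapping.keys m - centers n = F" using * G by blast
    then show "Poly_Mapping.keys m \<subseteq> saturation n F"
      using core_eq_iff[OF core G] by simp
  qed
  have "{s \<in> ?T. ?x * s \<in> ?L} = monomial_span {1..n} (\<lambda>m. \<not> Poly_Mapping.keys m \<subseteq> saturation n F)"
  proof (intro Set.set_eqI iffI)
    fix s assume s: "s \<in> {s \<in> ?T. ?x * s \<in> ?L}"
    show "s \<in> monomial_span {1..n} (\<lambda>m. \<not> Poly_Mapping.keys m \<subseteq> saturation n F)"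
      unfolding monomial_span_def
    proof (intro CollectI conjI ballI)
      fix m assume m: "m \<in> Poly_Mapping.keys s"
      then have e: "squarefree_monomial F + m \<in> Poly_Mapping.keys (?x * s)"
        by (rule keys_single_mult_mem) simp
      have "Poly_Mapping.keys m \<subseteq> {1..n}" using s m by (auto simp: poly_carrier_iff)
      have "has_path_edge n (F \<union> Poly_Mapping.keys m) \<or>
         F \<union> Poly_Mapping.keys m \<in> faces n \<and> F \<union> Poly_Mapping.keys m - centers n \<in> Fs - {F}"
        using s e unfolding layer_def monomial_span_def
        by (fastforce simp: keys_plus_nat keys_squarefree_monomial[OF F_fin])
      then show "\<not> Poly_Mapping.keys m \<subseteq> saturation n F"
        using iff[OF \<open>Poly_Mapping.keys m \<subseteq> {1..n}\<close>] by blast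
    qed (use s in auto)
  next
    fix s :: "'k mpolynomial"
    assume s: "s \<in> monomial_span {1..n} (\<lambda>m. \<not> Poly_Mapping.keys m \<subseteq> saturation n F)"
    then have "?x * s \<in> ?T" using F_sub
      by (intro poly_carrier_closed) (auto simp: monomial_span_def keys_squarefree_monomial F_fin)
    moreover have "has_path_edge n (Poly_Mapping.keys m) \<or>
         Poly_Mapping.keys m \<in> faces n \<and> Poly_Mapping.keys m - centers n \<in> Fs - {F}"
      if "m \<in> Poly_Mapping.keys (?x * s)" for m
    proof -
      from that obtain m' where m': "m' \<in> Poly_Mapping.keys s" "m = squarefree_monomial F + m'"
        using keys_single_mult by blast
      then have "Poly_Mapping.keys m' \<subseteq> {1..n}" "\<not> Poly_Mapping.keys m' \<subseteq> saturation n F"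
        using s by (auto simp: monomial_span_def poly_carrier_iff)
      then show ?thesis
        using iff[of m'] m'(2) by (simp add: keys_plus_nat keys_squarefree_monomial F_fin) blast
    qed
    ultimately show "s \<in> {s \<in> ?T. ?x * s \<in> ?L}"
      using s by (auto simp: layer_def monomial_span_def)
  qed
  then have "weakly_regular fs (adjoin_multiples ?x ?T ?L) ?L"
    using reg by (intro weakly_regular_colon[OF submodule_set_poly_carrier L' fs]) simp
  then show ?thesis by (simp only: gen)
qed

text \<open>Removing a core that is minimal under inclusion leaves an upward closed set, so the
  cores can be peeled off one at a time; \<open>weakly_regular_trans\<close> joins the factors
  again.\<close>

lemma weakly_regular_layers:
  assumes n: "n \<ge> 3" and fs: "set fs \<subseteq> poly_carrier {1..n}"
    and reg: "\<And>F. F \<in> cores n \<Longrightarrow> weakly_regular fs (poly_carrier {1..n})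
      (monomial_span {1..n} (\<lambda>m. \<not> Poly_Mapping.keys m \<subseteq> saturation n F) :: 'k::field mpolynomial set)"
    and Fs: "upward_closed n Fs"
  shows "weakly_regular fs (layer n Fs) (layer n {} :: 'k mpolynomial set)"
proof -
  have "finite Fs" using Fs finite_cores by (auto simp: upward_closed_def intro: finite_subset)
  then show ?thesis using Fs
  proof (induction Fs rule: finite_remove_induct)
    case empty
    show ?case using submodule_set_layer[OF empty n] fs by (rule weakly_regular_self)
  next
    case (remove Fs)
    obtain F where F: "F \<in> Fs" "\<And>G. G \<in> Fs \<Longrightarrow> G \<subseteq> F \<Longrightarrow> G = F"
      using finite_has_minimal[OF remove(1,2)] by blast
    have Gs: "upward_closed n (Fs - {F})"
      using remove.prems F unfolding upward_closed_def by blast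
    have empty: "upward_closed n {}" by (simp add: upward_closed_def)
    have "weakly_regular fs (layer n Fs) (layer n (Fs - {F}) :: 'k mpolynomial set)"
      using remove.prems F by (intro weakly_regular_layer_step[OF n _ _ Gs fs] reg) (auto simp: upward_closed_def)
    moreover have "weakly_regular fs (layer n (Fs - {F})) (layer n {} :: 'k mpolynomial set)"
      using remove.IH F Gs by blast
    ultimately show ?case
      by (intro weakly_regular_trans[OF submodule_set_layer[OF remove.prems n] submodule_set_layer[OF Gs n]
            submodule_set_layer[OF empty n] _ _ fs]) (auto simp: layer_def monomial_span_def)
  qed
qed

section \<open>Lower and upper bound for the depth\<close>

lemma keys_sum_var:
  assumes "m \<in> Poly_Mapping.keys (linear_form B :: 'k::field mpolynomial)"
  shows "\<exists>i\<in>B. m = Poly_Mapping.single i 1"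
proof -
  have "\<exists>i\<in>B. Poly_Mapping.lookup (var i :: 'k mpolynomial) m \<noteq> 0"
    using assms sum.not_neutral_contains_not_neutral unfolding in_keys_iff lookup_sum by blast
  then show ?thesis by (auto simp: var_def lookup_single when_def split: if_splits)
qed

lemma graded_max_ideal_subset: "graded_max_ideal n \<subseteq> poly_carrier {1..n}"
  by (auto simp: graded_max_ideal_eq monomial_span_def)

lemma regular_sequence_blocks:
  assumes n: "n \<ge> 3"
  shows "regular_sequence (ideal_quot (poly_ring {1..n}) (cycle_ideal n) (path_ideal n))
    (map linear_form (blocks n) :: 'k::field mpolynomial list)"
proof -
  interpret ideal_quotient "{1..n}" "path_ideal n :: 'k mpolynomial set" "cycle_ideal n"
    by (rule ideal_quotient_path_cycle)
  define fs where "fs = (map linear_form (blocks n) :: 'k mpolynomial list)"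
  have blocks_sub: "B \<subseteq> {1..n}" "finite B" if "B \<in> set (blocks n)" for B
    using that n by (auto simp: blocks_def simp del: upt_Suc)
  have fs: "set fs \<subseteq> poly_carrier {1..n}"
    using blocks_sub by (auto simp: fs_def intro!: linear_form_carrier)
  have layers: "layer n (cores n) = (cycle_ideal n :: 'k mpolynomial set)" "layer n {} = (path_ideal n :: 'k mpolynomial set)"
    using face_core[OF _ n] unfolding layer_def cycle_ideal_faces path_ideal_def by (auto intro!: monomial_span_cong)
  have "weakly_regular fs (layer n (cores n)) (layer n {})"
  proof (rule weakly_regular_layers[OF n fs])
    fix F assume F: "F \<in> cores n"
    then have "saturation n F \<subseteq> {1..n}" using saturation_face[of F n] by (auto simp: cores_def faces_def)
    then show "weakly_regular fs (poly_carrier {1..n}) (monomial_span {1..n} (\<lambda>m. \<not> Poly_Mapping.keys m \<subseteq> saturation n F))"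
      using blocks_meet_saturation[OF n F] blocks_disjoint[OF n] unfolding fs_def by (intro weakly_regular_linear_forms_face) auto
  qed (simp add: upward_closed_def)
  \<comment> \<open>The witness is $x_1 x_n$. If it occurred in a product of a linear form with an
    element of $J_n$, the monomial from $J_n$ would already contain both variables and the form
    would contribute one of them again, giving an exponent of at least 2.\<close>
  moreover have "adjoin_list fs (cycle_ideal n) (path_ideal n) \<noteq> cycle_ideal n"
  proof
    assume eq: "adjoin_list fs (cycle_ideal n) (path_ideal n) = cycle_ideal n"
    let ?e = "squarefree_monomial {1, n}"
    have keys_e: "Poly_Mapping.keys ?e = {1, n}" by (simp add: keys_squarefree_monomial)
    have face: "{1, n} \<in> faces n" using n by (auto simp: faces_def has_path_edge_def)
    then have "Poly_Mapping.single ?e 1 \<in> (cycle_ideal n :: 'k mpolynomial set)"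
      by (intro single_in_cycle_ideal) (simp only: keys_e)
    then have "Poly_Mapping.single ?e 1 \<in> adjoin_list fs (cycle_ideal n) (path_ideal n)"
      by (simp only: eq)
    then obtain y b where yb: "Poly_Mapping.single ?e 1 = (\<Sum>j<length fs. fs ! j * y j) + b" "b \<in> path_ideal n"
        "y \<in> {..<length fs} \<rightarrow> cycle_ideal n"
      unfolding adjoin_list_eq by (elim CollectE exE conjE) (rule that)
    have "Poly_Mapping.lookup (fs ! j * y j) ?e = 0" if j: "j < length fs" for j
    proof (rule ccontr)
      assume "Poly_Mapping.lookup (fs ! j * y j) ?e \<noteq> 0"
      then have "?e \<in> Poly_Mapping.keys (fs ! j * y j)" by (simp add: in_keys_iff)
      then obtain a c where ac: "a \<in> Poly_Mapping.keys (fs ! j)" "c \<in> Poly_Mapping.keys (y j)" "?e = a + c"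
        by (rule keys_multE)
      have sub: "Poly_Mapping.keys a \<union> Poly_Mapping.keys c = {1, n}"
        using keys_e unfolding ac(3) keys_plus_nat .
      have "fs ! j \<in> linear_form ` set (blocks n)" using j by (simp add: fs_def)
      then obtain B where "fs ! j = linear_form B" by auto
      then have "\<exists>i. a = Poly_Mapping.single i 1"
        using ac(1) keys_sum_var[of a B, where ?'k = 'k] by auto
      then obtain i where i: "a = Poly_Mapping.single i 1" by blast
      have "y j \<in> cycle_ideal n" using yb(3) j by auto
      then have "has_path_edge n (Poly_Mapping.keys c) \<or> 1 \<in> Poly_Mapping.keys c \<and> n \<in> Poly_Mapping.keys c"
        using ac(2) by (auto simp: cycle_ideal_def monomial_span_def)
      moreover have "\<not> has_path_edge n (Poly_Mapping.keys c)"
        using has_path_edge_mono[of n "Poly_Mapping.keys c" "{1, n}"] sub face by (auto simp: faces_def)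
      moreover have "i \<in> {1, n}" using sub unfolding i by auto
      ultimately have "i \<in> Poly_Mapping.keys c" by blast
      then have "Poly_Mapping.lookup ?e i \<ge> 2" unfolding ac(3) i by (simp add: lookup_add in_keys_iff)
      then show False by (simp add: lookup_squarefree_monomial split: if_splits)
    qed
    moreover have "Poly_Mapping.lookup b ?e = 0"
      using path_ideal_keys[OF yb(2), of ?e] face unfolding keys_e by (auto simp only: in_keys_iff)
    moreover have "Poly_Mapping.lookup (Poly_Mapping.single ?e (1::'k)) ?e = Poly_Mapping.lookup ((\<Sum>j<length fs. fs ! j * y j) + b) ?e"
      using yb(1) by simp
    ultimately show False by (simp add: lookup_add lookup_sum)
  qed
  ultimately show ?thesis unfolding fs_def[symmetric] regular_sequence_iff[OF fs] layers by blast
qed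

text \<open>The facet is maximal, so any further variable creates an edge; this supplies the
  annihilation hypothesis of \<open>weakly_regular_length_le\<close>.\<close>

lemma regular_sequence_length_le:
  fixes fs :: "'k::field mpolynomial list"
  assumes n: "n \<ge> 3" and fs: "set fs \<subseteq> graded_max_ideal n"
    and reg: "regular_sequence (ideal_quot (poly_ring {1..n}) (cycle_ideal n) (path_ideal n)) fs"
  shows "length fs \<le> 2 + (n - 2) div 3"
proof -
  interpret ideal_quotient "{1..n}" "path_ideal n :: 'k mpolynomial set" "cycle_ideal n"
    by (rule ideal_quotient_path_cycle)
  let ?Z = "small_facet n"
  note Z = small_facet_face[OF n]
  have fin: "finite ?Z" using Z by (rule finite_face)
  have keys: "Poly_Mapping.keys (squarefree_monomial ?Z) = ?Z" by (rule keys_squarefree_monomial[OF fin])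
  have "length fs \<le> card ?Z"
  proof (rule weakly_regular_length_le[where Z = ?Z and e = "squarefree_monomial ?Z"])
    show "set fs \<subseteq> monomial_span {1..n} (\<lambda>m. \<exists>i\<in>{1..n}. i \<in> Poly_Mapping.keys m)"
      using fs by (simp only: graded_max_ideal_eq)
    show "weakly_regular fs (cycle_ideal n) (path_ideal n)"
      using reg fs graded_max_ideal_subset[of n, where ?'a = 'k] by (subst (asm) regular_sequence_iff) auto
    show "Poly_Mapping.single (squarefree_monomial ?Z) 1 \<in> (cycle_ideal n :: 'k mpolynomial set)"
      using Z by (intro single_in_cycle_ideal) (simp only: keys)
    show "squarefree_monomial ?Z \<notin> Poly_Mapping.keys p" if "p \<in> path_ideal n" for p :: "'k mpolynomial"
      using path_ideal_keys[OF that] Z keys by metis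
    show "Poly_Mapping.single (m + squarefree_monomial ?Z) c \<in> path_ideal n"
      if m: "Poly_Mapping.keys m \<subseteq> {1..n}" "\<not> Poly_Mapping.keys m \<subseteq> ?Z" for m and c :: 'k
    proof -
      obtain j where j: "j \<in> Poly_Mapping.keys m" "j \<notin> ?Z" using m by blast
      have "has_path_edge n (insert j ?Z)"
        using small_facet_maximal[OF n _ j(2)] m j by blast
      then have "has_path_edge n (Poly_Mapping.keys m \<union> ?Z)"
        using j by (auto elim: has_path_edge_mono)
      moreover have "?Z \<subseteq> {1..n}" using Z by (simp add: faces_def)
      ultimately show ?thesis
        using m by (auto simp: path_ideal_def monomial_span_def keys_plus_nat keys)
    qed
  qed (use fin in auto)
  also have "\<dots> \<le> 2 + (n - 2) div 3" by (rule card_small_facet[OF n])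
  finally show ?thesis .
qed

lemma depth_cycle_mod_path:
  assumes n: "n \<ge> 3"
  shows "depth (graded_max_ideal n) (ideal_quot (poly_ring {1..n}) (cycle_ideal n) (path_ideal n :: 'k::field mpolynomial set))
    = 2 + (n - 2) div 3"
  unfolding depth_def
proof (rule Max_eqI)
  let ?Q = "ideal_quot (poly_ring {1..n}) (cycle_ideal n) (path_ideal n :: 'k mpolynomial set)"
  let ?X = "{length fs | fs. set fs \<subseteq> graded_max_ideal n \<and> regular_sequence ?Q fs}"
  show le: "x \<le> 2 + (n - 2) div 3" if "x \<in> ?X" for x
    using that regular_sequence_length_le[OF n] by blast
  \<comment> \<open>Finiteness of the set of lengths, without which \<open>Max\<close> is
    unspecified, comes from the upper bound itself.\<close>
  then have "?X \<subseteq> {..2 + (n - 2) div 3}" by blast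
  then show "finite ?X" by (rule finite_subset) simp
  have "linear_form B \<in> (graded_max_ideal n :: 'k mpolynomial set)" if "B \<in> set (blocks n)" for B
  proof -
    have B: "B \<subseteq> {1..n}" using that n by (auto simp: blocks_def simp del: upt_Suc)
    have "\<exists>i\<in>{1..n}. i \<in> Poly_Mapping.keys m" if "m \<in> Poly_Mapping.keys (linear_form B :: 'k mpolynomial)" for m
      using keys_sum_var[OF that] B by auto
    then show ?thesis
      using linear_form_carrier[OF B, where ?'a = 'k] by (simp add: graded_max_ideal_eq monomial_span_def)
  qed
  then show "2 + (n - 2) div 3 \<in> ?X"
    using regular_sequence_blocks[OF n, where ?'k = 'k] length_blocks[of n]
    by (intro CollectI exI[of _ "map linear_form (blocks n)"]) auto
qed

section \<open>Stanley depth\<close>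

text \<open>Otherwise the simplifier turns \<open>{1..n}\<close> into \<open>{Suc 0..n}\<close>, to which the interpreted facts of
  \<open>ideal_quotient\<close> do not apply.\<close>

declare One_nat_def [simp del]

lemma face_not_in_path_ideal:
  "Poly_Mapping.keys m \<in> faces n \<Longrightarrow> p \<in> path_ideal n \<Longrightarrow> Poly_Mapping.lookup p m = 0"
  using path_ideal_keys by (auto simp: in_keys_iff)

text \<open>The class of $x_Z$ is only a sum of members of the Stanley spaces. Comparing
  coefficients at $x_Z$ yields one summand with a representative in which $x_Z$ occurs, and the
  variables of its space are then confined to \<open>small_facet n\<close>.\<close>

lemma decomposition_sdepth_le:
  fixes D :: "('k::field mpolynomial set \<times> nat set) list"
  assumes n: "n \<ge> 3"
    and D: "stanley_decomposition n (ideal_quot (poly_ring {1..n}) (cycle_ideal n) (path_ideal n))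
      (ideal_quot_component n (cycle_ideal n) (path_ideal n)) D"
  shows "decomposition_sdepth D \<le> 2 + (n - 2) div 3"
proof -
  interpret ideal_quotient "{1..n}" "path_ideal n :: 'k mpolynomial set" "cycle_ideal n"
    by (rule ideal_quotient_path_cycle)
  let ?Z = "small_facet n" and ?N = "{..<length D}"
  let ?e = "squarefree_monomial ?Z"
  let ?u = "Poly_Mapping.single ?e 1 :: 'k mpolynomial"
  note Z = small_facet_face[OF n]
  have fin: "finite ?Z" using Z by (rule finite_face)
  have keys: "Poly_Mapping.keys ?e = ?Z" by (rule keys_squarefree_monomial[OF fin])
  have "?u \<in> cycle_ideal n" using Z by (intro single_in_cycle_ideal) (simp only: keys)
  then have "cls ?u \<in> carrier Q" by (simp add: carrier_Q)
  then obtain y where y: "y \<in> (\<Pi>\<^sub>E i\<in>?N. stanley_space Q (fst (D ! i)) (snd (D ! i)))"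
      "cls ?u = (\<Oplus>\<^bsub>Q\<^esub>i\<in>?N. y i)"
    using ex1_implies_ex[OF bspec[OF conjunct2[OF D[unfolded stanley_decomposition_def]] \<open>cls ?u \<in> carrier Q\<close>]] by blast
  \<comment> \<open>A homogeneous representative \<open>p\<close> of the generator, a coefficient
    \<open>v\<close> and the freeness of the space, all expressed modulo $I_n$, are packed together
    so that one choice fixes them for all indices.\<close>
  define P where "P i p v \<longleftrightarrow> p \<in> cycle_ideal n \<and> y i = cls (v * p) \<and> v \<in> poly_carrier (snd (D ! i))
      \<and> (\<exists>a. \<forall>m\<in>Poly_Mapping.keys p. (\<lambda>i. int (Poly_Mapping.lookup m i)) = a)
      \<and> snd (D ! i) \<subseteq> {1..n} \<and> (\<forall>u\<in>poly_carrier (snd (D ! i)). u * p \<in> path_ideal n \<longrightarrow> u = 0)" for i p v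
  have "\<exists>p v. P i p v"
    if iN: "i \<in> ?N" for i
  proof -
    have "D ! i \<in> set D" using iN by simp
    then obtain a where i: "fst (D ! i) \<in> ideal_quot_component n (cycle_ideal n) (path_ideal n) a"
        "snd (D ! i) \<subseteq> {1..n}" "\<forall>u\<in>poly_carrier (snd (D ! i)). u \<odot>\<^bsub>Q\<^esub> fst (D ! i) = \<zero>\<^bsub>Q\<^esub> \<longrightarrow> u = 0"
      using bspec[OF conjunct1[OF D[unfolded stanley_decomposition_def]] \<open>D ! i \<in> set D\<close>]
      unfolding case_prod_beta by blast
    then obtain p where p: "p \<in> cycle_ideal n" "p \<in> poly_component n a" "fst (D ! i) = cls p"
      unfolding ideal_quot_component_def by blast
    have mono: "poly_carrier (snd (D ! i)) \<subseteq> (poly_carrier {1..n} :: 'k mpolynomial set)"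
      using i(2) by (rule poly_carrier_mono)
    obtain v where v: "v \<in> poly_carrier (snd (D ! i))" "y i = v \<odot>\<^bsub>Q\<^esub> fst (D ! i)"
      using PiE_mem[OF y(1) iN] unfolding stanley_space_def by blast
    have smult: "u \<odot>\<^bsub>Q\<^esub> fst (D ! i) = cls (u * p)" if "u \<in> poly_carrier (snd (D ! i))" for u
      using smult_Q[of u p] mono that p(3) by auto
    have free: "u = 0" if "u \<in> poly_carrier (snd (D ! i))" "u * p \<in> path_ideal n" for u
      using i(3) that smult[OF that(1)] by (simp add: zero_Q cls_eq_iff)
    show ?thesis
      using p v i(2) free smult[OF v(1)] unfolding poly_component_def P_def by (intro exI[of _ p] exI[of _ v]) auto
  qed
  then obtain p v where pv: "\<And>i. i \<in> ?N \<Longrightarrow> P i (p i) (v i)" by metis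
  then have p: "\<And>i. i \<in> ?N \<Longrightarrow> p i \<in> cycle_ideal n"
    and y_eq: "\<And>i. i \<in> ?N \<Longrightarrow> y i = cls (v i * p i)"
    and v: "\<And>i. i \<in> ?N \<Longrightarrow> v i \<in> poly_carrier (snd (D ! i))"
    and homog: "\<And>i. i \<in> ?N \<Longrightarrow> \<exists>a. \<forall>m\<in>Poly_Mapping.keys (p i). (\<lambda>i. int (Poly_Mapping.lookup m i)) = a"
    and sub: "\<And>i. i \<in> ?N \<Longrightarrow> snd (D ! i) \<subseteq> {1..n}"
    and free: "\<And>i u. i \<in> ?N \<Longrightarrow> u \<in> poly_carrier (snd (D ! i)) \<Longrightarrow> u * p i \<in> path_ideal n \<Longrightarrow> u = 0"
    unfolding P_def by simp_all
  have "v i \<in> poly_carrier {1..n}" if "i \<in> ?N" for i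
    using poly_carrier_mono[OF sub[OF that]] v[OF that] by blast
  then have "(\<Oplus>\<^bsub>Q\<^esub>i\<in>?N. y i) = cls (\<Sum>i\<in>?N. v i * p i)"
    using p
    by (intro finsum_Q y_eq J_closed(5)) simp_all
  with y(2) have "?u - (\<Sum>i\<in>?N. v i * p i) \<in> path_ideal n" by (simp add: cls_eq_iff)
  then have "Poly_Mapping.lookup (?u - (\<Sum>i\<in>?N. v i * p i)) ?e = 0"
    using Z by (intro face_not_in_path_ideal) (simp_all only: keys)
  then have "(\<Sum>i\<in>?N. Poly_Mapping.lookup (v i * p i) ?e) \<noteq> 0" by (simp add: lookup_minus lookup_sum)
  then obtain i where i: "i \<in> ?N" "?e \<in> Poly_Mapping.keys (v i * p i)"
    by (metis (no_types, lifting) in_keys_iff sum.not_neutral_contains_not_neutral)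
  then obtain a b where ab: "a \<in> Poly_Mapping.keys (v i)" "b \<in> Poly_Mapping.keys (p i)" "?e = a + b"
    by (elim keys_multE)
  \<comment> \<open>A single multidegree leaves room for only one monomial, so \<open>p i\<close> is
    a scalar multiple of $x^b$.\<close>
  have uniq: "m = b" if "m \<in> Poly_Mapping.keys (p i)" for m
  proof (rule poly_mapping_eqI)
    fix k
    have "(\<lambda>k. int (Poly_Mapping.lookup m k)) = (\<lambda>k. int (Poly_Mapping.lookup b k))"
      using homog[OF i(1)] that ab(2) by metis
    from fun_cong[OF this, of k] show "Poly_Mapping.lookup m k = Poly_Mapping.lookup b k" by simp
  qed
  have "snd (D ! i) \<subseteq> ?Z"
  proof
    fix j assume j: "j \<in> snd (D ! i)"
    \<comment> \<open>Freeness is tested on the single term $x^a x_j$. Its product with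
      \<open>p i\<close> is a scalar multiple of $x_Z x_j$, which would lie in $I_n$ if
      \<open>j\<close> were outside the maximal face.\<close>
    let ?w = "Poly_Mapping.single (a + Poly_Mapping.single j 1) 1 :: 'k mpolynomial"
    have "Poly_Mapping.keys a \<subseteq> snd (D ! i)" using v[OF i(1)] ab(1) by (auto simp: poly_carrier_iff)
    then have "?w \<in> poly_carrier (snd (D ! i))"
      using j by (intro in_poly_carrier(3)) (auto simp: keys_plus_nat)
    moreover have "?w \<noteq> 0" by (metis single_zero lookup_single_eq lookup_zero zero_neq_one)
    ultimately have notin: "?w * p i \<notin> path_ideal n" using free[OF i(1)] by blast
    have "?w * p i \<in> poly_carrier {1..n}"
      using \<open>?w \<in> _\<close> p[OF i(1)] poly_carrier_mono[OF sub[OF i(1)]] J_carrier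
      by (intro poly_carrier_closed) auto
    with notin obtain m where m: "m \<in> Poly_Mapping.keys (?w * p i)" "\<not> has_path_edge n (Poly_Mapping.keys m)"
      by (auto simp: path_ideal_def monomial_span_def)
    then obtain m' where "m' \<in> Poly_Mapping.keys (p i)" "m = a + Poly_Mapping.single j 1 + m'"
      using keys_single_mult by blast
    then have "m = ?e + Poly_Mapping.single j 1" using uniq ab(3) by (simp add: ac_simps)
    then have "Poly_Mapping.keys m = insert j ?Z" by (simp only: keys_plus_nat keys) simp
    moreover have "j \<in> {1..n}" using sub[OF i(1)] j by (rule subsetD)
    ultimately show "j \<in> ?Z"
      using m(2) small_facet_maximal[OF n, of j] by metis
  qed
  then have "card (snd (D ! i)) \<le> card ?Z" using fin by (rule card_mono[rotated])
  moreover have "decomposition_sdepth D \<le> card (snd (D ! i))"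
    unfolding decomposition_sdepth_def using i(1)
    by (intro Min_le) (auto simp: case_prod_beta image_iff intro!: bexI[of _ "D ! i"])
  ultimately show ?thesis using card_small_facet[OF n] by linarith
qed

section \<open>The interval decomposition\<close>

definition core_span :: "nat \<Rightarrow> nat set \<Rightarrow> 'k::field mpolynomial set"
  where "core_span n F = monomial_span {1..n} (\<lambda>m. Poly_Mapping.keys m \<in> faces n \<and> Poly_Mapping.keys m - centers n = F)"

text \<open>By \<open>core_eq_iff\<close> the supports on the left are those between
  \<open>F\<close> and its saturation; division by $x_F$ then leaves an arbitrary polynomial in the
  variables of the saturation.\<close>

lemma core_span_eq:
  assumes F: "F \<in> cores n"
  shows "core_span n F = {u * face_poly F | u. u \<in> poly_carrier (saturation n F)} " (is "?A = ?B")
proof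
  have face: "F \<in> faces n" using F by (simp add: cores_def)
  then have fin: "finite F" by (rule finite_face)
  have "saturation n F \<in> faces n" using face by (rule saturation_face)
  then have sat: "saturation n F \<subseteq> {1..n}" by (simp add: faces_def)
  show "?A \<subseteq> ?B"
  proof
    fix q assume q: "q \<in> ?A"
    then have keys: "F \<subseteq> Poly_Mapping.keys m" "Poly_Mapping.keys m \<subseteq> saturation n F" if "m \<in> Poly_Mapping.keys q" for m
      using that core_eq_iff[OF F, of "Poly_Mapping.keys m"] by (auto simp: core_span_def monomial_span_def)
    then have "q \<in> poly_carrier (saturation n F)" by (auto simp: poly_carrier_iff)
    then obtain a where "a \<in> poly_carrier (saturation n F)" "q = face_poly F * a"
      using keys(1) by (rule face_poly_dvd[OF fin])
    then show "q \<in> ?B" by (auto simp: mult.commute)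
  qed
  show "?B \<subseteq> ?A"
  proof
    fix q assume "q \<in> ?B"
    then obtain u where u: "u \<in> poly_carrier (saturation n F)" "q = face_poly F * u" by (auto simp: mult.commute)
    have "Poly_Mapping.keys m \<in> faces n \<and> Poly_Mapping.keys m - centers n = F" if m: "m \<in> Poly_Mapping.keys q" for m
    proof -
      obtain m' where m': "m' \<in> Poly_Mapping.keys u" "m = squarefree_monomial F + m'"
        using m u(2) keys_single_mult by blast
      then have keys: "Poly_Mapping.keys m = F \<union> Poly_Mapping.keys m'"
        by (simp add: keys_plus_nat keys_squarefree_monomial fin)
      have "Poly_Mapping.keys m' \<subseteq> saturation n F" using u m' by (auto simp: poly_carrier_iff)
      then have "Poly_Mapping.keys m \<subseteq> saturation n F" using keys by (auto simp: saturation_def)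
      then show ?thesis using between_core_and_saturation[OF F, of "Poly_Mapping.keys m"] keys by auto
    qed
    moreover from this have "q \<in> poly_carrier {1..n}" by (auto simp: poly_carrier_iff faces_def)
    ultimately show "q \<in> ?A" by (simp add: core_span_def monomial_span_def)
  qed
qed

lemma sum_cond_nth:
  assumes "distinct xs" "x \<in> set xs"
  shows "(\<Sum>i<length xs. if x = xs ! i then c else 0) = (c :: 'a::comm_monoid_add)"
proof -
  obtain k where k: "k < length xs" "xs ! k = x" using assms(2) by (auto simp: in_set_conv_nth)
  have "(\<Sum>i<length xs. if x = xs ! i then c else 0) = (\<Sum>i<length xs. if i = k then c else 0)"
    using k assms(1) by (intro sum.cong) (auto simp: nth_eq_iff_index_eq)
  then show ?thesis using k by simp
qed

definition interval_decomposition :: "nat \<Rightarrow> nat set list \<Rightarrow> ('k::field mpolynomial set \<times> nat set) list"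
  where "interval_decomposition n Fs =
    map (\<lambda>F. (path_ideal n +>\<^bsub>ideal_module (poly_ring {1..n}) (cycle_ideal n)\<^esub> face_poly F, saturation n F)) Fs"

text \<open>Existence: an element of $J_n$ is split according to the cores of its face monomials,
  and the rest lies in $I_n$. Uniqueness: different cores share no monomial and elements of $I_n$
  contain no face monomial, so coefficients can be compared one by one.\<close>

lemma stanley_decomposition_intervals:
  assumes n: "n \<ge> 3" and Fs: "distinct Fs" "set Fs = cores n"
  shows "stanley_decomposition n (ideal_quot (poly_ring {1..n}) (cycle_ideal n) (path_ideal n))
      (ideal_quot_component n (cycle_ideal n) (path_ideal n))
      (interval_decomposition n Fs :: ('k::field mpolynomial set \<times> nat set) list)"
proof -
  interpret ideal_quotient "{1..n}" "path_ideal n :: 'k mpolynomial set" "cycle_ideal n"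
    by (rule ideal_quotient_path_cycle)
  let ?D = "interval_decomposition n Fs :: ('k mpolynomial set \<times> nat set) list"
  let ?N = "{..<length ?D}"
  have len: "length ?D = length Fs" by (simp add: interval_decomposition_def)
  have core: "F \<in> faces n" "finite F" "F \<subseteq> {1..n}" "saturation n F \<subseteq> {1..n}" if "F \<in> cores n" for F
    using that saturation_face[of F n] by (auto simp: cores_def faces_def intro: finite_face)
  have keys: "Poly_Mapping.keys (squarefree_monomial F) = F" if "F \<in> cores n" for F
    using core(2)[OF that] by (rule keys_squarefree_monomial)
  have face_J: "face_poly F \<in> cycle_ideal n" if "F \<in> cores n" for F
    using core(1)[OF that] by (intro single_in_cycle_ideal) (simp only: keys[OF that])
  have space: "stanley_space Q (fst (?D ! i)) (snd (?D ! i)) = cls ` core_span n (Fs ! i)" if "i \<in> ?N" for i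
  proof -
    let ?F = "Fs ! i"
    have i: "i < length Fs" and F: "?F \<in> cores n" using that Fs len by (auto simp flip: Fs(2))
    have "stanley_space Q (fst (?D ! i)) (snd (?D ! i)) = {u \<odot>\<^bsub>Q\<^esub> cls (face_poly ?F) | u. u \<in> poly_carrier (saturation n ?F)}"
      using i by (simp add: stanley_space_def interval_decomposition_def)
    also have "\<dots> = {cls (u * face_poly ?F) | u. u \<in> poly_carrier (saturation n ?F)}"
    proof -
      have "u \<odot>\<^bsub>Q\<^esub> cls (face_poly ?F) = cls (u * face_poly ?F)" if "u \<in> poly_carrier (saturation n ?F)" for u
        using that poly_carrier_mono[OF core(4)[OF F]] by (intro smult_Q) auto
      then show ?thesis by (metis (lifting))
    qed
    also have "\<dots> = cls ` core_span n ?F" unfolding core_span_eq[OF F] by blast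
    finally show ?thesis .
  qed
  have span_J: "q \<in> cycle_ideal n" if "q \<in> core_span n F" for q :: "'k mpolynomial" and F
    using that by (auto simp: core_span_def cycle_ideal_faces monomial_span_def)
  have pieces: "m \<in> carrier Q \<and> (\<exists>a\<in>multidegrees n. m \<in> ideal_quot_component n (cycle_ideal n) (path_ideal n) a) \<and>
       Z \<subseteq> {1..n} \<and> (\<forall>u\<in>poly_carrier Z. u \<odot>\<^bsub>Q\<^esub> m = \<zero>\<^bsub>Q\<^esub> \<longrightarrow> u = 0)"
    if mZ: "(m, Z) \<in> set ?D" for m Z
  proof -
    obtain F where F: "F \<in> cores n" "m = cls (face_poly F)" "Z = saturation n F"
      using mZ Fs(2) by (auto simp: interval_decomposition_def)
    let ?a = "\<lambda>i. int (Poly_Mapping.lookup (squarefree_monomial F) i)"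
    have "?a \<in> multidegrees n"
      using core[OF F(1)] by (auto simp: multidegrees_def lookup_squarefree_monomial)
    moreover have "face_poly F \<in> poly_component n ?a"
      using core(3)[OF F(1)] keys[OF F(1)] by (auto simp: poly_component_def)
    then have "m \<in> ideal_quot_component n (cycle_ideal n) (path_ideal n) ?a"
      unfolding ideal_quot_component_def F(2) using face_J[OF F(1)] by blast
    moreover have "u = 0" if u: "u \<in> poly_carrier Z" "u \<odot>\<^bsub>Q\<^esub> m = \<zero>\<^bsub>Q\<^esub>" for u
    proof -
      have "u \<in> poly_carrier {1..n}" using u(1) poly_carrier_mono[OF core(4)[OF F(1)]] F(3) by auto
      then have "u * face_poly F \<in> path_ideal n"
        using u(2) by (simp add: F(2) smult_Q zero_Q cls_eq_iff)
      then have uI: "face_poly F * u \<in> path_ideal n" by (simp add: mult.commute)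
      have "face_poly F * u \<in> core_span n F"
        unfolding core_span_eq[OF F(1)] using u(1) F(3) by (auto simp: mult.commute)
      \<comment> \<open>The product has only face monomials, yet it lies in $I_n$, whose elements
        have none. Multiplication by a monomial merely shifts the keys, so \<open>u\<close> has no
        keys either.\<close>
      then have "Poly_Mapping.keys (face_poly F * u) = {}"
        using path_ideal_keys[OF uI] by (auto simp: core_span_def monomial_span_def)
      then have "m \<notin> Poly_Mapping.keys u" for m
        using keys_single_mult_mem[of m u "1::'k" "squarefree_monomial F"] by auto
      then show ?thesis by (intro poly_mapping_eqI) (simp add: in_keys_iff)
    qed
    moreover have "m \<in> carrier Q" unfolding carrier_Q F(2) using face_J[OF F(1)] by (rule imageI)
    ultimately show ?thesis using core(4)[OF F(1)] F(3) by blast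
  qed
  have ex: "\<exists>y. y \<in> (\<Pi>\<^sub>E i\<in>?N. cls ` core_span n (Fs ! i)) \<and> x = (\<Oplus>\<^bsub>Q\<^esub>i\<in>?N. y i)"
    if x: "x \<in> carrier Q" for x
  proof -
    obtain p where p: "p \<in> cycle_ideal n" "x = cls p" using x by (auto simp: carrier_Q)
    define q where "q i = restrict_keys (\<lambda>m. Poly_Mapping.keys m \<in> faces n \<and> Poly_Mapping.keys m - centers n = Fs ! i) p" for i
    have q: "q i \<in> core_span n (Fs ! i)" for i
      using p(1) by (auto simp: q_def core_span_def monomial_span_def cycle_ideal_faces keys_restrict_keys poly_carrier_iff)
    let ?r = "p - (\<Sum>i\<in>?N. q i)"
    have "?r \<in> cycle_ideal n"
      using p(1) by (intro J_closed(4) submodule_set_sum[OF sub_J] span_J[OF q])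
    moreover have "Poly_Mapping.lookup ?r m = 0" if m: "Poly_Mapping.keys m \<in> faces n" for m
    proof -
      have "Poly_Mapping.keys m - centers n \<in> set Fs" using face_core[OF m n] Fs by simp
      then have "(\<Sum>i<length Fs. if Poly_Mapping.keys m - centers n = Fs ! i then Poly_Mapping.lookup p m else 0) = Poly_Mapping.lookup p m"
        by (rule sum_cond_nth[OF Fs(1)])
      then show ?thesis using m by (simp add: lookup_minus lookup_sum q_def lookup_restrict_keys len)
    qed
    ultimately have "?r \<in> path_ideal n"
      by (auto simp: cycle_ideal_faces path_ideal_def monomial_span_def in_keys_iff)
    then have "x = cls (\<Sum>i\<in>?N. q i)" by (simp add: p(2) cls_eq_iff)
    \<comment> \<open>Members of an extensional product are \<open>undefined\<close> outside the
      index set, hence the \<open>restrict\<close>.\<close>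
    also have "\<dots> = (\<Oplus>\<^bsub>Q\<^esub>i\<in>?N. restrict (\<lambda>i. cls (q i)) ?N i)"
      using span_J[OF q] by (intro finsum_Q[symmetric]) auto
    finally show ?thesis using q by (intro exI[of _ "restrict (\<lambda>i. cls (q i)) ?N"]) auto
  qed
  have unique: "y = y'"
    if y: "y \<in> (\<Pi>\<^sub>E i\<in>?N. cls ` core_span n (Fs ! i))" and y': "y' \<in> (\<Pi>\<^sub>E i\<in>?N. cls ` core_span n (Fs ! i))"
      and eq: "(\<Oplus>\<^bsub>Q\<^esub>i\<in>?N. y i) = (\<Oplus>\<^bsub>Q\<^esub>i\<in>?N. y' i)" for y y'
  proof -
    have "\<forall>i\<in>?N. \<exists>q. q \<in> core_span n (Fs ! i) \<and> y i = cls q" using y by (auto dest: PiE_mem)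
    then obtain q where q: "\<And>i. i \<in> ?N \<Longrightarrow> q i \<in> core_span n (Fs ! i)" "\<And>i. i \<in> ?N \<Longrightarrow> y i = cls (q i)" by metis
    have "\<forall>i\<in>?N. \<exists>q. q \<in> core_span n (Fs ! i) \<and> y' i = cls q" using y' by (auto dest: PiE_mem)
    then obtain q' where q': "\<And>i. i \<in> ?N \<Longrightarrow> q' i \<in> core_span n (Fs ! i)" "\<And>i. i \<in> ?N \<Longrightarrow> y' i = cls (q' i)" by metis
    have "(\<Oplus>\<^bsub>Q\<^esub>i\<in>?N. y i) = cls (\<Sum>i\<in>?N. q i)"
      by (rule finsum_Q[OF _ span_J[OF q(1)] q(2)]) simp_all
    moreover have "(\<Oplus>\<^bsub>Q\<^esub>i\<in>?N. y' i) = cls (\<Sum>i\<in>?N. q' i)"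
      by (rule finsum_Q[OF _ span_J[OF q'(1)] q'(2)]) simp_all
    ultimately have "cls (\<Sum>i\<in>?N. q i) = cls (\<Sum>i\<in>?N. q' i)" using eq by (simp only:)
    then have diff: "(\<Sum>i\<in>?N. q i) - (\<Sum>i\<in>?N. q' i) \<in> path_ideal n" by (simp add: cls_eq_iff)
    \<comment> \<open>A monomial with core \<open>Fs ! i\<close> can occur in the
      \<open>i\<close>-th summand only, because \<open>Fs\<close> is distinct.\<close>
    have single: "Poly_Mapping.lookup (\<Sum>j\<in>?N. r j) m = Poly_Mapping.lookup (r i) m"
      if r: "\<And>j. j \<in> ?N \<Longrightarrow> r j \<in> core_span n (Fs ! j)" and i: "i \<in> ?N" and m: "Poly_Mapping.keys m - centers n = Fs ! i"
      for r :: "nat \<Rightarrow> 'k mpolynomial" and i m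
    proof -
      have "Poly_Mapping.lookup (r j) m = 0" if j: "j \<in> ?N - {i}" for j
      proof (rule ccontr)
        assume "Poly_Mapping.lookup (r j) m \<noteq> 0"
        then have "Fs ! j = Fs ! i" using r[of j] m j by (auto simp: core_span_def monomial_span_def in_keys_iff)
        then show False using j i len Fs(1) by (auto simp: nth_eq_iff_index_eq)
      qed
      then have "(\<Sum>j\<in>?N. Poly_Mapping.lookup (r j) m) = Poly_Mapping.lookup (r i) m"
        using i by (subst sum.remove[of _ i]) auto
      then show ?thesis by (simp add: lookup_sum)
    qed
    have "q i = q' i" if i: "i \<in> ?N" for i
    proof (rule poly_mapping_eqI)
      fix m
      show "Poly_Mapping.lookup (q i) m = Poly_Mapping.lookup (q' i) m"
      proof (cases "Poly_Mapping.keys m \<in> faces n \<and> Poly_Mapping.keys m - centers n = Fs ! i")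
        case True
        then have "Poly_Mapping.lookup ((\<Sum>i\<in>?N. q i) - (\<Sum>i\<in>?N. q' i)) m = 0"
          using diff face_not_in_path_ideal by blast
        then show ?thesis
          using single[of q i m] single[of q' i m] q(1) q'(1) i True by (simp add: lookup_minus)
      next
        case False
        then have "m \<notin> Poly_Mapping.keys (q i)" "m \<notin> Poly_Mapping.keys (q' i)"
          using q(1)[OF i] q'(1)[OF i] unfolding core_span_def monomial_span_def by blast+
        then show ?thesis by (simp add: in_keys_iff)
      qed
    qed
    then have "y i = y' i" if "i \<in> ?N" for i using that q(2) q'(2) by simp
    with y y' show ?thesis by (rule PiE_ext)
  qed
  have Pi_eq: "(\<Pi>\<^sub>E i\<in>?N. stanley_space Q (fst (?D ! i)) (snd (?D ! i))) = (\<Pi>\<^sub>E i\<in>?N. cls ` core_span n (Fs ! i))"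
    using space by (rule PiE_cong)
  show ?thesis
    unfolding stanley_decomposition_def Pi_eq
  proof (intro conjI ballI ex_ex1I)
    fix d assume "d \<in> set ?D"
    then show "case d of (m, Z) \<Rightarrow> m \<in> carrier Q \<and>
       (\<exists>a\<in>multidegrees n. m \<in> ideal_quot_component n (cycle_ideal n) (path_ideal n) a) \<and>
       Z \<subseteq> {1..n} \<and> (\<forall>u\<in>poly_carrier Z. u \<odot>\<^bsub>Q\<^esub> m = \<zero>\<^bsub>Q\<^esub> \<longrightarrow> u = 0)"
      using pieces[of "fst d" "snd d"] by (simp add: case_prod_beta)
  next
    fix x assume "x \<in> carrier Q"
    then show "\<exists>y. y \<in> (\<Pi>\<^sub>E i\<in>?N. cls ` core_span n (Fs ! i)) \<and> x = (\<Oplus>\<^bsub>Q\<^esub>i\<in>?N. y i)"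
      by (rule ex)
  next
    fix x y y'
    assume "y \<in> (\<Pi>\<^sub>E i\<in>?N. cls ` core_span n (Fs ! i)) \<and> x = (\<Oplus>\<^bsub>Q\<^esub>i\<in>?N. y i)"
      "y' \<in> (\<Pi>\<^sub>E i\<in>?N. cls ` core_span n (Fs ! i)) \<and> x = (\<Oplus>\<^bsub>Q\<^esub>i\<in>?N. y' i)"
    then show "y = y'" using unique[of y y'] by metis
  qed
qed

lemma sdepth_cycle_mod_path:
  assumes n: "n \<ge> 3"
  shows "sdepth n (ideal_quot (poly_ring {1..n}) (cycle_ideal n) (path_ideal n :: 'k::field mpolynomial set))
      (ideal_quot_component n (cycle_ideal n) (path_ideal n))
    = 2 + (n - 2) div 3"
  unfolding sdepth_def
proof (rule Max_eqI)
  let ?d = "2 + (n - 2) div 3"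
  let ?SD = "stanley_decomposition n (ideal_quot (poly_ring {1..n}) (cycle_ideal n) (path_ideal n :: 'k mpolynomial set))
      (ideal_quot_component n (cycle_ideal n) (path_ideal n))"
  let ?X = "{decomposition_sdepth D | D. ?SD D}"
  show le: "x \<le> ?d" if "x \<in> ?X" for x
    using that decomposition_sdepth_le[OF n] by blast
  then have "?X \<subseteq> {..?d}" by blast
  then show "finite ?X" by (rule finite_subset) simp
  obtain Fs where Fs: "distinct Fs" "set Fs = cores n"
    using finite_distinct_list[OF finite_cores] by blast
  let ?D = "interval_decomposition n Fs :: ('k mpolynomial set \<times> nat set) list"
  have SD: "?SD ?D" by (rule stanley_decomposition_intervals[OF n Fs])
  \<comment> \<open>The decomposition has to be nonempty, as \<open>Min\<close> of the empty set is
    unspecified; this face supplies a core.\<close>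
  have "{1, n} \<in> faces n" using n by (auto simp: faces_def has_path_edge_def)
  then have "cores n \<noteq> {}" using face_core[OF _ n] by blast
  then have "set ?D \<noteq> {}" using Fs by (auto simp: interval_decomposition_def)
  moreover have "?d \<le> card Z" if "(m, Z) \<in> set ?D" for m Z
    using that Fs card_saturation[OF n] by (auto simp: interval_decomposition_def)
  ultimately have "?d \<le> decomposition_sdepth ?D"
    unfolding decomposition_sdepth_def by (subst Min_ge_iff) auto
  moreover have "decomposition_sdepth ?D \<le> ?d" by (rule decomposition_sdepth_le[OF n SD])
  ultimately have "?d = decomposition_sdepth ?D" by simp
  with SD show "?d \<in> ?X" by blast
qed

theorem proposition1p10:
  fixes n :: nat
    and S :: "'k::field mpolynomial ring"
    and I J :: "'k mpolynomial set"
  assumes n: "n \<ge> 3"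
    and S: "S = poly_ring {1..n}"
    and I: "I = Idl\<^bsub>S\<^esub> {var i * var (i + 1) | i. i \<in> {1..n - 1}}"
    and J: "J = I <+>\<^bsub>S\<^esub> PIdl\<^bsub>S\<^esub> (var n * var 1)"
  shows "sdepth n (ideal_quot S J I) (ideal_quot_component n J I)
           = depth (graded_max_ideal n) (ideal_quot S J I) \<and>
         int (depth (graded_max_ideal n) (ideal_quot S J I)) = \<lceil>(real n + 2) / 3\<rceil>"
proof -
  have I': "I = path_ideal n" unfolding I S path_ideal_def by (rule path_ideal_eq)
  have J': "J = cycle_ideal n"
    unfolding J I' S path_ideal_def cycle_ideal_def by (rule cycle_ideal_eq[OF n])
  \<comment> \<open>With n = 3k + 2 + r and r <= 2 the fraction (n + 2)/3 lies between k + 4/3 and k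
    + 2, so its ceiling is k + 2.\<close>
  define k where "k = (n - 2) div 3"
  have "n = 3 * k + (n - 2) mod 3 + 2" "(n - 2) mod 3 \<le> 2"
    using n unfolding k_def by (simp_all add: less_Suc_eq_le[symmetric])
  then have "3 * k + 2 \<le> n" "n \<le> 3 * k + 4" by linarith+
  then have "real (3 * k + 2) \<le> real n" "real n \<le> real (3 * k + 4)" by (simp_all only: of_nat_le_iff)
  then have "\<lceil>(real n + 2) / 3\<rceil> = int (2 + k)"
    by (intro ceiling_unique) (auto simp: field_simps)
  then show ?thesis
    using sdepth_cycle_mod_path[OF n, where ?'k = 'k] depth_cycle_mod_path[OF n, where ?'k = 'k]
    by (simp add: I' J' S k_def)
qed

end
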